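(* Let $\hat G$ be a topological group (not necessarily Hausdorff), $G$ a topological subgroup of $\hat G$, $Q$ a locally compact Hausdorff group, and let $1\to G\to\hat G\xrightarrow{q}Q\to1$ be an exact sequence of abstract groups ($q$ is not assumed continuous). Let $\Lambda$ be a discrete subgroup of $Q$ admitting a group homomorphism $s_1\colon\Lambda\to\hat G$ with $q\circ s_1=\mathrm{id}_\Lambda$. Assume there is a relatively compact strict fundamental domain $B$ for the action of $\Lambda$ on $Q$ by left multiplication such that $B=\coprod_{i=1}^pB^i$ is a finite partition into Borel sets and, for each $i$, there is a continuous map $\bar s_2^i\colon\overline{B^i}\to\hat G$ with $q\circ\bar s_2^i=\mathrm{id}_{\overline{B^i}}$ (closure taken in $Q$). Then for every $\hat G$-quasi-invariant continuous quasimorphism $\phi\colon G\to\mathbb{R}$ there exists a quasimorphism $\hat\phi\colon\hat G\to\mathbb{R}$ with $\hat\phi|_G=\phi$ and $D(\hat\phi)\le D(\phi)+3D'(\phi)$.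
   Context: A quasimorphism on a group $G$ is $\phi\colon G\to\mathbb{R}$ with defect $D(\phi)=\sup_{x,y\in G}|\phi(xy)-\phi(x)-\phi(y)|<\infty$. For a normal subgroup $G\trianglelefteq\hat G$, $\phi$ is $\hat G$-quasi-invariant if there is $D'\ge0$ with $|\phi(\hat gx\hat g^{-1})-\phi(x)|\le D'$ for all $\hat g\in\hat G$, $x\in G$; $D'(\phi)$ is the smallest such $D'$. A strict fundamental domain for the action is a subset of $Q$ meeting each $\Lambda$-orbit in exactly one point. *)

theory Defs
  imports "HOL-Analysis.Analysis" "HOL-Algebra.Group"
begin

definition topological_group :: "('a, 'c) monoid_scheme \<Rightarrow> 'a topology \<Rightarrow> bool" where
  "topological_group G T \<longleftrightarrow> group G \<and> topspace T = carrier G \<and>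
     continuous_map (prod_topology T T) T (\<lambda>(x, y). x \<otimes>\<^bsub>G\<^esub> y) \<and>
     continuous_map T T (\<lambda>x. inv\<^bsub>G\<^esub> x)"

definition borel_sets_of :: "'a topology \<Rightarrow> 'a set set" where
  "borel_sets_of T = sigma_sets (topspace T) {U. openin T U}"

definition quasimorphism_on :: "('a, 'c) monoid_scheme \<Rightarrow> 'a set \<Rightarrow> ('a \<Rightarrow> real) \<Rightarrow> bool" where
  "quasimorphism_on G H \<phi> \<longleftrightarrow>
     (\<exists>C. \<forall>x\<in>H. \<forall>y\<in>H. \<bar>\<phi> (x \<otimes>\<^bsub>G\<^esub> y) - \<phi> x - \<phi> y\<bar> \<le> C)"

definition defect :: "('a, 'c) monoid_scheme \<Rightarrow> 'a set \<Rightarrow> ('a \<Rightarrow> real) \<Rightarrow> real" where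
  "defect G H \<phi> = (SUP p\<in>H \<times> H. \<bar>\<phi> (fst p \<otimes>\<^bsub>G\<^esub> snd p) - \<phi> (fst p) - \<phi> (snd p)\<bar>)"

definition quasi_invariant :: "('a, 'c) monoid_scheme \<Rightarrow> 'a set \<Rightarrow> ('a \<Rightarrow> real) \<Rightarrow> bool" where
  "quasi_invariant G H \<phi> \<longleftrightarrow>
     (\<exists>D\<ge>0. \<forall>g\<in>carrier G. \<forall>x\<in>H. \<bar>\<phi> (g \<otimes>\<^bsub>G\<^esub> x \<otimes>\<^bsub>G\<^esub> inv\<^bsub>G\<^esub> g) - \<phi> x\<bar> \<le> D)"

definition qi_defect :: "('a, 'c) monoid_scheme \<Rightarrow> 'a set \<Rightarrow> ('a \<Rightarrow> real) \<Rightarrow> real" where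
  "qi_defect G H \<phi> = Inf {D. D \<ge> 0 \<and>
     (\<forall>g\<in>carrier G. \<forall>x\<in>H. \<bar>\<phi> (g \<otimes>\<^bsub>G\<^esub> x \<otimes>\<^bsub>G\<^esub> inv\<^bsub>G\<^esub> g) - \<phi> x\<bar> \<le> D)}"

definition strict_fundamental_domain :: "('b, 'd) monoid_scheme \<Rightarrow> 'b set \<Rightarrow> 'b set \<Rightarrow> bool" where
  "strict_fundamental_domain Q L B \<longleftrightarrow> B \<subseteq> carrier Q \<and>
     (\<forall>x\<in>carrier Q. \<exists>!b. b \<in> B \<and> (\<exists>l\<in>L. b = l \<otimes>\<^bsub>Q\<^esub> x))"

end

(* Let D and D' be the two defects of phi.  The extension is first made over the lattice, then transferred.

   On Gamma = q^-1(L) put f(g) = phi(g s_1(q g)^-1): this extends phi with defect at most D + D'.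

   The transfer from Gamma to the whole group needs an invariant mean over L\Q.  The closure of B is
   compact and meets every L-orbit, which makes Q unimodular: if I is a left Haar functional on compactly
   supported continuous functions and w has mass one on every L-orbit, then unfolding the two iterated
   integrals of w(x) w(y) (sum over l in L of f(x^-1 l y)) gives I(w) I(f) and I(w) I(f(x^-1)).  No measure
   is needed, only the functional I, and this disposes of the Borel sets B^i: one of the finitely many
   closures has interior, so q has a continuous section there, hence near every point by translation, and
   finitely many such sections sigma_a carry weights rho_a with total mass one on every orbit.

   Averaging f(g s^-1) over the chosen lifts s of the points of the orbit of q(g) gives a function F on
   the big group with |F(gamma g) - f(gamma) - F(g)| <= D + D' for gamma in Gamma.  Let Phi(g) be the
   average of F(s g) over all chosen lifts s.  Decomposing s x = (s x t^-1) t for the lifts t of the orbit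
   of q(s x) shows that Phi has defect at most D + D', because the average of F(t y) over s and t is, by
   invariance of I, the average Phi(y); the same inequality gives |Phi(x h) - Phi(x) - phi(h)| <= D + 2D'
   and |Phi(h x) - Phi(x) - phi(h)| <= D + 2D' for h in G.

   Finally Phi is replaced by phi on G and by its odd part (Phi(x) - Phi(x^-1)) / 2 elsewhere.  Oddness
   handles the case x, y not in G, xy in G: it reduces to y = x^-1 (xy).  This gives D + 2D', a D' better than required. *)
theory Submission
  imports Defs "HOL-Algebra.Coset"
begin

section \<open>Compactly supported functions\<close>

definition Cc_on :: "'a topology \<Rightarrow> 'a set \<Rightarrow> ('a \<Rightarrow> real) set" where
  "Cc_on T U = {f. continuous_map T euclideanreal f \<and>
     (\<exists>K. compactin T K \<and> K \<subseteq> U \<and> (\<forall>x\<in>topspace T. x \<notin> K \<longrightarrow> f x = 0))}"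

abbreviation Cc :: "'a topology \<Rightarrow> ('a \<Rightarrow> real) set" where
  "Cc T \<equiv> Cc_on T UNIV"

definition Cc_nonneg :: "'a topology \<Rightarrow> ('a \<Rightarrow> real) set" where
  "Cc_nonneg T = {f \<in> Cc T. \<forall>x\<in>topspace T. 0 \<le> f x}"

definition Cc_pos :: "'a topology \<Rightarrow> ('a \<Rightarrow> real) set" where
  "Cc_pos T = {f \<in> Cc_nonneg T. \<exists>x\<in>topspace T. 0 < f x}"

lemma Cc_onI:
  assumes "continuous_map T euclideanreal f" "compactin T K" "K \<subseteq> U"
    and "\<And>x. x \<in> topspace T \<Longrightarrow> x \<notin> K \<Longrightarrow> f x = 0"
  shows "f \<in> Cc_on T U"
  using assms by (auto simp: Cc_on_def)

lemma Cc_on_continuous: "f \<in> Cc_on T U \<Longrightarrow> continuous_map T euclideanreal f"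
  by (simp add: Cc_on_def)

lemma Cc_on_support:
  assumes "f \<in> Cc_on T U"
  obtains K where "compactin T K" "K \<subseteq> U" "\<And>x. x \<in> topspace T \<Longrightarrow> x \<notin> K \<Longrightarrow> f x = 0"
  using assms unfolding Cc_on_def by blast

lemma Cc_on_imp_Cc: "f \<in> Cc_on T U \<Longrightarrow> f \<in> Cc T"
  unfolding Cc_on_def by blast

lemma Cc_on_eq_0: "f \<in> Cc_on T U \<Longrightarrow> x \<in> topspace T \<Longrightarrow> x \<notin> U \<Longrightarrow> f x = 0"
  unfolding Cc_on_def by blast

lemma Cc_on_cong:
  assumes "f \<in> Cc_on T U" "\<And>x. x \<in> topspace T \<Longrightarrow> f x = g x"
  shows "g \<in> Cc_on T U"
  using assms unfolding Cc_on_def by (auto elim: continuous_map_eq)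

lemma Cc_nonnegD: "f \<in> Cc_nonneg T \<Longrightarrow> f \<in> Cc T" "f \<in> Cc_nonneg T \<Longrightarrow> x \<in> topspace T \<Longrightarrow> 0 \<le> f x"
  by (auto simp: Cc_nonneg_def)

lemma Cc_pos_nonneg: "f \<in> Cc_pos T \<Longrightarrow> f \<in> Cc_nonneg T"
  by (simp add: Cc_pos_def)

lemma Cc_on_zero [simp]: "(\<lambda>x. 0) \<in> Cc_on T U"
  by (rule Cc_onI[where K="{}"]) auto

lemma Cc_on_add:
  assumes f: "f \<in> Cc_on T U" and g: "g \<in> Cc_on T U"
  shows "(\<lambda>x. f x + g x) \<in> Cc_on T U"
proof -
  obtain K where K: "compactin T K" "K \<subseteq> U" "\<And>x. x \<in> topspace T \<Longrightarrow> x \<notin> K \<Longrightarrow> f x = 0"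
    by (rule Cc_on_support[OF f]) (rule that)
  obtain L where L: "compactin T L" "L \<subseteq> U" "\<And>x. x \<in> topspace T \<Longrightarrow> x \<notin> L \<Longrightarrow> g x = 0"
    by (rule Cc_on_support[OF g]) (rule that)
  show ?thesis
    using assms K L
    by (intro Cc_onI[where K="K \<union> L"] compactin_Un continuous_intros) (auto simp: Cc_on_continuous)
qed

lemma Cc_on_mult:
  assumes "f \<in> Cc_on T U" "continuous_map T euclideanreal g"
  shows "(\<lambda>x. f x * g x) \<in> Cc_on T U" "(\<lambda>x. g x * f x) \<in> Cc_on T U"
proof -
  obtain K where K: "compactin T K" "K \<subseteq> U" "\<And>x. x \<in> topspace T \<Longrightarrow> x \<notin> K \<Longrightarrow> f x = 0"
    by (rule Cc_on_support[OF assms(1)]) (rule that)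
  show "(\<lambda>x. f x * g x) \<in> Cc_on T U"
    using assms K by (intro Cc_onI[where K=K] continuous_intros) (auto simp: Cc_on_continuous)
  then show "(\<lambda>x. g x * f x) \<in> Cc_on T U"
    by (simp add: mult.commute)
qed

lemma Cc_on_scale: "f \<in> Cc_on T U \<Longrightarrow> (\<lambda>x. c * f x) \<in> Cc_on T U"
  and Cc_on_scale_right: "f \<in> Cc_on T U \<Longrightarrow> (\<lambda>x. f x * c) \<in> Cc_on T U"
  by (rule Cc_on_mult; simp)+

lemma Cc_on_minus: "f \<in> Cc_on T U \<Longrightarrow> (\<lambda>x. - f x) \<in> Cc_on T U"
  using Cc_on_scale[of f T U "-1"] by simp

lemma Cc_on_diff: "f \<in> Cc_on T U \<Longrightarrow> g \<in> Cc_on T U \<Longrightarrow> (\<lambda>x. f x - g x) \<in> Cc_on T U"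
  using Cc_on_add[of f T U "\<lambda>x. - g x"] Cc_on_minus by auto

lemma Cc_on_sum:
  assumes "finite A" "\<And>a. a \<in> A \<Longrightarrow> f a \<in> Cc_on T U"
  shows "(\<lambda>x. \<Sum>a\<in>A. f a x) \<in> Cc_on T U"
  using assms by (induction A rule: finite_induct) (auto intro: Cc_on_add)

lemma Cc_on_divide:
  assumes "f \<in> Cc_on T U" "continuous_map T euclideanreal g" "\<And>x. x \<in> topspace T \<Longrightarrow> g x \<noteq> 0"
  shows "(\<lambda>x. f x / g x) \<in> Cc_on T U"
  using Cc_on_mult(1)[OF assms(1), of "\<lambda>x. inverse (g x)"] assms
  by (simp add: continuous_map_real_inverse divide_inverse)

lemma Cc_max_zero:
  assumes "f \<in> Cc T"
  shows "(\<lambda>x. max (f x) 0) \<in> Cc_nonneg T"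
proof -
  obtain K where "compactin T K" "\<And>x. x \<in> topspace T \<Longrightarrow> x \<notin> K \<Longrightarrow> f x = 0"
    using Cc_on_support[OF assms] by metis
  then have "(\<lambda>x. max (f x) 0) \<in> Cc T"
    using assms by (intro Cc_onI[where K=K] continuous_intros) (auto simp: Cc_on_continuous)
  then show ?thesis by (simp add: Cc_nonneg_def)
qed

lemma Cc_nonneg_add: "f \<in> Cc_nonneg T \<Longrightarrow> g \<in> Cc_nonneg T \<Longrightarrow> (\<lambda>x. f x + g x) \<in> Cc_nonneg T"
  by (auto simp: Cc_nonneg_def intro: Cc_on_add)

lemma Cc_nonneg_scale: "f \<in> Cc_nonneg T \<Longrightarrow> 0 \<le> c \<Longrightarrow> (\<lambda>x. c * f x) \<in> Cc_nonneg T"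
  by (auto simp: Cc_nonneg_def intro: Cc_on_scale)

lemma Cc_nonneg_factor:
  assumes f: "f1 \<in> Cc_nonneg T" "f2 \<in> Cc_nonneg T" and h: "continuous_map T euclideanreal h" and d: "0 < d"
    and f_le_h: "\<forall>x\<in>topspace T. f1 x + f2 x \<le> h x"
    and h_ge: "\<forall>x\<in>topspace T. 0 < f1 x + f2 x \<longrightarrow> d \<le> h x"
  obtains k1 k2 where "k1 \<in> Cc_nonneg T" "k2 \<in> Cc_nonneg T" "\<And>x. x \<in> topspace T \<Longrightarrow> k1 x + k2 x \<le> 1"
    "\<And>x. x \<in> topspace T \<Longrightarrow> h x * k1 x = f1 x" "\<And>x. x \<in> topspace T \<Longrightarrow> h x * k2 x = f2 x"
proof -
  let ?k = "\<lambda>f x. f x / max (h x) d"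
  have k: "?k f \<in> Cc_nonneg T" if "f \<in> Cc_nonneg T" for f
    unfolding Cc_nonneg_def
    using Cc_nonnegD[OF that] h d
    by (auto intro!: Cc_on_divide continuous_intros divide_nonneg_pos simp: less_max_iff_disj)
  have h_k: "h x * ?k f1 x = f1 x \<and> h x * ?k f2 x = f2 x" if x: "x \<in> topspace T" for x
  proof (cases "0 < f1 x + f2 x")
    case True
    then have "d \<le> h x" using h_ge x by blast
    then show ?thesis using d by (simp add: max_def)
  next
    case False
    then have "f1 x = 0" "f2 x = 0"
      using Cc_nonnegD(2)[OF f(1) x] Cc_nonnegD(2)[OF f(2) x] by linarith+
    then show ?thesis by simp
  qed
  show ?thesis
  proof (rule that[OF k[OF f(1)] k[OF f(2)]])
    show "?k f1 x + ?k f2 x \<le> 1" if "x \<in> topspace T" for x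
    proof -
      have "f1 x + f2 x \<le> max (h x) d" using f_le_h that by (simp add: le_max_iff_disj)
      then show ?thesis using d by (simp add: divide_le_eq less_max_iff_disj flip: add_divide_distrib)
    qed
  qed (use h_k in auto)
qed

lemma Cc_bounded:
  assumes "f \<in> Cc T"
  obtains M where "M > 0" "\<And>x. x \<in> topspace T \<Longrightarrow> \<bar>f x\<bar> \<le> M"
proof -
  obtain K where K: "compactin T K" "\<And>x. x \<in> topspace T \<Longrightarrow> x \<notin> K \<Longrightarrow> f x = 0"
    using Cc_on_support[OF assms] by metis
  have "compactin euclideanreal (f ` K)"
    by (rule image_compactin[OF K(1) Cc_on_continuous[OF assms]])
  then have "bounded (f ` K)"
    by (simp add: compact_imp_bounded)
  then obtain b where b: "b > 0" "\<And>x. x \<in> K \<Longrightarrow> \<bar>f x\<bar> \<le> b"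
    by (auto simp: bounded_pos)
  show ?thesis
    by (rule that[of b]) (use b K(2) in force)+
qed

lemma Cc_on_mult_Int:
  assumes "Hausdorff_space T" and f: "f \<in> Cc_on T U" and g: "g \<in> Cc_on T V"
  shows "(\<lambda>x. f x * g x) \<in> Cc_on T (U \<inter> V)"
proof -
  obtain K where K: "compactin T K" "K \<subseteq> U" "\<And>x. x \<in> topspace T \<Longrightarrow> x \<notin> K \<Longrightarrow> f x = 0"
    by (rule Cc_on_support[OF f]) (rule that)
  obtain L where L: "compactin T L" "L \<subseteq> V" "\<And>x. x \<in> topspace T \<Longrightarrow> x \<notin> L \<Longrightarrow> g x = 0"
    by (rule Cc_on_support[OF g]) (rule that)
  have "compactin T (K \<inter> L)"
    using K(1) L(1) assms(1) by (intro compact_Int_closedin compactin_imp_closedin)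
  then show ?thesis
    using f g K L
    by (intro Cc_onI[where K="K \<inter> L"] continuous_map_real_mult) (auto simp: Cc_on_continuous)
qed

lemma Cc_on_mult_local:
  assumes T: "Hausdorff_space T" and U: "openin T U" and f: "f \<in> Cc_on T U"
    and g: "continuous_map (subtopology T U) euclideanreal g"
  shows "(\<lambda>x. f x * g x) \<in> Cc_on T U"
proof -
  obtain K where K: "compactin T K" "K \<subseteq> U" "\<And>x. x \<in> topspace T \<Longrightarrow> x \<notin> K \<Longrightarrow> f x = 0"
    by (rule Cc_on_support[OF f]) (rule that)
  have closed: "closedin T K" using T K(1) by (rule compactin_imp_closedin)
  have "continuous_map T euclideanreal (\<lambda>x. f x * g x)"
  proof (rule pasting_lemma[where I="UNIV :: bool set" and T="\<lambda>b. if b then U else topspace T - K"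
        and f="\<lambda>b. if b then (\<lambda>x. f x * g x) else (\<lambda>x. 0)"])
    show "openin T (if b then U else topspace T - K)" for b using U closed by auto
    show "continuous_map (subtopology T (if b then U else topspace T - K)) euclideanreal
        (if b then \<lambda>x. f x * g x else (\<lambda>x. 0))" for b
      using g Cc_on_continuous[OF f] by (auto intro: continuous_map_real_mult continuous_map_from_subtopology)
  qed (use K in \<open>auto split: if_splits\<close>)
  then show ?thesis by (rule Cc_onI[OF _ K(1,2)]) (use K(3) in auto)
qed

lemma Cc_on_compose:
  assumes f: "f \<in> Cc_on T U" and a: "continuous_map S T a" and b: "continuous_map T S b"
    and ba: "\<And>x. x \<in> topspace S \<Longrightarrow> b (a x) = x"
    and ab: "\<And>y. y \<in> topspace T \<Longrightarrow> a (b y) = y"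
  shows "(\<lambda>x. f (a x)) \<in> Cc_on S {x \<in> topspace S. a x \<in> U}"
proof -
  obtain K where K: "compactin T K" "K \<subseteq> U" "\<And>x. x \<in> topspace T \<Longrightarrow> x \<notin> K \<Longrightarrow> f x = 0"
    by (rule Cc_on_support[OF f]) (rule that)
  have KT: "K \<subseteq> topspace T" using K(1) by (rule compactin_subset_topspace)
  have a_space: "a x \<in> topspace T" if "x \<in> topspace S" for x
    using continuous_map_image_subset_topspace[OF a] that by blast
  show ?thesis
  proof (rule Cc_onI)
    show "continuous_map S euclideanreal (\<lambda>x. f (a x))"
      using continuous_map_compose[OF a Cc_on_continuous[OF f]] by (simp add: o_def)
    show "compactin S (b ` K)" by (rule image_compactin[OF K(1) b])
    show "b ` K \<subseteq> {x \<in> topspace S. a x \<in> U}"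
      using KT K(2) ab continuous_map_image_subset_topspace[OF b] by (auto simp: subset_iff)
    show "f (a x) = 0" if "x \<in> topspace S" "x \<notin> b ` K" for x
      using that K(3)[OF a_space] ba by (metis image_eqI)
  qed
qed

lemma compactin_finite_subcover:
  assumes "compactin T K" "\<forall>x\<in>K. openin T (U x) \<and> x \<in> U x"
  obtains A where "finite A" "A \<subseteq> K" "K \<subseteq> \<Union>(U ` A)"
proof -
  have "K \<subseteq> \<Union>(U ` K)" using assms(2) by blast
  then obtain \<U> where "finite \<U>" "\<U> \<subseteq> U ` K" "K \<subseteq> \<Union>\<U>"
    using assms unfolding compactin_def by (metis (no_types, lifting) imageE)
  then show ?thesis by (metis finite_subset_image that)
qed

subsection \<open>Functions on a product\<close>

lemma Cc_prod_support:
  assumes "F \<in> Cc (prod_topology X Y)"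
  obtains K L where "compactin X K" "compactin Y L"
    "\<And>x y. x \<in> topspace X \<Longrightarrow> y \<in> topspace Y \<Longrightarrow> x \<notin> K \<or> y \<notin> L \<Longrightarrow> F (x, y) = 0"
proof -
  obtain C where C: "compactin (prod_topology X Y) C"
    "\<And>z. z \<in> topspace (prod_topology X Y) \<Longrightarrow> z \<notin> C \<Longrightarrow> F z = 0"
    using Cc_on_support[OF assms] by metis
  show ?thesis
  proof (rule that)
    show "compactin X (fst ` C)" "compactin Y (snd ` C)"
      using C(1) by (rule image_compactin, intro continuous_map_fst continuous_map_snd)+
    show "F (x, y) = 0" if "x \<in> topspace X" "y \<in> topspace Y" "x \<notin> fst ` C \<or> y \<notin> snd ` C" for x y
      using that by (intro C(2)) force+
  qed
qed

lemma Cc_prod_swap: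
  assumes "F \<in> Cc (prod_topology X Y)"
  shows "(\<lambda>(y, x). F (x, y)) \<in> Cc (prod_topology Y X)"
proof -
  have "(\<lambda>z. F (snd z, fst z)) \<in> Cc_on (prod_topology Y X)
      {z \<in> topspace (prod_topology Y X). (snd z, fst z) \<in> UNIV}"
    by (rule Cc_on_compose[OF assms, where b="\<lambda>z. (snd z, fst z)"]) (auto intro!: continuous_intros)
  then show ?thesis unfolding case_prod_beta by (rule Cc_on_imp_Cc)
qed

lemma Cc_prod_section:
  assumes F: "F \<in> Cc (prod_topology X Y)" and x: "x \<in> topspace X"
  shows "(\<lambda>y. F (x, y)) \<in> Cc Y"
proof -
  obtain K L where KL: "compactin Y L"
    "\<And>x y. x \<in> topspace X \<Longrightarrow> y \<in> topspace Y \<Longrightarrow> x \<notin> K \<or> y \<notin> L \<Longrightarrow> F (x, y) = 0"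
    by (rule Cc_prod_support[OF F]) (rule that)
  have "continuous_map Y (prod_topology X Y) (\<lambda>y. (x, y))"
    using x by (intro continuous_intros) auto
  from continuous_map_compose[OF this Cc_on_continuous[OF F]] show ?thesis
    using KL(2)[OF x] by (intro Cc_onI[OF _ KL(1)]) (auto simp: o_def)
qed

lemma uniformly_close_on_compact:
  fixes F :: "'a \<times> 'b \<Rightarrow> real"
  assumes F: "continuous_map (prod_topology X Y) euclideanreal F"
    and K: "compactin Y K" and x0: "x0 \<in> topspace X" and e: "e > 0"
  obtains U where "openin X U" "x0 \<in> U" "\<And>x y. x \<in> U \<Longrightarrow> y \<in> K \<Longrightarrow> \<bar>F (x, y) - F (x0, y)\<bar> < e"
proof -
  let ?P = "prod_topology X Y"
  let ?osc = "\<lambda>z. \<bar>F z - F (x0, snd z)\<bar>"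
  have "continuous_map ?P ?P (\<lambda>z. (x0, snd z))"
    using x0 continuous_map_snd[of X Y] by (intro continuous_intros) auto
  from continuous_map_compose[OF this F]
  have "continuous_map ?P euclideanreal (\<lambda>z. F (x0, snd z))"
    by (simp add: o_def)
  then have osc: "continuous_map ?P euclideanreal ?osc"
    using F by (intro continuous_intros)
  define W where "W = {z \<in> topspace ?P. ?osc z \<in> {..<e}}"
  have W: "openin ?P W"
    unfolding W_def by (rule openin_continuous_map_preimage[OF osc]) auto
  have "K \<subseteq> topspace Y" using K by (rule compactin_subset_topspace)
  then have "{x0} \<times> K \<subseteq> W" using x0 e by (auto simp: W_def)
  from tube_lemma_right[OF W K x0 this] obtain U V
    where "openin X U" "x0 \<in> U" "K \<subseteq> V" "U \<times> V \<subseteq> W" by blast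
  then show ?thesis by (intro that[of U]) (fastforce simp: W_def)+
qed

lemma partition_of_unity_tensor_error:
  fixes F :: "'a \<times> 'b \<Rightarrow> real"
  assumes v: "\<And>k. k \<in> A \<Longrightarrow> 0 \<le> v k y" "(\<Sum>k\<in>A. v k y) \<le> 1" "F (x, y) \<noteq> 0 \<Longrightarrow> (\<Sum>k\<in>A. v k y) * b = 1"
    and b: "0 \<le> b" and d: "0 \<le> d" and osc: "\<And>k. k \<in> A \<Longrightarrow> v k y \<noteq> 0 \<Longrightarrow> \<bar>F (x, y) - F (x, k)\<bar> \<le> d"
  shows "\<bar>F (x, y) - (\<Sum>k\<in>A. F (x, k) * (v k y * b))\<bar> \<le> d * b"
proof -
  have "F (x, y) = F (x, y) * ((\<Sum>k\<in>A. v k y) * b)" using v(3) by auto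
  then have "\<bar>F (x, y) - (\<Sum>k\<in>A. F (x, k) * (v k y * b))\<bar> = \<bar>\<Sum>k\<in>A. (F (x, y) - F (x, k)) * (v k y * b)\<bar>"
    by (simp add: left_diff_distrib sum_subtractf sum_distrib_left sum_distrib_right)
  also have "\<dots> \<le> (\<Sum>k\<in>A. d * (v k y * b))"
  proof (rule order_trans[OF sum_abs sum_mono])
    show "\<bar>(F (x, y) - F (x, k)) * (v k y * b)\<bar> \<le> d * (v k y * b)" if k: "k \<in> A" for k
      using osc[OF k] v(1)[OF k] b by (cases "v k y = 0") (auto simp: abs_mult mult_right_mono)
  qed
  also have "\<dots> = d * b * (\<Sum>k\<in>A. v k y)"
    by (simp add: sum_distrib_left mult_ac)
  also have "\<dots> \<le> d * b * 1" using v(2) d b by (intro mult_left_mono) auto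
  finally show ?thesis by simp
qed

subsection \<open>Bump functions on locally compact Hausdorff spaces\<close>

locale lc_space =
  fixes T :: "'a topology"
  assumes Hausdorff: "Hausdorff_space T" and locally_compact: "locally_compact_space T"
begin

lemma bump:
  assumes "openin T U" "x \<in> U"
  obtains u where "u \<in> Cc_on T U" "\<And>y. 0 \<le> u y" "u x = 1"
proof -
  obtain V K where VK: "openin T V" "compactin T K" "x \<in> V" "V \<subseteq> K" "K \<subseteq> U"
    using locally_compact assms
    unfolding locally_compact_space_neighbourhood_base[OF disjI1[OF Hausdorff]]
    by (metis neighbourhood_base_of)
  have "completely_regular_space T"
    using Hausdorff locally_compact by (simp add: locally_compact_regular_imp_completely_regular_space)
  moreover have "closedin T (topspace T - V)" using VK by blast
  moreover have "compactin T {x}" using assms openin_subset by auto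
  ultimately obtain f where f: "continuous_map T (subtopology euclidean {0..1::real}) f"
      "f ` (topspace T - V) \<subseteq> {0}" "f ` {x} \<subseteq> {1}"
    using Urysohn_completely_regular_compact_closed[of 0 1 T "{x}" "topspace T - V"] VK
    by (auto simp: disjnt_iff)
  let ?u = "\<lambda>y. if y \<in> topspace T \<inter> V then f y else 0"
  have f': "continuous_map T euclideanreal f" "f \<in> topspace T \<rightarrow> {0..1}"
    using f(1) by (auto simp: continuous_map_in_subtopology)
  have "continuous_map T euclideanreal ?u"
    by (rule continuous_map_eq[OF f'(1)]) (use f(2) in auto)
  then have "?u \<in> Cc_on T U"
    by (rule Cc_onI[OF _ VK(2,5)]) (use VK(4) in auto)
  then show ?thesis
    using f' f(3) VK(3) openin_subset[OF VK(1)]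
    by (intro that[of ?u]) (auto simp: Pi_iff)
qed

lemma finite_bump_cover:
  assumes K: "compactin T K" and U: "\<forall>x\<in>K. openin T (U x) \<and> x \<in> U x"
  obtains A u where "finite A" "A \<subseteq> K" "\<And>a. a \<in> A \<Longrightarrow> u a \<in> Cc_on T (U a)"
    "\<And>a y. a \<in> A \<Longrightarrow> 0 \<le> u a y" "\<And>y. y \<in> K \<Longrightarrow> 1 \<le> (\<Sum>a\<in>A. u a y)"
proof -
  have "\<forall>x\<in>K. \<exists>u. u \<in> Cc_on T (U x) \<and> (\<forall>y. 0 \<le> u y) \<and> u x = (2::real)"
  proof
    fix x assume "x \<in> K"
    then obtain u where "u \<in> Cc_on T (U x)" "\<And>y. 0 \<le> u y" "u x = 1"
      using bump U by metis
    then show "\<exists>u. u \<in> Cc_on T (U x) \<and> (\<forall>y. 0 \<le> u y) \<and> u x = 2"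
      by (intro exI[of _ "\<lambda>y. 2 * u y"]) (auto intro: Cc_on_scale)
  qed
  then obtain u where u: "\<And>x. x \<in> K \<Longrightarrow> u x \<in> Cc_on T (U x)" "\<And>x y. x \<in> K \<Longrightarrow> 0 \<le> u x y"
    "\<And>x. x \<in> K \<Longrightarrow> u x x = (2::real)"
    by metis
  define P where "P x = {y \<in> topspace T. u x y \<in> {1<..}}" for x
  have "\<forall>x\<in>K. openin T (P x) \<and> x \<in> P x"
  proof (intro ballI conjI)
    fix x assume x: "x \<in> K"
    show "openin T (P x)"
      unfolding P_def
      by (rule openin_continuous_map_preimage[OF Cc_on_continuous[OF u(1)[OF x]]]) auto
    show "x \<in> P x" using u(3)[OF x] x compactin_subset_topspace[OF K] by (auto simp: P_def)
  qed
  then obtain A where A: "finite A" "A \<subseteq> K" "K \<subseteq> \<Union>(P ` A)"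
    by (rule compactin_finite_subcover[OF K]) (rule that)
  show ?thesis
  proof (rule that[OF A(1,2)])
    fix y assume "y \<in> K"
    then obtain a where a: "a \<in> A" "1 \<le> u a y" using A(3) by (force simp: P_def)
    have "u a y \<le> (\<Sum>a\<in>A. u a y)" using A u(2) a(1) by (intro member_le_sum) auto
    with a(2) show "1 \<le> (\<Sum>a\<in>A. u a y)" by linarith
  qed (use A u in auto)
qed

lemma partition_of_unity:
  assumes K: "compactin T K" and U: "\<forall>x\<in>K. openin T (U x) \<and> x \<in> U x"
  obtains A v where "finite A" "A \<subseteq> K" "\<And>a. a \<in> A \<Longrightarrow> v a \<in> Cc_on T (U a)"
    "\<And>a y. a \<in> A \<Longrightarrow> 0 \<le> v a y" "\<And>y. (\<Sum>a\<in>A. v a y) \<le> 1" "\<And>y. y \<in> K \<Longrightarrow> (\<Sum>a\<in>A. v a y) = 1"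
proof -
  obtain A u where A: "finite A" "A \<subseteq> K" and u: "\<And>a. a \<in> A \<Longrightarrow> u a \<in> Cc_on T (U a)"
    "\<And>a y. a \<in> A \<Longrightarrow> 0 \<le> u a y" "\<And>y. y \<in> K \<Longrightarrow> (1::real) \<le> (\<Sum>a\<in>A. u a y)"
    by (rule finite_bump_cover[OF K U]) (rule that)
  define s where "s y = max 1 (\<Sum>a\<in>A. u a y)" for y
  have s_ge: "1 \<le> s y" for y by (simp add: s_def)
  have s: "continuous_map T euclideanreal s"
    unfolding s_def using A(1) by (intro continuous_intros) (auto intro: Cc_on_continuous u(1))
  have sum: "(\<Sum>a\<in>A. u a y / s y) = (\<Sum>a\<in>A. u a y) / s y" for y
    by (simp add: sum_divide_distrib)
  show ?thesis
  proof (rule that[OF A, of "\<lambda>a y. u a y / s y"])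
    show "(\<lambda>y. u a y / s y) \<in> Cc_on T (U a)" if "a \<in> A" for a
      using s_ge by (intro Cc_on_divide[OF u(1)[OF that] s]) (metis not_one_le_zero)
    show "0 \<le> u a y / s y" if "a \<in> A" for a y
      using u(2)[OF that] s_ge[of y] by (intro divide_nonneg_nonneg) auto
    show "(\<Sum>a\<in>A. u a y / s y) \<le> 1" for y
      unfolding sum using s_ge[of y] by (simp add: divide_le_eq s_def)
    show "(\<Sum>a\<in>A. u a y / s y) = 1" if "y \<in> K" for y
      unfolding sum using u(3)[OF that] by (simp add: s_def)
  qed
qed

lemma bump_on_compact:
  assumes "compactin T K"
  obtains e where "e \<in> Cc T" "\<And>x. 0 \<le> e x" "\<And>x. x \<in> K \<Longrightarrow> e x = 1"
proof (rule partition_of_unity[OF assms, of "\<lambda>x. topspace T"])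
  show "\<forall>x\<in>K. openin T (topspace T) \<and> x \<in> topspace T"
    using compactin_subset_topspace[OF assms] by blast
  fix A :: "'a set" and v :: "'a \<Rightarrow> 'a \<Rightarrow> real"
  assume "finite A" "\<And>a. a \<in> A \<Longrightarrow> v a \<in> Cc_on T (topspace T)" "\<And>a y. a \<in> A \<Longrightarrow> 0 \<le> v a y"
    "\<And>y. y \<in> K \<Longrightarrow> (\<Sum>a\<in>A. v a y) = 1"
  then show thesis
    by (intro that[of "\<lambda>x. \<Sum>a\<in>A. v a x"]) (auto intro!: Cc_on_sum sum_nonneg intro: Cc_on_imp_Cc)
qed

lemma partition_of_unity_small_oscillation:
  fixes F :: "'b \<times> 'a \<Rightarrow> real"
  assumes F: "F \<in> Cc (prod_topology X T)" and K: "compactin X K" and L: "compactin T L" and d: "d > 0"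
  obtains A v where "finite A" "A \<subseteq> L" "\<And>k. k \<in> A \<Longrightarrow> v k \<in> Cc T" "\<And>k y. k \<in> A \<Longrightarrow> 0 \<le> v k y"
    "\<And>y. (\<Sum>k\<in>A. v k y) \<le> 1" "\<And>y. y \<in> L \<Longrightarrow> (\<Sum>k\<in>A. v k y) = 1"
    "\<And>k x y. k \<in> A \<Longrightarrow> x \<in> K \<Longrightarrow> y \<in> topspace T \<Longrightarrow> v k y \<noteq> 0 \<Longrightarrow> \<bar>F (x, y) - F (x, k)\<bar> \<le> d"
proof -
  have "\<exists>U. openin T U \<and> y0 \<in> U \<and> (\<forall>x\<in>K. \<forall>y\<in>U. \<bar>F (x, y) - F (x, y0)\<bar> < d)"
    if y0: "y0 \<in> L" for y0
  proof -
    have "y0 \<in> topspace T" using y0 compactin_subset_topspace[OF L] by blast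
    then obtain U where "openin T U" "y0 \<in> U"
      "\<And>y x. y \<in> U \<Longrightarrow> x \<in> K \<Longrightarrow> \<bar>(\<lambda>(y, x). F (x, y)) (y, x) - (\<lambda>(y, x). F (x, y)) (y0, x)\<bar> < d"
      by (rule uniformly_close_on_compact[OF Cc_on_continuous[OF Cc_prod_swap[OF F]] K _ d]) (rule that)
    then show ?thesis by auto
  qed
  then obtain U where U: "\<forall>y\<in>L. openin T (U y) \<and> y \<in> U y"
    "\<And>y0 x y. y0 \<in> L \<Longrightarrow> x \<in> K \<Longrightarrow> y \<in> U y0 \<Longrightarrow> \<bar>F (x, y) - F (x, y0)\<bar> < d"
    by metis
  obtain A v where A: "finite A" "A \<subseteq> L" and v: "\<And>k. k \<in> A \<Longrightarrow> v k \<in> Cc_on T (U k)"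
    "\<And>k y. k \<in> A \<Longrightarrow> 0 \<le> v k y" "\<And>y. (\<Sum>k\<in>A. v k y) \<le> (1::real)" "\<And>y. y \<in> L \<Longrightarrow> (\<Sum>k\<in>A. v k y) = 1"
    by (rule partition_of_unity[OF L U(1)]) (rule that)
  show ?thesis
  proof (rule that[OF A Cc_on_imp_Cc[OF v(1)] v(2-4)])
    fix k x y assume k: "k \<in> A" and x: "x \<in> K" and y: "y \<in> topspace T" and nonzero: "v k y \<noteq> 0"
    have "y \<in> U k" using Cc_on_eq_0[OF v(1)[OF k] y] nonzero by blast
    then show "\<bar>F (x, y) - F (x, k)\<bar> \<le> d" using U(2)[of k x y] k x A(2) by force
  qed
qed

lemma tensor_approximation:
  fixes F :: "'b \<times> 'a \<Rightarrow> real"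
  assumes F: "F \<in> Cc (prod_topology X T)" and K: "compactin X K" and L: "compactin T L"
    and F0: "\<forall>x\<in>topspace X. \<forall>y\<in>topspace T. x \<notin> K \<or> y \<notin> L \<longrightarrow> F (x, y) = 0"
    and a: "\<forall>x. 0 \<le> a x" "\<forall>x\<in>K. a x = 1"
    and b: "b \<in> Cc T" "\<forall>y. 0 \<le> b y" "\<forall>y\<in>L. b y = 1" and d: "d > 0"
  obtains A v where "finite A" "A \<subseteq> topspace T" "\<And>k. k \<in> A \<Longrightarrow> v k \<in> Cc T"
    "\<And>x y. x \<in> topspace X \<Longrightarrow> y \<in> topspace T \<Longrightarrow> \<bar>F (x, y) - (\<Sum>k\<in>A. F (x, k) * v k y)\<bar> \<le> d * (a x * b y)"
proof -
  obtain A v where A: "finite A" "A \<subseteq> L" and v: "\<And>k. k \<in> A \<Longrightarrow> v k \<in> Cc T" "\<And>k y. k \<in> A \<Longrightarrow> 0 \<le> v k y"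
    "\<And>y. (\<Sum>k\<in>A. v k y) \<le> 1" "\<And>y. y \<in> L \<Longrightarrow> (\<Sum>k\<in>A. v k y) = 1"
    "\<And>k x y. k \<in> A \<Longrightarrow> x \<in> K \<Longrightarrow> y \<in> topspace T \<Longrightarrow> v k y \<noteq> 0 \<Longrightarrow> \<bar>F (x, y) - F (x, k)\<bar> \<le> d"
    by (rule partition_of_unity_small_oscillation[OF F K L d]) (rule that)
  have AT: "A \<subseteq> topspace T" using A(2) compactin_subset_topspace[OF L] by blast
  show ?thesis
  proof (rule that[OF A(1) AT Cc_on_mult(1)[OF v(1) Cc_on_continuous[OF b(1)]]])
    fix x y assume x: "x \<in> topspace X" and y: "y \<in> topspace T"
    show "\<bar>F (x, y) - (\<Sum>k\<in>A. F (x, k) * (v k y * b y))\<bar> \<le> d * (a x * b y)"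
    proof (cases "x \<in> K")
      case True
      have "F (x, y) \<noteq> 0 \<Longrightarrow> (\<Sum>k\<in>A. v k y) * b y = 1" using F0 x y v(4) b(3) by (cases "y \<in> L") auto
      then show ?thesis
        using partition_of_unity_tensor_error[of A v y F x "b y" d] v(2,3,5) b(2) d y a(2) True by simp
    next
      case False
      then show ?thesis using F0 x y AT d a(1) b(2) by (simp add: subset_iff)
    qed
  qed
qed

end

section \<open>Positive functionals\<close>

locale pos_functional = lc_space T for T :: "'a topology" +
  fixes I :: "('a \<Rightarrow> real) \<Rightarrow> real"
  assumes I_add: "\<And>f g. f \<in> Cc T \<Longrightarrow> g \<in> Cc T \<Longrightarrow> I (\<lambda>x. f x + g x) = I f + I g"
    and I_scale: "\<And>f c. f \<in> Cc T \<Longrightarrow> I (\<lambda>x. c * f x) = c * I f"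
    and I_nonneg: "\<And>f. f \<in> Cc_nonneg T \<Longrightarrow> 0 \<le> I f"
begin

lemma I_diff: "f \<in> Cc T \<Longrightarrow> g \<in> Cc T \<Longrightarrow> I (\<lambda>x. f x - g x) = I f - I g"
  using I_add[of f "\<lambda>x. -1 * g x"] I_scale[of g "-1"] Cc_on_minus[of g T UNIV] by simp

lemma I_mono: "f \<in> Cc T \<Longrightarrow> g \<in> Cc T \<Longrightarrow> (\<And>x. x \<in> topspace T \<Longrightarrow> f x \<le> g x) \<Longrightarrow> I f \<le> I g"
  using I_nonneg[of "\<lambda>x. g x - f x"] I_diff[of g f] by (simp add: Cc_nonneg_def Cc_on_diff)

lemma I_cong:
  assumes f: "f \<in> Cc T" and eq: "\<And>x. x \<in> topspace T \<Longrightarrow> f x = g x"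
  shows "I f = I g"
  using Cc_on_cong[OF f eq] f eq by (intro antisym I_mono) auto

lemma I_zero: "I (\<lambda>x. 0) = 0"
  using I_scale[of "\<lambda>x. 0" 0] by simp

lemma I_scale_right: "f \<in> Cc T \<Longrightarrow> I (\<lambda>x. f x * c) = I f * c"
  using I_scale[of f c] by (simp add: mult.commute)

lemma I_sum:
  assumes "finite A" "\<And>a. a \<in> A \<Longrightarrow> f a \<in> Cc T"
  shows "I (\<lambda>x. \<Sum>a\<in>A. f a x) = (\<Sum>a\<in>A. I (f a))"
  using assms by (induction A rule: finite_induct) (auto simp: I_zero I_add Cc_on_sum)

lemma I_abs_diff_le:
  assumes "f \<in> Cc T" "g \<in> Cc T" "h \<in> Cc T" "\<And>x. x \<in> topspace T \<Longrightarrow> \<bar>f x - g x\<bar> \<le> h x"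
  shows "\<bar>I f - I g\<bar> \<le> I h"
proof -
  have "I f - I g \<le> I h" "I g - I f \<le> I h"
    using assms by (auto simp flip: I_diff intro!: I_mono Cc_on_diff dest!: assms(4))
  then show ?thesis by linarith
qed

lemma pos_functional_divide:
  assumes "0 < c"
  shows "pos_functional T (\<lambda>f. I f / c)"
  by unfold_locales (use assms in \<open>auto simp: I_add I_scale I_nonneg add_divide_distrib\<close>)

lemma partial_integral_Cc:
  assumes F: "F \<in> Cc (prod_topology X T)"
  shows "(\<lambda>x. I (\<lambda>y. F (x, y))) \<in> Cc X"
proof -
  obtain K L where K: "compactin X K" and L: "compactin T L"
    and F0: "\<And>x y. x \<in> topspace X \<Longrightarrow> y \<in> topspace T \<Longrightarrow> x \<notin> K \<or> y \<notin> L \<Longrightarrow> F (x, y) = 0"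
    by (rule Cc_prod_support[OF F]) (rule that)
  obtain e where e: "e \<in> Cc T" "\<And>x. 0 \<le> e x" "\<And>x. x \<in> L \<Longrightarrow> e x = 1"
    by (rule bump_on_compact[OF L]) (rule that)
  have Ie: "I e \<ge> 0" using e by (simp add: I_nonneg Cc_nonneg_def)
  let ?J = "\<lambda>x. I (\<lambda>y. F (x, y))"
  have "\<forall>\<^sub>F x in atin X x0. \<bar>?J x - ?J x0\<bar> < r" if x0: "x0 \<in> topspace X" and r: "r > 0" for x0 r
  proof -
    define d where "d = r / (I e + 1)"
    have d: "d > 0" "d * I e < r" using r Ie by (auto simp: d_def field_simps)
    obtain U where U: "openin X U" "x0 \<in> U" "\<And>x y. x \<in> U \<Longrightarrow> y \<in> L \<Longrightarrow> \<bar>F (x, y) - F (x0, y)\<bar> < d"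
      by (rule uniformly_close_on_compact[OF Cc_on_continuous[OF F] L x0 d(1)]) (rule that)
    have "\<bar>?J x - ?J x0\<bar> < r" if x: "x \<in> U" for x
    proof -
      have xX: "x \<in> topspace X" using x openin_subset[OF U(1)] by blast
      have "\<bar>F (x, y) - F (x0, y)\<bar> \<le> d * e y" if y: "y \<in> topspace T" for y
        using U(3)[OF x, of y] e(2,3)[of y] d(1) F0[OF xX y] F0[OF x0 y] by (cases "y \<in> L") auto
      then have "\<bar>?J x - ?J x0\<bar> \<le> I (\<lambda>y. d * e y)"
        by (rule I_abs_diff_le[OF Cc_prod_section[OF F xX] Cc_prod_section[OF F x0] Cc_on_scale[OF e(1)]])
      also have "\<dots> < r" unfolding I_scale[OF e(1)] by (rule d)
      finally show ?thesis .
    qed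
    then show ?thesis unfolding eventually_atin using U(1,2) by auto
  qed
  then have "continuous_map X euclideanreal ?J"
    by (simp add: continuous_map_atin limitin_canonical_iff tendsto_iff dist_real_def)
  moreover have "?J x = 0" if "x \<in> topspace X" "x \<notin> K" for x
    using I_cong[OF Cc_prod_section[OF F that(1)], of "\<lambda>y. 0"] F0 that I_zero by simp
  ultimately show ?thesis by (intro Cc_onI[OF _ K]) auto
qed

lemma iterated_integral_abs_diff_le:
  assumes J: "pos_functional X J" and F: "F \<in> Cc (prod_topology X T)"
    and G: "\<And>x. x \<in> topspace X \<Longrightarrow> G x \<in> Cc T" "(\<lambda>x. I (G x)) \<in> Cc X"
    and a: "a \<in> Cc X" and b: "b \<in> Cc T"
    and le: "\<And>x y. x \<in> topspace X \<Longrightarrow> y \<in> topspace T \<Longrightarrow> \<bar>F (x, y) - G x y\<bar> \<le> d * (a x * b y)"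
  shows "\<bar>J (\<lambda>x. I (\<lambda>y. F (x, y))) - J (\<lambda>x. I (G x))\<bar> \<le> d * (J a * I b)"
proof -
  interpret J: pos_functional X J by (rule J)
  have "\<bar>I (\<lambda>y. F (x, y)) - I (G x)\<bar> \<le> (d * I b) * a x" if x: "x \<in> topspace X" for x
  proof -
    have "\<bar>I (\<lambda>y. F (x, y)) - I (G x)\<bar> \<le> I (\<lambda>y. (d * a x) * b y)"
      by (rule I_abs_diff_le[OF Cc_prod_section[OF F x] G(1)[OF x] Cc_on_scale[OF b]])
        (use le[OF x] in \<open>simp add: mult.assoc\<close>)
    also have "\<dots> = (d * I b) * a x" using I_scale[OF b, of "d * a x"] by (simp only: mult_ac)
    finally show ?thesis .
  qed
  then have "\<bar>J (\<lambda>x. I (\<lambda>y. F (x, y))) - J (\<lambda>x. I (G x))\<bar> \<le> J (\<lambda>x. (d * I b) * a x)"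
    by (rule J.I_abs_diff_le[OF partial_integral_Cc[OF F] G(2) Cc_on_scale[OF a]])
  also have "\<dots> = d * (J a * I b)" using J.I_scale[OF a, of "d * I b"] by (simp only: mult_ac)
  finally show ?thesis .
qed

lemma fubini_gap_le:
  assumes J: "pos_functional X J" and F: "F \<in> Cc (prod_topology X T)" and ab: "a \<in> Cc X" "b \<in> Cc T"
    and A: "finite A" "A \<subseteq> topspace T" and v: "\<And>k. k \<in> A \<Longrightarrow> v k \<in> Cc T"
    and le: "\<And>x y. x \<in> topspace X \<Longrightarrow> y \<in> topspace T \<Longrightarrow>
      \<bar>F (x, y) - (\<Sum>k\<in>A. F (x, k) * v k y)\<bar> \<le> d * (a x * b y)"
  shows "\<bar>J (\<lambda>x. I (\<lambda>y. F (x, y))) - I (\<lambda>y. J (\<lambda>x. F (x, y)))\<bar> \<le> 2 * (d * (J a * I b))"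
proof -
  interpret J: pos_functional X J by (rule J)
  note F' = Cc_prod_swap[OF F]
  have FX: "(\<lambda>x. F (x, k)) \<in> Cc X" if "k \<in> A" for k
    using Cc_prod_section[OF F'] that A(2) by auto
  have I_tensor: "I (\<lambda>y. \<Sum>k\<in>A. F (x, k) * v k y) = (\<Sum>k\<in>A. F (x, k) * I (v k))" for x
    using A v by (simp add: I_sum I_scale Cc_on_scale)
  have J_tensor: "J (\<lambda>x. \<Sum>k\<in>A. F (x, k) * v k y) = (\<Sum>k\<in>A. J (\<lambda>x. F (x, k)) * v k y)" for y
    using A FX by (simp add: J.I_sum J.I_scale_right Cc_on_scale_right)
  have "\<bar>J (\<lambda>x. I (\<lambda>y. F (x, y))) - J (\<lambda>x. I (\<lambda>y. \<Sum>k\<in>A. F (x, k) * v k y))\<bar> \<le> d * (J a * I b)"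
    by (rule iterated_integral_abs_diff_le[OF J F _ _ ab le])
      (auto simp: I_tensor intro!: Cc_on_sum Cc_on_scale Cc_on_scale_right A v FX)
  moreover have "\<bar>I (\<lambda>y. J (\<lambda>x. (\<lambda>(y, x). F (x, y)) (y, x))) - I (\<lambda>y. J (\<lambda>x. \<Sum>k\<in>A. F (x, k) * v k y))\<bar>
      \<le> d * (I b * J a)"
    by (rule J.iterated_integral_abs_diff_le[OF pos_functional_axioms F' _ _ ab(2,1)])
      (use le in \<open>auto simp: J_tensor mult.commute[of "b _"]
        intro!: Cc_on_sum Cc_on_scale Cc_on_scale_right A v FX\<close>)
  moreover have "J (\<lambda>x. I (\<lambda>y. \<Sum>k\<in>A. F (x, k) * v k y)) = I (\<lambda>y. J (\<lambda>x. \<Sum>k\<in>A. F (x, k) * v k y))"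
    using A v FX unfolding I_tensor J_tensor
    by (simp add: I_sum J.I_sum I_scale J.I_scale_right Cc_on_scale Cc_on_scale_right)
  ultimately show ?thesis by (simp add: mult.commute)
qed

lemma fubini:
  assumes J: "pos_functional X J" and F: "F \<in> Cc (prod_topology X T)"
  shows "J (\<lambda>x. I (\<lambda>y. F (x, y))) = I (\<lambda>y. J (\<lambda>x. F (x, y)))"
proof -
  interpret J: pos_functional X J by (rule J)
  obtain K L where K: "compactin X K" and L: "compactin T L"
    and F0: "\<forall>x\<in>topspace X. \<forall>y\<in>topspace T. x \<notin> K \<or> y \<notin> L \<longrightarrow> F (x, y) = 0"
    using Cc_prod_support[OF F] by metis
  obtain a where a: "a \<in> Cc X" "\<forall>x. 0 \<le> a x" "\<forall>x\<in>K. a x = 1"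
    using J.bump_on_compact[OF K] by metis
  obtain b where b: "b \<in> Cc T" "\<forall>y. 0 \<le> b y" "\<forall>y\<in>L. b y = 1"
    using bump_on_compact[OF L] by metis
  let ?gap = "\<bar>J (\<lambda>x. I (\<lambda>y. F (x, y))) - I (\<lambda>y. J (\<lambda>x. F (x, y)))\<bar>"
  have "?gap \<le> 2 * (d * (J a * I b))" if d: "d > 0" for d
    by (rule tensor_approximation[OF F K L F0 a(2,3) b d]) (rule fubini_gap_le[OF J F a(1) b(1)])
  then have "\<forall>\<^sub>F d in at_right 0. ?gap \<le> 2 * (d * (J a * I b))"
    by (auto intro: eventually_mono[OF eventually_at_right_less])
  moreover have "((\<lambda>d. 2 * (d * (J a * I b))) \<longlongrightarrow> 2 * (0 * (J a * I b))) (at_right 0)"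
    by (intro tendsto_intros)
  ultimately have "?gap \<le> 2 * (0 * (J a * I b))"
    by (intro tendsto_lowerbound) auto
  then show ?thesis by simp
qed

end

locale cone_functional = lc_space T for T :: "'a topology" +
  fixes J :: "('a \<Rightarrow> real) \<Rightarrow> real"
  assumes J_add: "\<And>f g. f \<in> Cc_nonneg T \<Longrightarrow> g \<in> Cc_nonneg T \<Longrightarrow> J (\<lambda>x. f x + g x) = J f + J g"
    and J_scale: "\<And>f c. f \<in> Cc_nonneg T \<Longrightarrow> 0 \<le> c \<Longrightarrow> J (\<lambda>x. c * f x) = c * J f"
    and J_nonneg: "\<And>f. f \<in> Cc_nonneg T \<Longrightarrow> 0 \<le> J f"
begin

definition cone_extension :: "('a \<Rightarrow> real) \<Rightarrow> real" where
  "cone_extension f = J (\<lambda>x. max (f x) 0) - J (\<lambda>x. max (- f x) 0)"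

lemma cone_extension_eq:
  assumes "f \<in> Cc T" "a \<in> Cc_nonneg T" "b \<in> Cc_nonneg T" "\<And>x. f x = a x - b x"
  shows "cone_extension f = J a - J b"
proof -
  have "(\<lambda>x. max (f x) 0 + b x) = (\<lambda>x. max (- f x) 0 + a x)"
    using assms(4) by auto
  then have "J (\<lambda>x. max (f x) 0) + J b = J (\<lambda>x. max (- f x) 0) + J a"
    using J_add[OF Cc_max_zero[OF assms(1)] assms(3)] J_add[OF Cc_max_zero[OF Cc_on_minus[OF assms(1)]] assms(2)]
    by simp
  then show ?thesis by (simp add: cone_extension_def)
qed

lemma cone_extension_nonneg:
  assumes f: "f \<in> Cc_nonneg T"
  shows "cone_extension f = J f"
  using cone_extension_eq[OF Cc_nonnegD(1)[OF f] Cc_nonneg_add[OF f f] f] J_add[OF f f] by simp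

lemma cone_extension_minus: "cone_extension (\<lambda>x. - f x) = - cone_extension f"
  by (simp add: cone_extension_def)

lemma cone_extension_add:
  assumes f: "f \<in> Cc T" and g: "g \<in> Cc T"
  shows "cone_extension (\<lambda>x. f x + g x) = cone_extension f + cone_extension g"
proof -
  note cone = Cc_max_zero[OF f] Cc_max_zero[OF Cc_on_minus[OF f]]
    Cc_max_zero[OF g] Cc_max_zero[OF Cc_on_minus[OF g]]
  have "cone_extension (\<lambda>x. f x + g x) =
      J (\<lambda>x. max (f x) 0 + max (g x) 0) - J (\<lambda>x. max (- f x) 0 + max (- g x) 0)"
    by (intro cone_extension_eq Cc_on_add Cc_nonneg_add cone f g) (simp add: max_def)
  then show ?thesis using cone by (simp add: J_add cone_extension_def)
qed

lemma cone_extension_scale_nonneg: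
  assumes f: "f \<in> Cc T" and c: "0 \<le> c"
  shows "cone_extension (\<lambda>x. c * f x) = c * cone_extension f"
proof -
  note cone = Cc_max_zero[OF f] Cc_max_zero[OF Cc_on_minus[OF f]]
  have "c * f x = c * max (f x) 0 - c * max (- f x) 0" for x by (simp add: max_def)
  then have "cone_extension (\<lambda>x. c * f x) = J (\<lambda>x. c * max (f x) 0) - J (\<lambda>x. c * max (- f x) 0)"
    by (intro cone_extension_eq Cc_on_scale Cc_nonneg_scale cone f c)
  then show ?thesis using cone c by (simp add: J_scale cone_extension_def right_diff_distrib)
qed

lemma pos_functional_cone_extension: "pos_functional T cone_extension"
proof unfold_locales
  fix f and c :: real assume f: "f \<in> Cc T"
  show "cone_extension (\<lambda>x. c * f x) = c * cone_extension f"
  proof (cases "0 \<le> c")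
    case False
    then show ?thesis
      using cone_extension_scale_nonneg[OF f, of "- c"] cone_extension_minus[of "\<lambda>x. c * f x"] by simp
  qed (rule cone_extension_scale_nonneg[OF f])
qed (simp_all add: cone_extension_add cone_extension_nonneg J_nonneg)

end

section \<open>The Haar functional of a locally compact group\<close>

lemma (in group) mult_inv_cancel [simp]:
  assumes "x \<in> carrier G" "y \<in> carrier G"
  shows "x \<otimes> (inv x \<otimes> y) = y" "inv x \<otimes> (x \<otimes> y) = y"
  using assms by (auto simp: m_assoc[symmetric])

locale top_group = group Q for Q :: "('a, 'm) monoid_scheme" (structure) +
  fixes T :: "'a topology"
  assumes top_group: "topological_group Q T"
begin

lemma topspace_eq [simp]: "topspace T = carrier Q"
  using top_group by (simp add: topological_group_def)

lemma continuous_map_group_mult: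
  assumes "continuous_map X T f" "continuous_map X T g"
  shows "continuous_map X T (\<lambda>x. f x \<otimes> g x)"
  using continuous_map_compose[OF continuous_map_pairedI[OF assms], of T "\<lambda>(x, y). x \<otimes> y"] top_group
  by (simp add: o_def topological_group_def)

lemma continuous_map_group_inv:
  assumes "continuous_map X T f"
  shows "continuous_map X T (\<lambda>x. inv (f x))"
  using continuous_map_compose[OF assms, of T "\<lambda>x. inv x"] top_group
  by (simp add: o_def topological_group_def)

lemma continuous_map_left: "g \<in> carrier Q \<Longrightarrow> continuous_map T T (\<lambda>x. g \<otimes> x)"
  by (rule continuous_map_group_mult) auto

lemma continuous_map_right: "g \<in> carrier Q \<Longrightarrow> continuous_map T T (\<lambda>x. x \<otimes> g)"
  by (rule continuous_map_group_mult) auto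

lemma Cc_on_left:
  assumes "f \<in> Cc_on T U" "g \<in> carrier Q"
  shows "(\<lambda>x. f (g \<otimes> x)) \<in> Cc_on T {x \<in> carrier Q. g \<otimes> x \<in> U}"
  using Cc_on_compose[OF assms(1), of T "\<lambda>x. g \<otimes> x" "\<lambda>x. inv g \<otimes> x"] assms(2)
  by (simp add: continuous_map_left)

lemma Cc_on_right:
  assumes "f \<in> Cc_on T U" "g \<in> carrier Q"
  shows "(\<lambda>x. f (x \<otimes> g)) \<in> Cc_on T {x \<in> carrier Q. x \<otimes> g \<in> U}"
  using Cc_on_compose[OF assms(1), of T "\<lambda>x. x \<otimes> g" "\<lambda>x. x \<otimes> inv g"] assms(2)
  by (simp add: continuous_map_right m_assoc)

lemma Cc_left: "f \<in> Cc T \<Longrightarrow> g \<in> carrier Q \<Longrightarrow> (\<lambda>x. f (g \<otimes> x)) \<in> Cc T"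
  by (rule Cc_on_imp_Cc[OF Cc_on_left])

lemma Cc_right: "f \<in> Cc T \<Longrightarrow> g \<in> carrier Q \<Longrightarrow> (\<lambda>x. f (x \<otimes> g)) \<in> Cc T"
  by (rule Cc_on_imp_Cc[OF Cc_on_right])

lemma Cc_inv:
  assumes "f \<in> Cc T"
  shows "(\<lambda>x. f (inv x)) \<in> Cc T"
  using Cc_on_imp_Cc[OF Cc_on_compose[OF assms, of T "\<lambda>x. inv x" "\<lambda>x. inv x"]]
  by (simp add: continuous_map_group_inv)

definition left_invariant :: "'a set \<Rightarrow> (('a \<Rightarrow> real) \<Rightarrow> real) \<Rightarrow> bool" where
  "left_invariant S I \<longleftrightarrow> (\<forall>f\<in>Cc T. \<forall>g\<in>S. I (\<lambda>x. f (g \<otimes> x)) = I f)"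

definition right_invariant :: "'a set \<Rightarrow> (('a \<Rightarrow> real) \<Rightarrow> real) \<Rightarrow> bool" where
  "right_invariant S I \<longleftrightarrow> (\<forall>f\<in>Cc T. \<forall>g\<in>S. I (\<lambda>x. f (x \<otimes> g)) = I f)"

lemma left_invariantD: "left_invariant S I \<Longrightarrow> f \<in> Cc T \<Longrightarrow> g \<in> S \<Longrightarrow> I (\<lambda>x. f (g \<otimes> x)) = I f"
  by (simp add: left_invariant_def)

lemma right_invariantD: "right_invariant S I \<Longrightarrow> f \<in> Cc T \<Longrightarrow> g \<in> S \<Longrightarrow> I (\<lambda>x. f (x \<otimes> g)) = I f"
  by (simp add: right_invariant_def)

lemma left_invariant_subset: "left_invariant S I \<Longrightarrow> R \<subseteq> S \<Longrightarrow> left_invariant R I"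
  by (auto simp: left_invariant_def)

lemma Cc_uniformly_continuous:
  assumes f: "f \<in> Cc T" and e: "e > 0"
  obtains V where "openin T V" "\<one> \<in> V"
    "\<And>x v. x \<in> carrier Q \<Longrightarrow> v \<in> V \<Longrightarrow> \<bar>f (x \<otimes> v) - f x\<bar> < e"
proof -
  obtain K where K: "compactin T K" "\<And>x. x \<in> topspace T \<Longrightarrow> x \<notin> K \<Longrightarrow> f x = 0"
    using Cc_on_support[OF f] by metis
  have "continuous_map (prod_topology T T) T (\<lambda>z. snd z \<otimes> fst z)"
    by (intro continuous_map_group_mult continuous_map_fst continuous_map_snd)
  from continuous_map_compose[OF this Cc_on_continuous[OF f]]
  have F: "continuous_map (prod_topology T T) euclideanreal (\<lambda>z. f (snd z \<otimes> fst z))"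
    by (simp add: o_def)
  obtain U where U: "openin T U" "\<one> \<in> U" and
    near_K: "\<And>v x. v \<in> U \<Longrightarrow> x \<in> K \<Longrightarrow> \<bar>f (x \<otimes> v) - f (x \<otimes> \<one>)\<bar> < e"
    using uniformly_close_on_compact[OF F K(1) _ e, of \<one>] by auto
  define V where "V = U \<inter> {x \<in> topspace T. inv x \<in> U}"
  show ?thesis
  proof (rule that[of V])
    show "openin T V"
      unfolding V_def
      by (intro openin_Int U openin_continuous_map_preimage[OF continuous_map_group_inv]) auto
    show "\<one> \<in> V" using U by (simp add: V_def)
    fix x v assume x: "x \<in> carrier Q" and v: "v \<in> V"
    have vQ: "v \<in> carrier Q" using v by (auto simp: V_def)
    consider "x \<in> K" | "x \<notin> K" "x \<otimes> v \<in> K" | "x \<notin> K" "x \<otimes> v \<notin> K" by blast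
    then show "\<bar>f (x \<otimes> v) - f x\<bar> < e"
    proof cases
      case 1
      then show ?thesis using near_K[of v x] v x by (simp add: V_def)
    next
      case 2
      then show ?thesis
        using near_K[of "inv v" "x \<otimes> v"] v x vQ by (simp add: V_def m_assoc abs_minus_commute)
    next
      case 3
      then show ?thesis using K(2) x vQ e by simp
    qed
  qed
qed

subsection \<open>Haar's covering number\<close>

text \<open>The weights \<open>w\<close> with \<open>majorized \<phi> f w\<close> are the coefficient sums of the combinations of
  translates of \<open>\<phi>\<close> that dominate \<open>f\<close>; their infimum is Haar's \<open>(f : \<phi>)\<close>.\<close>

inductive majorized :: "('a \<Rightarrow> real) \<Rightarrow> ('a \<Rightarrow> real) \<Rightarrow> real \<Rightarrow> bool" for \<phi> where
  zero: "majorized \<phi> (\<lambda>x. 0) 0"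
| translate: "g \<in> carrier Q \<Longrightarrow> majorized \<phi> (\<lambda>x. \<phi> (g \<otimes> x)) 1"
| scale: "majorized \<phi> f w \<Longrightarrow> 0 \<le> c \<Longrightarrow> majorized \<phi> (\<lambda>x. c * f x) (c * w)"
| add: "majorized \<phi> f w \<Longrightarrow> majorized \<phi> g v \<Longrightarrow> majorized \<phi> (\<lambda>x. f x + g x) (w + v)"
| weaken: "majorized \<phi> f w \<Longrightarrow> (\<And>x. x \<in> carrier Q \<Longrightarrow> f' x \<le> f x) \<Longrightarrow> majorized \<phi> f' w"

definition covering_number :: "('a \<Rightarrow> real) \<Rightarrow> ('a \<Rightarrow> real) \<Rightarrow> real" where
  "covering_number \<phi> f = Inf {w. majorized \<phi> f w}"

lemma majorized_nonneg: "majorized \<phi> f w \<Longrightarrow> 0 \<le> w"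
  by (induction rule: majorized.induct) auto

lemma majorized_left:
  assumes "majorized \<phi> f w" "g \<in> carrier Q"
  shows "majorized \<phi> (\<lambda>x. f (g \<otimes> x)) w"
  using assms
proof (induction rule: majorized.induct)
  case (translate h)
  show ?case
    by (rule majorized.weaken[OF majorized.translate[of "h \<otimes> g"]]) (use translate in \<open>auto simp: m_assoc\<close>)
next
  case (weaken f w f')
  show ?case
    by (rule majorized.weaken[OF weaken.IH]) (use weaken in auto)
qed (auto intro: majorized.intros)

lemma majorized_trans:
  assumes "majorized \<phi> f w" "majorized \<psi> \<phi> v"
  shows "majorized \<psi> f (w * v)"
  using assms
proof (induction rule: majorized.induct)
  case (translate g)
  then show ?case by (simp add: majorized_left)
qed (auto simp: mult.assoc distrib_right intro: majorized.intros)

lemma majorized_sum: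
  assumes "finite A" "\<And>a. a \<in> A \<Longrightarrow> majorized \<phi> (f a) (w a)"
  shows "majorized \<phi> (\<lambda>x. \<Sum>a\<in>A. f a x) (\<Sum>a\<in>A. w a)"
  using assms by (induction A rule: finite_induct) (auto intro: majorized.intros)

lemma majorized_le:
  assumes "majorized \<phi> f w" "\<And>x. x \<in> carrier Q \<Longrightarrow> \<phi> x \<le> M" "x \<in> carrier Q"
  shows "f x \<le> w * M"
  using assms
proof (induction arbitrary: x rule: majorized.induct)
  case (scale f w c)
  then show ?case by (simp add: mult.assoc mult_left_mono)
next
  case (add f w g v)
  then show ?case by (simp add: distrib_right add_mono)
qed (auto intro: order_trans)

lemma covering_number_le: "majorized \<phi> f w \<Longrightarrow> covering_number \<phi> f \<le> w"
  unfolding covering_number_def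
  by (rule cInf_lower) (auto intro!: bdd_belowI[of _ 0] majorized_nonneg)

end

locale lc_group = top_group Q T + lc_space T
  for Q :: "('a, 'm) monoid_scheme" (structure) and T :: "'a topology"
begin

lemma majorized_exists:
  assumes f: "f \<in> Cc T" and \<phi>: "\<phi> \<in> Cc_pos T"
  obtains w where "majorized \<phi> f w"
proof -
  obtain x0 where x0: "x0 \<in> carrier Q" "\<phi> x0 > 0" using \<phi> by (auto simp: Cc_pos_def)
  note \<phi>_Cc = Cc_nonnegD(1)[OF Cc_pos_nonneg[OF \<phi>]] and \<phi>_nonneg = Cc_nonnegD(2)[OF Cc_pos_nonneg[OF \<phi>]]
  obtain K where K: "compactin T K" "\<And>x. x \<in> topspace T \<Longrightarrow> x \<notin> K \<Longrightarrow> f x = 0"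
    using Cc_on_support[OF f] by metis
  have KQ: "x \<in> carrier Q" if "x \<in> K" for x using compactin_subset_topspace[OF K(1)] that by auto
  obtain M where M: "M > 0" "\<And>x. x \<in> topspace T \<Longrightarrow> \<bar>f x\<bar> \<le> M"
    using Cc_bounded[OF f] by metis
  define U where "U a = {x \<in> topspace T. \<phi> (x0 \<otimes> inv a \<otimes> x) \<in> {\<phi> x0 / 2<..}}" for a
  have "\<forall>a\<in>K. openin T (U a) \<and> a \<in> U a"
  proof (intro ballI conjI)
    fix a assume a: "a \<in> K"
    show "openin T (U a)" unfolding U_def
      by (rule openin_continuous_map_preimage[OF Cc_on_continuous[OF Cc_left[OF \<phi>_Cc]]])
        (use KQ[OF a] x0 in auto)
    show "a \<in> U a" using KQ[OF a] x0 by (simp add: U_def m_assoc)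
  qed
  then obtain A where A: "finite A" "A \<subseteq> K" "K \<subseteq> \<Union>(U ` A)"
    by (rule compactin_finite_subcover[OF K(1)]) (rule that)
  define c where "c = 2 * M / \<phi> x0"
  have c: "0 \<le> c" using M(1) x0(2) by (simp add: c_def)
  have majorized: "majorized \<phi> (\<lambda>x. \<Sum>a\<in>A. c * \<phi> (x0 \<otimes> inv a \<otimes> x)) (\<Sum>a\<in>A. c * 1)"
    using A c x0(1) KQ by (intro majorized_sum majorized.intros) auto
  show ?thesis
  proof (rule that[OF majorized.weaken[OF majorized]])
    fix x assume x: "x \<in> carrier Q"
    have nonneg: "0 \<le> c * \<phi> (x0 \<otimes> inv a \<otimes> x)" if "a \<in> A" for a
      using that A(2) KQ x x0(1) c by (intro mult_nonneg_nonneg \<phi>_nonneg) auto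
    show "f x \<le> (\<Sum>a\<in>A. c * \<phi> (x0 \<otimes> inv a \<otimes> x))"
    proof (cases "x \<in> K")
      case True
      then obtain a where a: "a \<in> A" "x \<in> U a" using A(3) by blast
      have "f x \<le> c * (\<phi> x0 / 2)" using M(2)[of x] x x0(2) by (simp add: c_def)
      also have "\<dots> \<le> c * \<phi> (x0 \<otimes> inv a \<otimes> x)" using a(2) c by (intro mult_left_mono) (auto simp: U_def)
      also have "\<dots> \<le> (\<Sum>a\<in>A. c * \<phi> (x0 \<otimes> inv a \<otimes> x))" using a(1) A(1) nonneg by (intro member_le_sum) auto
      finally show ?thesis .
    next
      case False
      then show ?thesis using K(2) x nonneg by (simp add: sum_nonneg)
    qed
  qed
qed

lemma covering_number_greatest:
  assumes "f \<in> Cc T" "\<phi> \<in> Cc_pos T" "\<And>w. majorized \<phi> f w \<Longrightarrow> z \<le> w"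
  shows "z \<le> covering_number \<phi> f"
  unfolding covering_number_def using majorized_exists[OF assms(1,2)] assms(3)
  by (intro cInf_greatest) auto

lemma covering_number_nonneg: "f \<in> Cc T \<Longrightarrow> \<phi> \<in> Cc_pos T \<Longrightarrow> 0 \<le> covering_number \<phi> f"
  by (rule covering_number_greatest) (auto intro: majorized_nonneg)

lemma covering_number_pos:
  assumes f: "f \<in> Cc_pos T" and \<phi>: "\<phi> \<in> Cc_pos T"
  shows "0 < covering_number \<phi> f"
proof -
  obtain x where x: "x \<in> carrier Q" "0 < f x" using f by (auto simp: Cc_pos_def)
  obtain M where M: "M > 0" "\<And>x. x \<in> topspace T \<Longrightarrow> \<bar>\<phi> x\<bar> \<le> M"
    using Cc_bounded[OF Cc_nonnegD(1)[OF Cc_pos_nonneg[OF \<phi>]]] by metis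
  have "f x / M \<le> covering_number \<phi> f"
  proof (rule covering_number_greatest[OF Cc_nonnegD(1)[OF Cc_pos_nonneg[OF f]] \<phi>])
    fix w assume "majorized \<phi> f w"
    then have "f x \<le> w * M" by (rule majorized_le) (use M(2) x(1) in \<open>auto simp: abs_le_iff\<close>)
    then show "f x / M \<le> w" using M(1) by (simp add: divide_le_eq)
  qed
  then show ?thesis using x(2) M(1) by (meson divide_pos_pos less_le_trans)
qed

lemma covering_number_left:
  assumes f: "f \<in> Cc T" and \<phi>: "\<phi> \<in> Cc_pos T" and g: "g \<in> carrier Q"
  shows "covering_number \<phi> (\<lambda>x. f (g \<otimes> x)) = covering_number \<phi> f"
proof (rule antisym)
  show "covering_number \<phi> (\<lambda>x. f (g \<otimes> x)) \<le> covering_number \<phi> f"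
    by (rule covering_number_greatest[OF f \<phi>]) (rule covering_number_le[OF majorized_left[OF _ g]])
  show "covering_number \<phi> f \<le> covering_number \<phi> (\<lambda>x. f (g \<otimes> x))"
  proof (rule covering_number_greatest[OF Cc_left[OF f g] \<phi>])
    fix w assume "majorized \<phi> (\<lambda>x. f (g \<otimes> x)) w"
    from majorized.weaken[OF majorized_left[OF this, of "inv g"], of f]
    show "covering_number \<phi> f \<le> w" using g by (intro covering_number_le) auto
  qed
qed

lemma covering_number_add:
  assumes f: "f \<in> Cc T" and g: "g \<in> Cc T" and \<phi>: "\<phi> \<in> Cc_pos T"
  shows "covering_number \<phi> (\<lambda>x. f x + g x) \<le> covering_number \<phi> f + covering_number \<phi> g"
proof -
  have "covering_number \<phi> (\<lambda>x. f x + g x) - v \<le> covering_number \<phi> f" if "majorized \<phi> g v" for v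
    by (rule covering_number_greatest[OF f \<phi>])
      (use covering_number_le[OF majorized.add[OF _ that]] in \<open>simp add: algebra_simps\<close>)
  then have "covering_number \<phi> (\<lambda>x. f x + g x) - covering_number \<phi> f \<le> covering_number \<phi> g"
    by (intro covering_number_greatest[OF g \<phi>]) (simp add: algebra_simps)
  then show ?thesis by simp
qed

lemma covering_number_scale_le:
  assumes f: "f \<in> Cc T" and \<phi>: "\<phi> \<in> Cc_pos T" and c: "0 < c"
  shows "covering_number \<phi> (\<lambda>x. c * f x) \<le> c * covering_number \<phi> f"
proof -
  have "covering_number \<phi> (\<lambda>x. c * f x) / c \<le> covering_number \<phi> f"
    by (rule covering_number_greatest[OF f \<phi>])
      (use c covering_number_le[OF majorized.scale] in \<open>simp add: divide_le_eq mult.commute\<close>)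
  then show ?thesis using c by (simp add: divide_le_eq mult.commute)
qed

lemma covering_number_scale:
  assumes f: "f \<in> Cc T" and \<phi>: "\<phi> \<in> Cc_pos T" and c: "0 \<le> c"
  shows "covering_number \<phi> (\<lambda>x. c * f x) = c * covering_number \<phi> f"
proof (cases "c = 0")
  case True
  then show ?thesis
    using covering_number_le[OF majorized.zero, of \<phi>] covering_number_nonneg[OF Cc_on_zero \<phi>] by simp
next
  case False
  then have c: "0 < c" using c by simp
  have "covering_number \<phi> (\<lambda>x. inverse c * (c * f x)) \<le> inverse c * covering_number \<phi> (\<lambda>x. c * f x)"
    using c by (intro covering_number_scale_le Cc_on_scale f \<phi>) auto
  then show ?thesis
    using c covering_number_scale_le[OF f \<phi> c] by (simp add: field_simps)
qed

lemma covering_number_trans: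
  assumes f: "f \<in> Cc T" and \<phi>: "\<phi> \<in> Cc_pos T" and \<psi>: "\<psi> \<in> Cc_pos T"
  shows "covering_number \<psi> f \<le> covering_number \<phi> f * covering_number \<psi> \<phi>"
proof -
  note \<phi>_Cc = Cc_nonnegD(1)[OF Cc_pos_nonneg[OF \<phi>]]
  have pos: "0 < covering_number \<psi> \<phi>" by (rule covering_number_pos[OF \<phi> \<psi>])
  have le: "covering_number \<psi> f \<le> w * covering_number \<psi> \<phi>" if w: "majorized \<phi> f w" for w
  proof (cases "w = 0")
    case True
    obtain v where "majorized \<psi> \<phi> v" by (rule majorized_exists[OF \<phi>_Cc \<psi>])
    from covering_number_le[OF majorized_trans[OF w this]] show ?thesis using True by simp
  next
    case False
    then have w_pos: "0 < w" using majorized_nonneg[OF w] by simp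
    have "covering_number \<psi> f / w \<le> covering_number \<psi> \<phi>"
      by (rule covering_number_greatest[OF \<phi>_Cc \<psi>])
        (use covering_number_le[OF majorized_trans[OF w]] w_pos in \<open>simp add: divide_le_eq mult.commute\<close>)
    then show ?thesis using w_pos by (simp add: divide_le_eq mult.commute)
  qed
  have "covering_number \<psi> f / covering_number \<psi> \<phi> \<le> covering_number \<phi> f"
    by (rule covering_number_greatest[OF f \<phi>]) (use le pos in \<open>simp add: divide_le_eq\<close>)
  then show ?thesis using pos by (simp add: divide_le_eq)
qed

lemma majorized_translate_mult:
  assumes \<phi>: "\<phi> \<in> Cc_nonneg T" "\<And>x. x \<in> carrier Q \<Longrightarrow> x \<notin> V \<Longrightarrow> \<phi> x = 0"
    and k: "\<And>x. x \<in> carrier Q \<Longrightarrow> 0 \<le> k x" "\<And>x v. x \<in> carrier Q \<Longrightarrow> v \<in> V \<Longrightarrow> \<bar>k (x \<otimes> v) - k x\<bar> < d"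
    and d: "0 < d" and g: "g \<in> carrier Q"
  shows "majorized \<phi> (\<lambda>x. \<phi> (g \<otimes> x) * k x) (k (inv g) + d)"
proof -
  have "\<phi> (g \<otimes> x) * k x \<le> (k (inv g) + d) * \<phi> (g \<otimes> x)" if x: "x \<in> carrier Q" for x
  proof (cases "g \<otimes> x \<in> V")
    case True
    have "k x \<le> k (inv g) + d" using k(2)[OF _ True, of "inv g"] g x by auto
    then have "k x * \<phi> (g \<otimes> x) \<le> (k (inv g) + d) * \<phi> (g \<otimes> x)"
      using g x by (intro mult_right_mono Cc_nonnegD(2)[OF \<phi>(1)]) auto
    then show ?thesis by (simp add: mult.commute)
  qed (use \<phi>(2) g x in simp)
  moreover have "majorized \<phi> (\<lambda>x. (k (inv g) + d) * \<phi> (g \<otimes> x)) ((k (inv g) + d) * 1)"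
    using g d k(1)[of "inv g"] by (intro majorized.scale majorized.translate) auto
  ultimately show ?thesis using majorized.weaken by fastforce
qed

lemma majorized_split:
  assumes "majorized \<phi> h w"
    and \<phi>: "\<phi> \<in> Cc_nonneg T" "\<And>x. x \<in> carrier Q \<Longrightarrow> x \<notin> V \<Longrightarrow> \<phi> x = 0"
    and k1: "\<And>x. x \<in> carrier Q \<Longrightarrow> 0 \<le> k1 x" "\<And>x v. x \<in> carrier Q \<Longrightarrow> v \<in> V \<Longrightarrow> \<bar>k1 (x \<otimes> v) - k1 x\<bar> < d"
    and k2: "\<And>x. x \<in> carrier Q \<Longrightarrow> 0 \<le> k2 x" "\<And>x v. x \<in> carrier Q \<Longrightarrow> v \<in> V \<Longrightarrow> \<bar>k2 (x \<otimes> v) - k2 x\<bar> < d"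
    and k_sum: "\<And>x. x \<in> carrier Q \<Longrightarrow> k1 x + k2 x \<le> 1" and d: "0 < d"
  shows "\<exists>w1 w2. majorized \<phi> (\<lambda>x. h x * k1 x) w1 \<and> majorized \<phi> (\<lambda>x. h x * k2 x) w2 \<and>
    w1 + w2 \<le> (1 + 2 * d) * w"
  using assms(1)
proof (induction rule: majorized.induct)
  case zero
  show ?case by (intro exI[of _ 0]) (auto intro: majorized.zero)
next
  case (translate g)
  show ?case
    using majorized_translate_mult[OF \<phi> k1 d translate] majorized_translate_mult[OF \<phi> k2 d translate]
      k_sum[of "inv g"] translate
    by (intro exI[of _ "k1 (inv g) + d"] exI[of _ "k2 (inv g) + d"]) auto
next
  case (scale f w c)
  then obtain w1 w2 where w: "majorized \<phi> (\<lambda>x. f x * k1 x) w1" "majorized \<phi> (\<lambda>x. f x * k2 x) w2"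
    "w1 + w2 \<le> (1 + 2 * d) * w" by blast
  have "c * (w1 + w2) \<le> c * ((1 + 2 * d) * w)" using w(3) scale.hyps(2) by (rule mult_left_mono)
  then show ?case
    using majorized.scale[OF w(1) scale.hyps(2)] majorized.scale[OF w(2) scale.hyps(2)]
    by (intro exI[of _ "c * w1"] exI[of _ "c * w2"]) (auto simp: algebra_simps)
next
  case (add f w g v)
  then obtain w1 w2 v1 v2 where w: "majorized \<phi> (\<lambda>x. f x * k1 x) w1" "majorized \<phi> (\<lambda>x. f x * k2 x) w2"
      "w1 + w2 \<le> (1 + 2 * d) * w"
    and v: "majorized \<phi> (\<lambda>x. g x * k1 x) v1" "majorized \<phi> (\<lambda>x. g x * k2 x) v2" "v1 + v2 \<le> (1 + 2 * d) * v"
    by blast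
  then show ?case
    using majorized.add[OF w(1) v(1)] majorized.add[OF w(2) v(2)]
    by (intro exI[of _ "w1 + v1"] exI[of _ "w2 + v2"]) (auto simp: algebra_simps)
next
  case (weaken f w f')
  then obtain w1 w2 where w: "majorized \<phi> (\<lambda>x. f x * k1 x) w1" "majorized \<phi> (\<lambda>x. f x * k2 x) w2"
    "w1 + w2 \<le> (1 + 2 * d) * w" by blast
  then show ?case
    using k1(1) k2(1) weaken.hyps(2)
    by (intro exI[of _ w1] exI[of _ w2] conjI majorized.weaken[OF w(1)] majorized.weaken[OF w(2)])
      (auto intro: mult_right_mono)
qed

definition small_bumps :: "('a \<Rightarrow> real) filter" where
  "small_bumps = (INF V\<in>{V. openin T V \<and> \<one> \<in> V}.
    principal {\<phi> \<in> Cc_pos T. \<forall>x\<in>carrier Q. x \<notin> V \<longrightarrow> \<phi> x = 0})"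

lemma eventually_small_bumps:
  "eventually P small_bumps \<longleftrightarrow>
    (\<exists>V. openin T V \<and> \<one> \<in> V \<and> (\<forall>\<phi>\<in>Cc_pos T. (\<forall>x\<in>carrier Q. x \<notin> V \<longrightarrow> \<phi> x = 0) \<longrightarrow> P \<phi>))"
proof -
  have "openin T (carrier Q)" using openin_topspace[of T] by simp
  then show ?thesis
    unfolding small_bumps_def
    by (subst eventually_INF_base) (auto simp: eventually_principal intro!: bexI[of _ "_ \<inter> _"])
qed

lemma small_bumps_ne_bot: "small_bumps \<noteq> bot"
proof -
  have "\<exists>\<phi>\<in>Cc_pos T. \<forall>x\<in>carrier Q. x \<notin> V \<longrightarrow> \<phi> x = 0" if V: "openin T V" "\<one> \<in> V" for V
  proof -
    obtain u where u: "u \<in> Cc_on T V" "\<And>y. 0 \<le> u y" "u \<one> = 1"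
      by (rule bump[OF V]) (rule that)
    then have "u \<in> Cc_pos T"
      using Cc_on_imp_Cc[OF u(1)] by (auto simp: Cc_pos_def Cc_nonneg_def intro!: bexI[of _ \<one>])
    then show ?thesis using Cc_on_eq_0[OF u(1)] by auto
  qed
  then show ?thesis unfolding trivial_limit_def eventually_small_bumps by blast
qed

lemma eventually_small_bumps_Cc_pos: "\<forall>\<^sub>F \<phi> in small_bumps. \<phi> \<in> Cc_pos T"
  using openin_topspace[of T] by (auto simp: eventually_small_bumps intro!: exI[of _ "carrier Q"])

lemma covering_number_split:
  assumes h: "h \<in> Cc T" and d: "0 < d" and k: "k1 \<in> Cc_nonneg T" "k2 \<in> Cc_nonneg T"
    and k_sum: "\<And>x. x \<in> carrier Q \<Longrightarrow> k1 x + k2 x \<le> 1"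
    and f: "\<And>x. x \<in> carrier Q \<Longrightarrow> h x * k1 x = f1 x" "\<And>x. x \<in> carrier Q \<Longrightarrow> h x * k2 x = f2 x"
  shows "\<forall>\<^sub>F \<phi> in small_bumps.
    covering_number \<phi> f1 + covering_number \<phi> f2 \<le> (1 + 2 * d) * covering_number \<phi> h"
proof -
  obtain V1 where V1: "openin T V1" "\<one> \<in> V1"
    "\<And>x v. x \<in> carrier Q \<Longrightarrow> v \<in> V1 \<Longrightarrow> \<bar>k1 (x \<otimes> v) - k1 x\<bar> < d"
    using Cc_uniformly_continuous[OF Cc_nonnegD(1)[OF k(1)] d] by metis
  obtain V2 where V2: "openin T V2" "\<one> \<in> V2"
    "\<And>x v. x \<in> carrier Q \<Longrightarrow> v \<in> V2 \<Longrightarrow> \<bar>k2 (x \<otimes> v) - k2 x\<bar> < d"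
    using Cc_uniformly_continuous[OF Cc_nonnegD(1)[OF k(2)] d] by metis
  have "covering_number \<phi> f1 + covering_number \<phi> f2 \<le> (1 + 2 * d) * covering_number \<phi> h"
    if \<phi>: "\<phi> \<in> Cc_pos T" and \<phi>_V: "\<forall>x\<in>carrier Q. x \<notin> V1 \<inter> V2 \<longrightarrow> \<phi> x = 0" for \<phi>
  proof -
    have "(covering_number \<phi> f1 + covering_number \<phi> f2) / (1 + 2 * d) \<le> covering_number \<phi> h"
    proof (rule covering_number_greatest[OF h \<phi>])
      fix w assume "majorized \<phi> h w"
      then have "\<exists>w1 w2. majorized \<phi> (\<lambda>x. h x * k1 x) w1 \<and> majorized \<phi> (\<lambda>x. h x * k2 x) w2 \<and>
          w1 + w2 \<le> (1 + 2 * d) * w"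
        by (rule majorized_split[where V="V1 \<inter> V2"])
          (use Cc_pos_nonneg[OF \<phi>] \<phi>_V k k_sum V1(3) V2(3) d in \<open>auto simp: Cc_nonneg_def\<close>)
      then obtain w1 w2 where w: "majorized \<phi> (\<lambda>x. h x * k1 x) w1" "majorized \<phi> (\<lambda>x. h x * k2 x) w2"
        "w1 + w2 \<le> (1 + 2 * d) * w" by blast
      have "covering_number \<phi> f1 \<le> w1" "covering_number \<phi> f2 \<le> w2"
        using majorized.weaken[OF w(1), of f1] majorized.weaken[OF w(2), of f2] f
        by (auto intro: covering_number_le)
      then show "(covering_number \<phi> f1 + covering_number \<phi> f2) / (1 + 2 * d) \<le> w"
        using w(3) d by (simp add: divide_le_eq mult.commute)
    qed
    then show ?thesis using d by (simp add: divide_le_eq mult.commute)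
  qed
  then show ?thesis
    using V1(1,2) V2(1,2) unfolding eventually_small_bumps by (intro exI[of _ "V1 \<inter> V2"]) auto
qed

lemma covering_number_almost_additive:
  assumes f: "f1 \<in> Cc_nonneg T" "f2 \<in> Cc_nonneg T"
  obtains u where "u \<in> Cc T"
    "\<And>d. 0 < d \<Longrightarrow> \<forall>\<^sub>F \<phi> in small_bumps. covering_number \<phi> f1 + covering_number \<phi> f2 \<le>
       (1 + 2 * d) * (covering_number \<phi> (\<lambda>x. f1 x + f2 x) + d * covering_number \<phi> u)"
proof -
  let ?s = "\<lambda>x. f1 x + f2 x"
  have s: "?s \<in> Cc T" by (intro Cc_on_add Cc_nonnegD(1) f)
  obtain K where K: "compactin T K" "\<And>x. x \<in> topspace T \<Longrightarrow> x \<notin> K \<Longrightarrow> ?s x = 0"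
    using Cc_on_support[OF s] by metis
  obtain u where u: "u \<in> Cc T" "\<And>x. 0 \<le> u x" "\<And>x. x \<in> K \<Longrightarrow> u x = 1"
    by (rule bump_on_compact[OF K(1)]) (rule that)
  show ?thesis
  proof (rule that[OF u(1)])
    fix d :: real assume d: "0 < d"
    define h where "h x = ?s x + d * u x" for x
    have h: "h \<in> Cc T" unfolding h_def by (intro Cc_on_add[OF s] Cc_on_scale u(1))
    have s_le: "\<forall>x\<in>topspace T. ?s x \<le> h x" using d u(2) by (simp add: h_def)
    have h_ge: "\<forall>x\<in>topspace T. 0 < ?s x \<longrightarrow> d \<le> h x"
    proof (intro ballI impI)
      fix x assume x: "x \<in> topspace T" and pos: "0 < ?s x"
      have "x \<in> K" using K(2)[OF x] pos by force
      then show "d \<le> h x" using u(3) pos by (simp add: h_def)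
    qed
    obtain k1 k2 where k: "k1 \<in> Cc_nonneg T" "k2 \<in> Cc_nonneg T" "\<And>x. x \<in> topspace T \<Longrightarrow> k1 x + k2 x \<le> 1"
      "\<And>x. x \<in> topspace T \<Longrightarrow> h x * k1 x = f1 x" "\<And>x. x \<in> topspace T \<Longrightarrow> h x * k2 x = f2 x"
      by (rule Cc_nonneg_factor[OF f Cc_on_continuous[OF h] d s_le h_ge]) (rule that)
    then have "\<forall>\<^sub>F \<phi> in small_bumps.
        covering_number \<phi> f1 + covering_number \<phi> f2 \<le> (1 + 2 * d) * covering_number \<phi> h"
      by (intro covering_number_split[OF h d k(1,2)]) auto
    then show "\<forall>\<^sub>F \<phi> in small_bumps. covering_number \<phi> f1 + covering_number \<phi> f2 \<le>
        (1 + 2 * d) * (covering_number \<phi> ?s + d * covering_number \<phi> u)"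
      using eventually_small_bumps_Cc_pos
    proof eventually_elim
      case (elim \<phi>)
      have "covering_number \<phi> h \<le> covering_number \<phi> ?s + d * covering_number \<phi> u"
        using covering_number_add[OF s Cc_on_scale[OF u(1), of d] elim(2)]
          covering_number_scale[OF u(1) elim(2), of d] d
        unfolding h_def by simp
      then have "(1 + 2 * d) * covering_number \<phi> h \<le>
          (1 + 2 * d) * (covering_number \<phi> ?s + d * covering_number \<phi> u)"
        using d by (intro mult_left_mono) auto
      with elim(1) show ?case by (rule order_trans)
    qed
  qed
qed

end

lemma bounded_family_convergent_subfilter:
  fixes r :: "'i \<Rightarrow> 'f \<Rightarrow> real"
  assumes F: "F \<noteq> bot" and bounded: "\<forall>\<^sub>F i in F. \<forall>f. r i f \<in> {a f..b f}"
  obtains G J where "G \<noteq> bot" "G \<le> F" "\<And>f. ((\<lambda>i. r i f) \<longlongrightarrow> J f) G"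
proof -
  let ?box = "Pi\<^sub>E UNIV (\<lambda>f. {a f..b f})"
  have "compactin (product_topology (\<lambda>f. euclideanreal) UNIV) ?box"
    by (subst compactin_PiE) auto
  then have "compact ?box" by (simp add: euclidean_product_topology)
  moreover have "filtermap r F \<noteq> bot" using F by (simp add: filtermap_bot_iff)
  moreover have "\<forall>\<^sub>F j in filtermap r F. j \<in> ?box"
    using bounded by (simp add: eventually_filtermap PiE_UNIV_domain Pi_iff)
  ultimately obtain J where J: "inf (nhds J) (filtermap r F) \<noteq> bot"
    unfolding compact_filter by blast
  define G where "G = inf F (filtercomap r (nhds J))"
  have r: "filterlim r (nhds J) G"
    unfolding G_def by (rule filterlim_mono[OF filterlim_filtercomap _ inf_le2]) simp
  show ?thesis
  proof (rule that[of G J])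
    show "G \<le> F" by (simp add: G_def)
    show "G \<noteq> bot"
    proof
      assume "G = bot"
      then obtain P N where "eventually P F" "eventually N (nhds J)" "\<And>i. P i \<Longrightarrow> \<not> N (r i)"
        unfolding G_def trivial_limit_def eventually_inf eventually_filtercomap by blast
      then have "eventually (\<lambda>j. False) (inf (nhds J) (filtermap r F))"
        unfolding eventually_inf eventually_filtermap
        by (intro exI[of _ N] exI[of _ "\<lambda>j. \<not> N j"]) (auto elim: eventually_mono)
      then show False using J by (simp add: trivial_limit_def)
    qed
    show "((\<lambda>i. r i f) \<longlongrightarrow> J f) G" for f
      by (rule continuous_on_tendsto_compose[OF continuous_on_product_coordinates r]) auto
  qed
qed

context lc_group
begin

abbreviation covering_ratio :: "('a \<Rightarrow> real) \<Rightarrow> ('a \<Rightarrow> real) \<Rightarrow> ('a \<Rightarrow> real) \<Rightarrow> real" where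
  "covering_ratio f0 \<phi> f \<equiv> covering_number \<phi> f / covering_number \<phi> f0"

lemma covering_ratio_limit:
  assumes f0: "f0 \<in> Cc_pos T"
  obtains G J where "G \<noteq> bot" "G \<le> small_bumps"
    "\<And>f. f \<in> Cc T \<Longrightarrow> ((\<lambda>\<phi>. covering_ratio f0 \<phi> f) \<longlongrightarrow> J f) G"
proof -
  define r where "r \<phi> f = (if f \<in> Cc T then covering_ratio f0 \<phi> f else 0)" for \<phi> f
  define b where "b f = (if f \<in> Cc T then covering_number f0 f else 0)" for f
  have "\<forall>\<^sub>F \<phi> in small_bumps. \<forall>f. r \<phi> f \<in> {0..b f}"
    using eventually_small_bumps_Cc_pos
  proof eventually_elim
    case (elim \<phi>)
    show ?case
      using covering_number_nonneg[OF _ elim] covering_number_pos[OF f0 elim] covering_number_trans[OF _ f0 elim]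
      by (auto simp: r_def b_def divide_le_eq)
  qed
  then obtain G J where G: "G \<noteq> bot" "G \<le> small_bumps" and J: "\<And>f. ((\<lambda>\<phi>. r \<phi> f) \<longlongrightarrow> J f) G"
    by (rule bounded_family_convergent_subfilter[OF small_bumps_ne_bot]) (rule that)
  show ?thesis
  proof (rule that[OF G])
    show "((\<lambda>\<phi>. covering_ratio f0 \<phi> f) \<longlongrightarrow> J f) G" if "f \<in> Cc T" for f
      using J[of f] that by (simp add: r_def)
  qed
qed

end

locale Haar_limit = lc_group Q T for Q :: "('a, 'm) monoid_scheme" (structure) and T :: "'a topology" +
  fixes f0 :: "'a \<Rightarrow> real" and G :: "('a \<Rightarrow> real) filter" and J :: "('a \<Rightarrow> real) \<Rightarrow> real"
  assumes f0: "f0 \<in> Cc_pos T" and G_ne_bot: "G \<noteq> bot" and G_le: "G \<le> small_bumps"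
    and limit: "\<And>f. f \<in> Cc T \<Longrightarrow> ((\<lambda>\<phi>. covering_ratio f0 \<phi> f) \<longlongrightarrow> J f) G"
begin

lemma eventually_Cc_pos: "\<forall>\<^sub>F \<phi> in G. \<phi> \<in> Cc_pos T"
  using eventually_small_bumps_Cc_pos G_le by (rule filter_leD[rotated])

lemma J_nonneg:
  assumes "f \<in> Cc T"
  shows "0 \<le> J f"
proof (rule tendsto_lowerbound[OF limit[OF assms] _ G_ne_bot])
  show "\<forall>\<^sub>F \<phi> in G. 0 \<le> covering_ratio f0 \<phi> f"
    using eventually_Cc_pos
    by eventually_elim (simp add: covering_number_nonneg Cc_nonnegD(1) assms f0 Cc_pos_nonneg)
qed

lemma J_pos:
  assumes f: "f \<in> Cc_pos T"
  shows "0 < J f"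
proof -
  note f_Cc = Cc_nonnegD(1)[OF Cc_pos_nonneg[OF f]] and f0_Cc = Cc_nonnegD(1)[OF Cc_pos_nonneg[OF f0]]
  have "0 < 1 / covering_number f f0" using covering_number_pos[OF f0 f] by simp
  also have "1 / covering_number f f0 \<le> J f"
  proof (rule tendsto_lowerbound[OF limit[OF f_Cc] _ G_ne_bot])
    show "\<forall>\<^sub>F \<phi> in G. 1 / covering_number f f0 \<le> covering_ratio f0 \<phi> f"
      using eventually_Cc_pos
    proof eventually_elim
      case (elim \<phi>)
      show ?case
        using covering_number_trans[OF f0_Cc f elim] covering_number_pos[OF f0 elim] covering_number_pos[OF f0 f]
        by (simp add: field_simps)
    qed
  qed
  finally show ?thesis .
qed

lemma J_scale:
  assumes f: "f \<in> Cc T" and c: "0 \<le> c"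
  shows "J (\<lambda>x. c * f x) = c * J f"
proof -
  have "\<forall>\<^sub>F \<phi> in G. covering_ratio f0 \<phi> (\<lambda>x. c * f x) = c * covering_ratio f0 \<phi> f"
    using eventually_Cc_pos by eventually_elim (simp add: covering_number_scale f c)
  from tendsto_cong[THEN iffD1, OF this limit[OF Cc_on_scale[OF f]]]
  show ?thesis by (rule tendsto_unique[OF G_ne_bot]) (intro tendsto_intros limit f)
qed

lemma J_left:
  assumes f: "f \<in> Cc T" and g: "g \<in> carrier Q"
  shows "J (\<lambda>x. f (g \<otimes> x)) = J f"
proof -
  have "\<forall>\<^sub>F \<phi> in G. covering_ratio f0 \<phi> (\<lambda>x. f (g \<otimes> x)) = covering_ratio f0 \<phi> f"
    using eventually_Cc_pos by eventually_elim (simp add: covering_number_left f g)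
  from tendsto_cong[THEN iffD1, OF this limit[OF Cc_left[OF f g]]]
  show ?thesis by (rule tendsto_unique[OF G_ne_bot]) (rule limit[OF f])
qed

lemma J_subadditive:
  assumes f: "f \<in> Cc T" and g: "g \<in> Cc T"
  shows "J (\<lambda>x. f x + g x) \<le> J f + J g"
proof (rule tendsto_le[OF G_ne_bot])
  show "\<forall>\<^sub>F \<phi> in G. covering_ratio f0 \<phi> (\<lambda>x. f x + g x) \<le> covering_ratio f0 \<phi> f + covering_ratio f0 \<phi> g"
    using eventually_Cc_pos
  proof eventually_elim
    case (elim \<phi>)
    show ?case
      using covering_number_add[OF f g elim] covering_number_pos[OF f0 elim]
      by (simp add: divide_right_mono flip: add_divide_distrib)
  qed
qed (intro tendsto_intros limit Cc_on_add f g)+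

lemma J_superadditive:
  assumes f: "f \<in> Cc_nonneg T" and g: "g \<in> Cc_nonneg T"
  shows "J f + J g \<le> J (\<lambda>x. f x + g x)"
proof -
  let ?s = "\<lambda>x. f x + g x"
  obtain u where u: "u \<in> Cc T"
    "\<And>d. 0 < d \<Longrightarrow> \<forall>\<^sub>F \<phi> in small_bumps. covering_number \<phi> f + covering_number \<phi> g \<le>
         (1 + 2 * d) * (covering_number \<phi> ?s + d * covering_number \<phi> u)"
    by (rule covering_number_almost_additive[OF f g]) (rule that)
  have "J f + J g \<le> (1 + 2 * d) * (J ?s + d * J u)" if d: "0 < d" for d
  proof (rule tendsto_le[OF G_ne_bot])
    from filter_leD[OF G_le u(2)[OF d]] eventually_Cc_pos
    show "\<forall>\<^sub>F \<phi> in G. covering_ratio f0 \<phi> f + covering_ratio f0 \<phi> g \<le>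
        (1 + 2 * d) * (covering_ratio f0 \<phi> ?s + d * covering_ratio f0 \<phi> u)"
    proof eventually_elim
      case (elim \<phi>)
      from divide_right_mono[OF elim(1) less_imp_le[OF covering_number_pos[OF f0 elim(2)]]]
      show ?case by (simp flip: add_divide_distrib)
    qed
  qed (intro tendsto_intros limit Cc_nonnegD(1) Cc_nonneg_add f g u(1))+
  then have "\<forall>\<^sub>F d in at_right 0. J f + J g \<le> (1 + 2 * d) * (J ?s + d * J u)"
    by (auto intro: eventually_mono[OF eventually_at_right_less])
  moreover have "((\<lambda>d. (1 + 2 * d) * (J ?s + d * J u)) \<longlongrightarrow> (1 + 2 * 0) * (J ?s + 0 * J u)) (at_right 0)"
    by (intro tendsto_intros)
  ultimately have "J f + J g \<le> (1 + 2 * 0) * (J ?s + 0 * J u)"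
    by (intro tendsto_lowerbound) auto
  then show ?thesis by simp
qed

lemma J_add:
  assumes "f \<in> Cc_nonneg T" "g \<in> Cc_nonneg T"
  shows "J (\<lambda>x. f x + g x) = J f + J g"
  by (intro antisym J_subadditive J_superadditive Cc_nonnegD(1) assms)

end

context lc_group
begin

lemma Haar_functional:
  obtains I where "pos_functional T I" "\<forall>f\<in>Cc_pos T. 0 < I f" "left_invariant (carrier Q) I"
proof -
  obtain f0 where f0: "f0 \<in> Cc_pos T"
    using eventually_happens'[OF small_bumps_ne_bot eventually_small_bumps_Cc_pos] by blast
  obtain G J where "G \<noteq> bot" "G \<le> small_bumps"
    "\<And>f. f \<in> Cc T \<Longrightarrow> ((\<lambda>\<phi>. covering_ratio f0 \<phi> f) \<longlongrightarrow> J f) G"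
    by (rule covering_ratio_limit[OF f0]) (rule that)
  then interpret Haar_limit Q T f0 G J by unfold_locales (use f0 in auto)
  interpret cone_functional T J
    by unfold_locales (auto simp: J_add J_scale J_nonneg Cc_nonnegD(1))
  show ?thesis
  proof (rule that[OF pos_functional_cone_extension])
    show "\<forall>f\<in>Cc_pos T. 0 < cone_extension f" using J_pos cone_extension_nonneg[OF Cc_pos_nonneg] by simp
    show "left_invariant (carrier Q) cone_extension"
      unfolding left_invariant_def
    proof (intro ballI)
      fix f g assume f: "f \<in> Cc T" and g: "g \<in> carrier Q"
      note cone = Cc_max_zero[OF f] Cc_max_zero[OF Cc_on_minus[OF f]]
      show "cone_extension (\<lambda>x. f (g \<otimes> x)) = cone_extension f"
        using J_left[OF Cc_nonnegD(1)[OF cone(1)] g] J_left[OF Cc_nonnegD(1)[OF cone(2)] g]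
        by (simp add: cone_extension_def)
    qed
  qed
qed

end

section \<open>Discrete and cocompact subgroups\<close>

lemma interior_of_finite_Union_empty:
  assumes "finite F" "\<And>S. S \<in> F \<Longrightarrow> closedin X S \<and> X interior_of S = {}"
  shows "X interior_of (\<Union>F) = {}"
  using assms by (induction F rule: finite_induct) (auto simp: interior_of_union_eq_empty)

locale discrete_subgroup = lc_group Q T for Q :: "('a, 'm) monoid_scheme" (structure) and T :: "'a topology" +
  fixes L :: "'a set"
  assumes L_subgroup: "subgroup L Q"
    and L_discrete: "subtopology T L = discrete_topology L"
begin

lemma L_carrier: "l \<in> L \<Longrightarrow> l \<in> carrier Q"
  using L_subgroup subgroup.mem_carrier by metis

lemma L_subset: "L \<subseteq> carrier Q"
  using L_carrier by blast

lemma L_closed [simp]: "l \<in> L \<Longrightarrow> m \<in> L \<Longrightarrow> l \<otimes> m \<in> L" "l \<in> L \<Longrightarrow> inv l \<in> L" "\<one> \<in> L"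
  using L_subgroup by (auto simp: subgroup.m_closed subgroup.m_inv_closed subgroup.one_closed)

lemma compactin_carrier: "compactin T C \<Longrightarrow> x \<in> C \<Longrightarrow> x \<in> carrier Q"
  using compactin_subset_topspace by fastforce

lemma nbhd_inj_on_L:
  assumes c: "c \<in> carrier Q"
  obtains N where "openin T N" "c \<in> N" "\<And>l m. l \<in> L \<inter> N \<Longrightarrow> m \<in> L \<inter> N \<Longrightarrow> l = m"
proof -
  have "openin (subtopology T L) {\<one>}" by (simp add: L_discrete)
  then obtain U where U: "openin T U" "U \<inter> L = {\<one>}" by (auto simp: openin_subtopology)
  let ?P = "prod_topology T T"
  have "continuous_map ?P T (\<lambda>z. inv (fst z) \<otimes> snd z)"
    by (intro continuous_map_group_mult continuous_map_group_inv continuous_map_fst continuous_map_snd)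
  note W = openin_continuous_map_preimage[OF this U(1)]
  have "{c} \<times> {c} \<subseteq> {z \<in> topspace ?P. inv (fst z) \<otimes> snd z \<in> U}"
    using U c by auto
  from tube_lemma_right[OF W _ _ this] obtain V1 V2 where V: "openin T V1" "openin T V2" "c \<in> V1" "c \<in> V2"
    and V_U: "V1 \<times> V2 \<subseteq> {z \<in> topspace ?P. inv (fst z) \<otimes> snd z \<in> U}"
    using c by auto
  show ?thesis
  proof (rule that[of "V1 \<inter> V2"])
    fix l m assume l: "l \<in> L \<inter> (V1 \<inter> V2)" and m: "m \<in> L \<inter> (V1 \<inter> V2)"
    then have "inv l \<otimes> m \<in> U \<inter> L" using V_U by auto
    then have "l \<otimes> (inv l \<otimes> m) = l \<otimes> \<one>" using U(2) by simp
    then show "l = m" using l m L_carrier by simp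
  qed (use V in auto)
qed

lemma finite_L_Int_compact:
  assumes C: "compactin T C"
  shows "finite (L \<inter> C)"
proof (rule ccontr)
  assume "infinite (L \<inter> C)"
  then obtain c where c: "c \<in> C" "c \<in> T derived_set_of (L \<inter> C)"
    using compactin_imp_Bolzano_Weierstrass[OF C, of "L \<inter> C"] by auto
  obtain N where N: "openin T N" "c \<in> N" "\<And>l m. l \<in> L \<inter> N \<Longrightarrow> m \<in> L \<inter> N \<Longrightarrow> l = m"
    by (rule nbhd_inj_on_L[OF compactin_carrier[OF C c(1)]]) (rule that)
  have accumulation: "\<exists>l. l \<noteq> c \<and> l \<in> L \<inter> C \<and> l \<in> U" if "openin T U" "c \<in> U" for U
    using c(2) that by (auto simp: in_derived_set_of)
  obtain l where l: "l \<noteq> c" "l \<in> L \<inter> C" "l \<in> N"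
    using accumulation[OF N(1,2)] by blast
  have "openin T (N - {l})"
    using N(1) l(3) openin_subset[OF N(1)] Hausdorff
    by (intro openin_diff closedin_Hausdorff_singleton) auto
  then obtain m where "m \<in> L" "m \<in> N - {l}"
    using accumulation[of "N - {l}"] N(2) l(1) by blast
  then show False using N(3)[of l m] l by blast
qed

lemma finite_returns:
  assumes K: "compactin T K" and C: "compactin T C"
  shows "finite {l \<in> L. \<exists>x\<in>C. l \<otimes> x \<in> K}"
proof -
  let ?quot = "\<lambda>z. fst z \<otimes> inv (snd z)"
  have "compactin T (?quot ` (K \<times> C))"
    using K C by (intro image_compactin[of "prod_topology T T"])
      (auto simp: compactin_Times
        intro!: continuous_map_group_mult continuous_map_group_inv continuous_map_fst continuous_map_snd)
  then have "finite (L \<inter> ?quot ` (K \<times> C))"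
    by (rule finite_L_Int_compact)
  moreover have "l \<in> ?quot ` (K \<times> C)" if "l \<in> L" "x \<in> C" "l \<otimes> x \<in> K" for l x
    using that L_carrier compactin_carrier[OF C]
    by (intro image_eqI[of _ _ "(l \<otimes> x, x)"]) (auto simp: m_assoc)
  ultimately show ?thesis by (auto elim!: finite_subset[rotated])
qed

lemma finite_orbit_Int_compact:
  assumes "compactin T C" "x \<in> carrier Q"
  shows "finite {l \<in> L. l \<otimes> x \<in> C}"
  using finite_returns[OF assms(1), of "{x}"] assms(2) by simp

subsection \<open>Periodization\<close>

definition periodize :: "('a \<Rightarrow> real) \<Rightarrow> 'a \<Rightarrow> real" where
  "periodize f x = (\<Sum>l | l \<in> L \<and> f (l \<otimes> x) \<noteq> 0. f (l \<otimes> x))"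

lemma periodize_eq_sum:
  assumes "finite S" "S \<subseteq> L" "\<And>l. l \<in> L \<Longrightarrow> l \<notin> S \<Longrightarrow> f (l \<otimes> x) = 0"
  shows "periodize f x = (\<Sum>l\<in>S. f (l \<otimes> x))"
  unfolding periodize_def using assms by (intro sum.mono_neutral_left) auto

lemma periodize_translate:
  assumes "m \<in> L" "x \<in> carrier Q"
  shows "periodize f (m \<otimes> x) = periodize f x"
  unfolding periodize_def
  by (rule sum.reindex_bij_witness[where i="\<lambda>l. l \<otimes> inv m" and j="\<lambda>l. l \<otimes> m"])
    (use assms L_carrier in \<open>auto simp: m_assoc\<close>)

lemma periodize_eq_sum_on_compact:
  assumes K: "compactin T K" "\<forall>x\<in>topspace T. x \<notin> K \<longrightarrow> f x = 0" and C: "compactin T C" "x \<in> C"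
  shows "periodize f x = (\<Sum>l\<in>{l \<in> L. \<exists>y\<in>C. l \<otimes> y \<in> K}. f (l \<otimes> x))"
proof (rule periodize_eq_sum[OF finite_returns[OF K(1) C(1)]])
  show "f (l \<otimes> x) = 0" if "l \<in> L" "l \<notin> {l \<in> L. \<exists>y\<in>C. l \<otimes> y \<in> K}" for l
    using that C(2) K(2) L_carrier compactin_carrier[OF C] by auto
qed auto

lemma periodize_continuous:
  assumes f: "f \<in> Cc T"
  shows "continuous_map T euclideanreal (periodize f)"
proof -
  obtain K where K: "compactin T K" "\<forall>x\<in>topspace T. x \<notin> K \<longrightarrow> f x = 0"
    using Cc_on_support[OF f] by metis
  have "\<forall>x\<in>carrier Q. \<exists>U C. openin T U \<and> compactin T C \<and> x \<in> U \<and> U \<subseteq> C"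
    using locally_compact unfolding locally_compact_space_def by auto
  then obtain U C where U: "\<And>x. x \<in> carrier Q \<Longrightarrow> openin T (U x)" "\<And>x. x \<in> carrier Q \<Longrightarrow> x \<in> U x"
    and C: "\<And>x. x \<in> carrier Q \<Longrightarrow> compactin T (C x)" "\<And>x. x \<in> carrier Q \<Longrightarrow> U x \<subseteq> C x"
    by metis
  define S where "S x = {l \<in> L. \<exists>y\<in>C x. l \<otimes> y \<in> K}" for x
  have local_sum: "periodize f y = (\<Sum>l\<in>S x. f (l \<otimes> y))" if "x \<in> carrier Q" "y \<in> U x" for x y
    unfolding S_def using that C by (intro periodize_eq_sum_on_compact[OF K]) auto
  show ?thesis
  proof (rule pasting_lemma[where I="carrier Q" and T=U and f="\<lambda>x y. \<Sum>l\<in>S x. f (l \<otimes> y)"])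
    show "continuous_map (subtopology T (U x)) euclideanreal (\<lambda>y. \<Sum>l\<in>S x. f (l \<otimes> y))"
      if "x \<in> carrier Q" for x
      using finite_returns[OF K(1) C(1)[OF that]]
      by (intro continuous_map_from_subtopology continuous_map_sum Cc_on_continuous[OF Cc_left[OF f L_carrier]])
        (auto simp: S_def)
    show "(\<Sum>l\<in>S x. f (l \<otimes> z)) = (\<Sum>l\<in>S y. f (l \<otimes> z))"
      if "x \<in> carrier Q" "y \<in> carrier Q" "z \<in> topspace T \<inter> U x \<inter> U y" for x y z
      using that by (simp flip: local_sum)
  qed (use U local_sum in auto)
qed

lemma integral_mult_periodize:
  assumes I: "pos_functional T I" and w: "w \<in> Cc T" and h: "h \<in> Cc T"
    and K: "compactin T K" "\<forall>x\<in>topspace T. x \<notin> K \<longrightarrow> w x = 0" "\<forall>x\<in>topspace T. x \<notin> K \<longrightarrow> h x = 0"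
  shows "I (\<lambda>x. w x * periodize h x) = (\<Sum>l\<in>{l \<in> L. \<exists>x\<in>K. l \<otimes> x \<in> K}. I (\<lambda>x. w x * h (l \<otimes> x)))"
proof -
  interpret pos_functional T I by (rule I)
  let ?S = "{l \<in> L. \<exists>x\<in>K. l \<otimes> x \<in> K}"
  have S: "finite ?S" by (rule finite_returns[OF K(1) K(1)])
  have term_Cc: "(\<lambda>x. w x * h (l \<otimes> x)) \<in> Cc T" if "l \<in> ?S" for l
    using that by (intro Cc_on_mult(1)[OF w] Cc_on_continuous[OF Cc_left[OF h L_carrier]]) auto
  have "I (\<lambda>x. w x * periodize h x) = I (\<lambda>x. \<Sum>l\<in>?S. w x * h (l \<otimes> x))"
  proof (rule I_cong[OF Cc_on_mult(1)[OF w periodize_continuous[OF h]]])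
    show "w x * periodize h x = (\<Sum>l\<in>?S. w x * h (l \<otimes> x))" if "x \<in> topspace T" for x
    proof (cases "x \<in> K")
      case True
      then show ?thesis
        by (simp only: periodize_eq_sum_on_compact[OF K(1,3,1) True] sum_distrib_left)
    qed (use K(2) that in simp)
  qed
  also have "\<dots> = (\<Sum>l\<in>?S. I (\<lambda>x. w x * h (l \<otimes> x)))" by (rule I_sum[OF S term_Cc])
  finally show ?thesis .
qed

lemma periodize_self_adjoint:
  assumes I: "pos_functional T I" and left: "left_invariant L I"
    and w: "w \<in> Cc T" and h: "h \<in> Cc T"
  shows "I (\<lambda>x. w x * periodize h x) = I (\<lambda>x. h x * periodize w x)"
proof -
  interpret pos_functional T I by (rule I)
  obtain K1 where K1: "compactin T K1" "\<And>x. x \<in> topspace T \<Longrightarrow> x \<notin> K1 \<Longrightarrow> w x = 0"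
    using Cc_on_support[OF w] by metis
  obtain K2 where K2: "compactin T K2" "\<And>x. x \<in> topspace T \<Longrightarrow> x \<notin> K2 \<Longrightarrow> h x = 0"
    using Cc_on_support[OF h] by metis
  define K where "K = K1 \<union> K2"
  have K: "compactin T K" unfolding K_def using K1(1) K2(1) by (rule compactin_Un)
  have w0: "\<forall>x\<in>topspace T. x \<notin> K \<longrightarrow> w x = 0" and h0: "\<forall>x\<in>topspace T. x \<notin> K \<longrightarrow> h x = 0"
    using K1(2) K2(2) by (auto simp: K_def)
  define S where "S = {l \<in> L. \<exists>x\<in>K. l \<otimes> x \<in> K}"
  have S_carrier: "l \<in> L" "l \<in> carrier Q" if "l \<in> S" for l using that L_carrier by (auto simp: S_def)
  have S_inv: "inv l \<in> S" if l: "l \<in> S" for l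
  proof -
    obtain x where "x \<in> K" "l \<otimes> x \<in> K" using l by (auto simp: S_def)
    then show ?thesis
      using S_carrier[OF l] compactin_carrier[OF K] by (auto simp: S_def intro!: bexI[of _ "l \<otimes> x"])
  qed
  have move: "I (\<lambda>x. w x * h (l \<otimes> x)) = I (\<lambda>x. h x * w (inv l \<otimes> x))" if l: "l \<in> S" for l
  proof -
    note lL = S_carrier[OF l]
    have hw: "(\<lambda>x. h x * w (inv l \<otimes> x)) \<in> Cc T"
      using lL by (intro Cc_on_mult(1)[OF h] Cc_on_continuous[OF Cc_left[OF w]]) auto
    have "I (\<lambda>x. w x * h (l \<otimes> x)) = I (\<lambda>x. h (l \<otimes> x) * w (inv l \<otimes> (l \<otimes> x)))"
      by (rule I_cong[OF Cc_on_mult(1)[OF w Cc_on_continuous[OF Cc_left[OF h lL(2)]]]])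
        (use lL in simp)
    also have "\<dots> = I (\<lambda>x. h x * w (inv l \<otimes> x))" by (rule left_invariantD[OF left hw lL(1)])
    finally show ?thesis .
  qed
  have "I (\<lambda>x. w x * periodize h x) = (\<Sum>l\<in>S. I (\<lambda>x. h x * w (inv l \<otimes> x)))"
    using integral_mult_periodize[OF I w h K w0 h0] move by (simp flip: S_def)
  also have "\<dots> = (\<Sum>l\<in>S. I (\<lambda>x. h x * w (l \<otimes> x)))"
    by (rule sum.reindex_bij_witness[where i="\<lambda>l. inv l" and j="\<lambda>l. inv l"]) (auto simp: S_carrier S_inv)
  also have "\<dots> = I (\<lambda>x. h x * periodize w x)"
    unfolding S_def by (rule integral_mult_periodize[OF I h w K h0 w0, symmetric])
  finally show ?thesis .
qed

lemma integral_unfold: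
  assumes I: "pos_functional T I" and left: "left_invariant L I"
    and w: "w \<in> Cc T" "\<forall>x\<in>carrier Q. periodize w x = 1" and h: "h \<in> Cc T"
  shows "I (\<lambda>x. w x * periodize h x) = I h"
proof -
  interpret pos_functional T I by (rule I)
  have "I (\<lambda>x. h x * periodize w x) = I h"
    using w(2) by (intro I_cong Cc_on_mult(1)[OF h periodize_continuous[OF w(1)]]) simp
  then show ?thesis using periodize_self_adjoint[OF I left w(1) h] by simp
qed

lemma periodize_left_eq_sum_on_compact:
  assumes K: "compactin T K" and f: "f \<in> Cc T"
  obtains S where "finite S" "S \<subseteq> L"
    "\<And>x y. x \<in> K \<Longrightarrow> y \<in> K \<Longrightarrow> periodize (\<lambda>y. f (inv x \<otimes> y)) y = (\<Sum>l\<in>S. f (inv x \<otimes> (l \<otimes> y)))"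
proof -
  obtain Kf where Kf: "compactin T Kf" "\<And>x. x \<in> topspace T \<Longrightarrow> x \<notin> Kf \<Longrightarrow> f x = 0"
    using Cc_on_support[OF f] by metis
  define M where "M = (\<lambda>z. fst z \<otimes> snd z) ` (K \<times> Kf)"
  have M: "compactin T M"
    unfolding M_def using K Kf(1) by (intro image_compactin[of "prod_topology T T"])
      (auto simp: compactin_Times intro!: continuous_map_group_mult continuous_map_fst continuous_map_snd)
  show ?thesis
  proof (rule that[OF finite_returns[OF M K]])
    fix x y assume x: "x \<in> K" and y: "y \<in> K"
    have xQ: "x \<in> carrier Q" by (rule compactin_carrier[OF K x])
    have "f (inv x \<otimes> z) = 0" if z: "z \<in> topspace T" "z \<notin> M" for z
    proof (rule Kf(2))
      show "inv x \<otimes> z \<notin> Kf"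
      proof
        assume "inv x \<otimes> z \<in> Kf"
        then have "x \<otimes> (inv x \<otimes> z) \<in> M" using x unfolding M_def by force
        then show False using z xQ by simp
      qed
    qed (use xQ z in simp)
    then show "periodize (\<lambda>y. f (inv x \<otimes> y)) y =
        (\<Sum>l\<in>{l \<in> L. \<exists>x\<in>K. l \<otimes> x \<in> M}. f (inv x \<otimes> (l \<otimes> y)))"
      by (intro periodize_eq_sum_on_compact[OF M _ K y]) blast
  qed auto
qed

lemma orbit_kernel_Cc:
  assumes w: "w \<in> Cc T" and f: "f \<in> Cc T"
  shows "(\<lambda>z. w (fst z) * (w (snd z) * periodize (\<lambda>y. f (inv (fst z) \<otimes> y)) (snd z)))
    \<in> Cc (prod_topology T T)"
proof -
  let ?P = "prod_topology T T"
  obtain K where K: "compactin T K" "\<And>x. x \<in> topspace T \<Longrightarrow> x \<notin> K \<Longrightarrow> w x = 0"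
    using Cc_on_support[OF w] by metis
  obtain S where S: "finite S" "S \<subseteq> L"
    "\<And>x y. x \<in> K \<Longrightarrow> y \<in> K \<Longrightarrow> periodize (\<lambda>y. f (inv x \<otimes> y)) y = (\<Sum>l\<in>S. f (inv x \<otimes> (l \<otimes> y)))"
    by (rule periodize_left_eq_sum_on_compact[OF K(1) f]) (rule that)
  let ?F = "\<lambda>z. w (fst z) * (w (snd z) * (\<Sum>l\<in>S. f (inv (fst z) \<otimes> (l \<otimes> snd z))))"
  have "continuous_map ?P euclideanreal (\<lambda>z. w (fst z))" "continuous_map ?P euclideanreal (\<lambda>z. w (snd z))"
    using continuous_map_compose[OF continuous_map_fst Cc_on_continuous[OF w]]
      continuous_map_compose[OF continuous_map_snd Cc_on_continuous[OF w]] by (auto simp: o_def)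
  moreover have "continuous_map ?P euclideanreal (\<lambda>z. f (inv (fst z) \<otimes> (l \<otimes> snd z)))" if "l \<in> S" for l
  proof -
    have "continuous_map ?P T (\<lambda>z. inv (fst z) \<otimes> (l \<otimes> snd z))"
      using that S(2) L_carrier
      by (intro continuous_map_group_mult continuous_map_group_inv continuous_map_fst continuous_map_snd) auto
    from continuous_map_compose[OF this Cc_on_continuous[OF f]] show ?thesis by (simp add: o_def)
  qed
  ultimately have "continuous_map ?P euclideanreal ?F"
    using S(1) by (intro continuous_map_real_mult continuous_map_sum) auto
  then have F: "continuous_map ?P euclideanreal
      (\<lambda>z. w (fst z) * (w (snd z) * periodize (\<lambda>y. f (inv (fst z) \<otimes> y)) (snd z)))"
  proof (rule continuous_map_eq)
    show "?F z = w (fst z) * (w (snd z) * periodize (\<lambda>y. f (inv (fst z) \<otimes> y)) (snd z))"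
      if "z \<in> topspace ?P" for z
      using that K(2) S(3) by (cases "fst z \<in> K"; cases "snd z \<in> K") auto
  qed
  have "compactin ?P (K \<times> K)" using K(1) by (simp add: compactin_Times)
  then show ?thesis by (rule Cc_onI[OF F]) (use K(2) in \<open>auto simp: mem_Times_iff\<close>)
qed

lemma integral_orbit_kernel_snd:
  assumes I: "pos_functional T I" and left: "left_invariant (carrier Q) I"
    and w: "w \<in> Cc T" "\<forall>x\<in>carrier Q. periodize w x = 1" and f: "f \<in> Cc T" and x: "x \<in> carrier Q"
  shows "I (\<lambda>y. w y * periodize (\<lambda>y. f (inv x \<otimes> y)) y) = I f"
proof -
  have "I (\<lambda>y. w y * periodize (\<lambda>y. f (inv x \<otimes> y)) y) = I (\<lambda>y. f (inv x \<otimes> y))"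
    by (rule integral_unfold[OF I left_invariant_subset[OF left L_subset] w Cc_left[OF f]]) (use x in simp)
  then show ?thesis using left_invariantD[OF left f] x by simp
qed

lemma periodize_orbit_kernel_swap:
  assumes "x \<in> carrier Q" "y \<in> carrier Q"
  shows "periodize (\<lambda>y. f (inv x \<otimes> y)) y = periodize (\<lambda>x. f (inv x \<otimes> y)) x"
  unfolding periodize_def
  by (rule sum.reindex_bij_witness[where i="\<lambda>l. inv l" and j="\<lambda>l. inv l"])
    (use assms L_carrier in \<open>auto simp: inv_mult_group m_assoc\<close>)

lemma integral_orbit_kernel_fst:
  assumes I: "pos_functional T I" and left: "left_invariant (carrier Q) I"
    and w: "w \<in> Cc T" "\<forall>x\<in>carrier Q. periodize w x = 1" and f: "f \<in> Cc T" and y: "y \<in> carrier Q"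
  shows "I (\<lambda>x. w x * periodize (\<lambda>y. f (inv x \<otimes> y)) y) = I (\<lambda>x. f (inv x))"
proof -
  interpret pos_functional T I by (rule I)
  have fy: "(\<lambda>x. f (inv x \<otimes> y)) \<in> Cc T" by (rule Cc_inv[OF Cc_right[OF f y]])
  have "I (\<lambda>x. w x * periodize (\<lambda>x. f (inv x \<otimes> y)) x) = I (\<lambda>x. w x * periodize (\<lambda>y. f (inv x \<otimes> y)) y)"
    by (rule I_cong[OF Cc_on_mult(1)[OF w(1) periodize_continuous[OF fy]]])
      (use y in \<open>simp add: periodize_orbit_kernel_swap\<close>)
  moreover have "I (\<lambda>x. w x * periodize (\<lambda>x. f (inv x \<otimes> y)) x) = I (\<lambda>x. f (inv x \<otimes> y))"
    by (rule integral_unfold[OF I left_invariant_subset[OF left L_subset] w fy])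
  moreover have "I (\<lambda>x. f (inv x \<otimes> y)) = I (\<lambda>x. f (inv (inv y \<otimes> x)))"
    by (rule I_cong[OF fy]) (use y in \<open>auto simp: inv_mult_group\<close>)
  moreover have "I (\<lambda>x. f (inv (inv y \<otimes> x))) = I (\<lambda>x. f (inv x))"
    using left_invariantD[OF left Cc_inv[OF f], of "inv y"] y by simp
  ultimately show ?thesis by simp
qed

end

locale cocompact_lattice = discrete_subgroup Q T L
  for Q :: "('a, 'm) monoid_scheme" (structure) and T :: "'a topology" and L +
  fixes K0 :: "'a set"
  assumes K0_compact: "compactin T K0"
    and K0_meets_orbit: "\<And>x. x \<in> carrier Q \<Longrightarrow> \<exists>l\<in>L. l \<otimes> x \<in> K0"
begin

lemma periodize_pos:
  assumes u: "u \<in> Cc_nonneg T" and u_pos: "\<forall>x\<in>K0. 0 < u x" and x: "x \<in> carrier Q"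
  shows "0 < periodize u x"
proof -
  obtain K where K: "compactin T K" "\<forall>x\<in>topspace T. x \<notin> K \<longrightarrow> u x = 0"
    using Cc_on_support[OF Cc_nonnegD(1)[OF u]] by metis
  obtain m where m: "m \<in> L" "m \<otimes> x \<in> K0" using K0_meets_orbit[OF x] by blast
  have "0 < (\<Sum>l\<in>{l \<in> L. l \<otimes> x \<in> K}. u (l \<otimes> x))"
  proof (rule sum_pos2[OF finite_orbit_Int_compact[OF K(1) x]])
    show "0 < u (m \<otimes> x)" using u_pos m(2) by blast
    then show "m \<in> {l \<in> L. l \<otimes> x \<in> K}" using K(2) m(1) x L_carrier by force
    show "0 \<le> u (l \<otimes> x)" if "l \<in> {l \<in> L. l \<otimes> x \<in> K}" for l
      using that x L_carrier by (intro Cc_nonnegD(2)[OF u]) simp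
  qed
  also have "\<dots> = periodize u x"
    using x periodize_eq_sum_on_compact[OF K, of "{x}" x] by simp
  finally show ?thesis .
qed

lemma periodize_normalized:
  assumes u: "u \<in> Cc_nonneg T" and u_pos: "\<forall>x\<in>K0. 0 < u x" and x: "x \<in> carrier Q"
  shows "periodize (\<lambda>y. u y / periodize u y) x = 1"
proof -
  obtain K where K: "compactin T K" "\<forall>x\<in>topspace T. x \<notin> K \<longrightarrow> u x = 0"
    using Cc_on_support[OF Cc_nonnegD(1)[OF u]] by metis
  let ?S = "{l \<in> L. \<exists>y\<in>{x}. l \<otimes> y \<in> K}"
  have x_compact: "compactin T {x}" "x \<in> {x}" using x by simp_all
  have "periodize (\<lambda>y. u y / periodize u y) x = (\<Sum>l\<in>?S. u (l \<otimes> x) / periodize u (l \<otimes> x))"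
    by (rule periodize_eq_sum_on_compact[OF K(1) _ x_compact]) (use K(2) in auto)
  also have "\<dots> = (\<Sum>l\<in>?S. u (l \<otimes> x) / periodize u x)"
    by (rule sum.cong) (use x in \<open>auto simp: periodize_translate\<close>)
  also have "\<dots> = periodize u x / periodize u x"
    by (simp only: periodize_eq_sum_on_compact[OF K x_compact] sum_divide_distrib)
  also have "\<dots> = 1" using periodize_pos[OF u u_pos x] by simp
  finally show ?thesis .
qed

lemma normalized_Cc_pos:
  assumes u: "u \<in> Cc_nonneg T" and u_pos: "\<forall>x\<in>K0. 0 < u x"
  shows "(\<lambda>x. u x / periodize u x) \<in> Cc_pos T"
proof -
  note u_Cc = Cc_nonnegD(1)[OF u] and per_pos = periodize_pos[OF u u_pos]
  have "(\<lambda>x. u x / periodize u x) \<in> Cc T"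
    using per_pos by (intro Cc_on_divide[OF u_Cc periodize_continuous[OF u_Cc]]) fastforce
  moreover obtain x where x: "x \<in> K0" using K0_meets_orbit[of \<one>] by auto
  moreover have "0 < u x / periodize u x"
    using u_pos x per_pos[OF compactin_carrier[OF K0_compact x]] by simp
  ultimately show ?thesis
    using compactin_carrier[OF K0_compact] Cc_nonnegD(2)[OF u] per_pos
    by (auto simp: Cc_pos_def Cc_nonneg_def intro!: divide_nonneg_pos)
qed

lemma normalized_bump:
  obtains w where "w \<in> Cc_pos T" "\<forall>x\<in>carrier Q. periodize w x = 1"
proof -
  obtain u where u: "u \<in> Cc T" "\<And>x. 0 \<le> u x" "\<And>x. x \<in> K0 \<Longrightarrow> u x = 1"
    by (rule bump_on_compact[OF K0_compact]) (rule that)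
  then have "u \<in> Cc_nonneg T" "\<forall>x\<in>K0. 0 < u x" by (auto simp: Cc_nonneg_def)
  from that[OF normalized_Cc_pos[OF this]] periodize_normalized[OF this] show ?thesis by blast
qed

text \<open>Unimodularity: the two iterated integrals of \<open>w x * w y * (\<Sum>l\<in>L. f (inv x \<otimes> l \<otimes> y))\<close> unfold to
  \<open>I w * I f\<close> and \<open>I w * I (\<lambda>x. f (inv x))\<close>.\<close>

lemma inversion_invariant:
  assumes "pos_functional T I" and pos: "\<forall>f\<in>Cc_pos T. 0 < I f"
    and left: "left_invariant (carrier Q) I"
    and f: "f \<in> Cc T"
  shows "I (\<lambda>x. f (inv x)) = I f"
proof -
  interpret pos_functional T I by fact
  obtain w where w: "w \<in> Cc_pos T" "\<forall>x\<in>carrier Q. periodize w x = 1"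
    by (rule normalized_bump) (rule that)
  note w_Cc = Cc_nonnegD(1)[OF Cc_pos_nonneg[OF w(1)]]
  define F where "F z = w (fst z) * (w (snd z) * periodize (\<lambda>y. f (inv (fst z) \<otimes> y)) (snd z))" for z
  have F: "F \<in> Cc (prod_topology T T)" using orbit_kernel_Cc[OF w_Cc f] by (simp add: F_def[abs_def])
  have inner_y: "I (\<lambda>y. F (x, y)) = w x * I f" if x: "x \<in> carrier Q" for x
  proof -
    have "(\<lambda>y. f (inv x \<otimes> y)) \<in> Cc T" using Cc_left[OF f] x by simp
    from I_scale[OF Cc_on_mult(1)[OF w_Cc periodize_continuous[OF this]]] show ?thesis
      unfolding F_def by (simp add: integral_orbit_kernel_snd[OF pos_functional_axioms left w_Cc w(2) f x])
  qed
  have inner_x: "I (\<lambda>x. F (x, y)) = w y * I (\<lambda>x. f (inv x))" if y: "y \<in> carrier Q" for y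
  proof -
    have "continuous_map T euclideanreal (\<lambda>x. periodize (\<lambda>y. f (inv x \<otimes> y)) y)"
      by (rule continuous_map_eq[OF periodize_continuous[OF Cc_inv[OF Cc_right[OF f y]]]])
        (simp add: periodize_orbit_kernel_swap y)
    from I_scale[OF Cc_on_mult(1)[OF w_Cc this], of "w y"] show ?thesis
      unfolding F_def
      by (simp add: integral_orbit_kernel_fst[OF pos_functional_axioms left w_Cc w(2) f y] mult.left_commute)
  qed
  have "I w * I f = I (\<lambda>x. w x * I f)" using I_scale_right[OF w_Cc] by simp
  also have "\<dots> = I (\<lambda>x. I (\<lambda>y. F (x, y)))"
    by (rule I_cong[OF Cc_on_scale_right[OF w_Cc]]) (simp add: inner_y)
  also have "\<dots> = I (\<lambda>y. I (\<lambda>x. F (x, y)))" by (rule fubini[OF pos_functional_axioms F])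
  also have "\<dots> = I (\<lambda>y. w y * I (\<lambda>x. f (inv x)))"
    by (rule I_cong[symmetric, OF Cc_on_scale_right[OF w_Cc]]) (simp add: inner_x)
  also have "\<dots> = I w * I (\<lambda>x. f (inv x))" by (rule I_scale_right[OF w_Cc])
  finally show ?thesis using pos w(1) by force
qed

lemma bi_invariant_functional:
  assumes w: "w \<in> Cc_pos T"
  obtains I where "pos_functional T I" "I w = 1"
    "left_invariant (carrier Q) I" "right_invariant (carrier Q) I"
proof -
  obtain I where I: "pos_functional T I" "\<forall>f\<in>Cc_pos T. 0 < I f" "left_invariant (carrier Q) I"
    by (rule Haar_functional) (rule that)
  interpret pos_functional T I by (rule I)
  note inv = inversion_invariant[OF I]
  have right: "I (\<lambda>x. f (x \<otimes> g)) = I f" if f: "f \<in> Cc T" and g: "g \<in> carrier Q" for f g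
  proof -
    note fg = Cc_right[OF f g] and f_inv = Cc_inv[OF f]
    have "I (\<lambda>x. f (x \<otimes> g)) = I (\<lambda>x. f (inv x \<otimes> g))" using inv[OF fg] by simp
    also have "\<dots> = I (\<lambda>x. f (inv (inv g \<otimes> x)))"
      by (rule I_cong[OF Cc_inv[OF fg]]) (use g in \<open>auto simp: inv_mult_group\<close>)
    also have "\<dots> = I (\<lambda>x. f (inv x))" using left_invariantD[OF I(3) f_inv, of "inv g"] g by simp
    also have "\<dots> = I f" by (rule inv[OF f])
    finally show ?thesis .
  qed
  show ?thesis
    using pos_functional_divide[OF bspec[OF I(2) w]] bspec[OF I(2) w] I(3) right
    by (intro that[of "\<lambda>f. I f / I w"]) (auto simp: left_invariant_def right_invariant_def)
qed

lemma interior_of_translate_empty: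
  assumes l: "l \<in> carrier Q" and D: "T interior_of D = {}"
  shows "T interior_of {x \<in> topspace T. l \<otimes> x \<in> D} = {}"
proof -
  let ?O = "T interior_of {x \<in> topspace T. l \<otimes> x \<in> D}"
  let ?lO = "{y \<in> topspace T. inv l \<otimes> y \<in> ?O}"
  have O: "l \<otimes> x \<in> D" "x \<in> carrier Q" if "x \<in> ?O" for x
    using that interior_of_subset[of T "{x \<in> topspace T. l \<otimes> x \<in> D}"] by auto
  have "openin T ?lO"
    using l by (intro openin_continuous_map_preimage[OF continuous_map_left]) auto
  moreover have "?lO \<subseteq> D" using l O(1) by fastforce
  ultimately have "?lO = {}" using D interior_of_maximal by blast
  moreover have "l \<otimes> x \<in> ?lO" if "x \<in> ?O" for x using that l O(2) by simp
  ultimately show ?thesis by blast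
qed

lemma closed_cover_has_interior:
  assumes J: "finite J" and closed: "\<And>i. i \<in> J \<Longrightarrow> closedin T (D i)" and cover: "K0 \<subseteq> (\<Union>i\<in>J. D i)"
  shows "\<exists>i\<in>J. T interior_of (D i) \<noteq> {}"
proof (rule ccontr)
  assume "\<not> ?thesis"
  then have empty: "T interior_of (D i) = {}" if "i \<in> J" for i using that by blast
  obtain U C where UC: "openin T U" "compactin T C" "\<one> \<in> U" "U \<subseteq> C"
    using locally_compact unfolding locally_compact_space_def by (metis one_closed topspace_eq)
  define S where "S = {l \<in> L. \<exists>x\<in>C. l \<otimes> x \<in> K0}"
  have S: "finite S" unfolding S_def by (rule finite_returns[OF K0_compact UC(2)])
  have S_carrier: "l \<in> carrier Q" if "l \<in> S" for l using that L_carrier by (simp add: S_def)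
  let ?Z = "\<lambda>(l, i). {x \<in> topspace T. l \<otimes> x \<in> D i}"
  have "U \<subseteq> \<Union>(?Z ` (S \<times> J))"
  proof
    fix x assume x: "x \<in> U"
    have xQ: "x \<in> carrier Q" using x openin_subset[OF UC(1)] by auto
    obtain l where l: "l \<in> L" "l \<otimes> x \<in> K0" using K0_meets_orbit[OF xQ] by blast
    then have "l \<in> S" using x UC(4) by (auto simp: S_def)
    moreover obtain i where "i \<in> J" "l \<otimes> x \<in> D i" using l(2) cover by blast
    ultimately show "x \<in> \<Union>(?Z ` (S \<times> J))" using xQ by auto
  qed
  moreover have "T interior_of (\<Union>(?Z ` (S \<times> J))) = {}"
  proof (rule interior_of_finite_Union_empty)
    show "closedin T Z \<and> T interior_of Z = {}" if Z: "Z \<in> ?Z ` (S \<times> J)" for Z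
    proof -
      obtain l i where li: "l \<in> S" "i \<in> J" "Z = ?Z (l, i)" using Z by blast
      then show ?thesis
        using closedin_continuous_map_preimage[OF continuous_map_left[OF S_carrier] closed]
          interior_of_translate_empty[OF S_carrier empty]
        by simp
    qed
  qed (use S J in auto)
  ultimately show False using UC(1,3) interior_of_maximal by fastforce
qed

end

section \<open>Quasimorphisms on a group extension\<close>

lemma (in group) quasimorphism_extension_from_odd_approximation:
  fixes \<phi> \<Psi> :: "'a \<Rightarrow> real"
  assumes H: "subgroup H G"
    and \<phi>: "\<And>h k. h \<in> H \<Longrightarrow> k \<in> H \<Longrightarrow> \<bar>\<phi> (h \<otimes> k) - \<phi> h - \<phi> k\<bar> \<le> E"
    and \<Psi>: "\<And>x y. x \<in> carrier G \<Longrightarrow> y \<in> carrier G \<Longrightarrow> \<bar>\<Psi> (x \<otimes> y) - \<Psi> x - \<Psi> y\<bar> \<le> E"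
    and odd: "\<And>x. x \<in> carrier G \<Longrightarrow> \<Psi> (inv x) = - \<Psi> x"
    and left: "\<And>h x. h \<in> H \<Longrightarrow> x \<in> carrier G \<Longrightarrow> \<bar>\<Psi> (h \<otimes> x) - \<Psi> x - \<phi> h\<bar> \<le> E"
    and right: "\<And>x h. x \<in> carrier G \<Longrightarrow> h \<in> H \<Longrightarrow> \<bar>\<Psi> (x \<otimes> h) - \<Psi> x - \<phi> h\<bar> \<le> E"
  obtains \<psi> where "\<And>h. h \<in> H \<Longrightarrow> \<psi> h = \<phi> h"
    "\<And>x y. x \<in> carrier G \<Longrightarrow> y \<in> carrier G \<Longrightarrow> \<bar>\<psi> (x \<otimes> y) - \<psi> x - \<psi> y\<bar> \<le> E"
proof -
  interpret H: subgroup H G by (rule H)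
  define \<psi> where "\<psi> x = (if x \<in> H then \<phi> x else \<Psi> x)" for x
  have "\<bar>\<psi> (x \<otimes> y) - \<psi> x - \<psi> y\<bar> \<le> E" if x: "x \<in> carrier G" and y: "y \<in> carrier G" for x y
  proof (cases "x \<in> H"; cases "y \<in> H")
    assume "x \<in> H" "y \<in> H"
    then show ?thesis using \<phi> by (simp add: \<psi>_def)
  next
    assume xH: "x \<in> H" and yH: "y \<notin> H"
    then have "x \<otimes> y \<notin> H" using y H.m_closed[OF H.m_inv_closed[OF xH], of "x \<otimes> y"] by auto
    then show ?thesis using xH yH left[OF xH y] by (simp add: \<psi>_def algebra_simps)
  next
    assume xH: "x \<notin> H" and yH: "y \<in> H"
    then have "x \<otimes> y \<notin> H" using x H.m_closed[OF _ H.m_inv_closed[OF yH], of "x \<otimes> y"] by (auto simp: m_assoc)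
    then show ?thesis using xH yH right[OF x yH] by (simp add: \<psi>_def)
  next
    assume xH: "x \<notin> H" and yH: "y \<notin> H"
    show ?thesis
    proof (cases "x \<otimes> y \<in> H")
      case True
      have "\<bar>\<Psi> y - \<Psi> (inv x) - \<phi> (x \<otimes> y)\<bar> \<le> E"
        using right[OF _ True, of "inv x"] x y by simp
      then show ?thesis using xH yH True odd[OF x] by (simp add: \<psi>_def)
    next
      case False
      then show ?thesis using xH yH \<Psi>[OF x y] by (simp add: \<psi>_def)
    qed
  qed
  then show ?thesis by (intro that[of \<psi>]) (auto simp: \<psi>_def)
qed

lemma (in group) quasimorphism_extension_from_approximation:
  fixes \<phi> \<Phi> :: "'a \<Rightarrow> real"
  assumes H: "subgroup H G"
    and \<phi>: "\<And>h k. h \<in> H \<Longrightarrow> k \<in> H \<Longrightarrow> \<bar>\<phi> (h \<otimes> k) - \<phi> h - \<phi> k\<bar> \<le> E"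
    and \<Phi>: "\<And>x y. x \<in> carrier G \<Longrightarrow> y \<in> carrier G \<Longrightarrow> \<bar>\<Phi> (x \<otimes> y) - \<Phi> x - \<Phi> y\<bar> \<le> E"
    and left: "\<And>h x. h \<in> H \<Longrightarrow> x \<in> carrier G \<Longrightarrow> \<bar>\<Phi> (h \<otimes> x) - \<Phi> x - \<phi> h\<bar> \<le> E"
    and right: "\<And>x h. x \<in> carrier G \<Longrightarrow> h \<in> H \<Longrightarrow> \<bar>\<Phi> (x \<otimes> h) - \<Phi> x - \<phi> h\<bar> \<le> E"
  obtains \<psi> where "\<And>h. h \<in> H \<Longrightarrow> \<psi> h = \<phi> h"
    "\<And>x y. x \<in> carrier G \<Longrightarrow> y \<in> carrier G \<Longrightarrow> \<bar>\<psi> (x \<otimes> y) - \<psi> x - \<psi> y\<bar> \<le> E"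
proof -
  interpret H: subgroup H G by (rule H)
  define \<Psi> where "\<Psi> x = (\<Phi> x - \<Phi> (inv x)) / 2" for x
  show ?thesis
  proof (rule quasimorphism_extension_from_odd_approximation[OF H, of \<phi> E \<Psi>])
    show "\<bar>\<phi> (h \<otimes> k) - \<phi> h - \<phi> k\<bar> \<le> E" if "h \<in> H" "k \<in> H" for h k by (rule \<phi>[OF that])
    show "\<Psi> (inv x) = - \<Psi> x" if "x \<in> carrier G" for x
      unfolding \<Psi>_def inv_inv[OF that] by (simp add: minus_divide_left)
    show "\<bar>\<Psi> (x \<otimes> y) - \<Psi> x - \<Psi> y\<bar> \<le> E" if x: "x \<in> carrier G" and y: "y \<in> carrier G" for x y
      using \<Phi>[OF x y] \<Phi>[OF inv_closed[OF y] inv_closed[OF x]]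
      unfolding \<Psi>_def inv_mult_group[OF x y] abs_le_iff by argo
    show "\<bar>\<Psi> (h \<otimes> x) - \<Psi> x - \<phi> h\<bar> \<le> E" if h: "h \<in> H" and x: "x \<in> carrier G" for h x
    proof -
      have "inv (h \<otimes> x) \<otimes> h = inv x" using h x by (simp add: inv_mult_group m_assoc)
      then have "\<bar>\<Phi> (inv x) - \<Phi> (inv (h \<otimes> x)) - \<phi> h\<bar> \<le> E" using right[of "inv (h \<otimes> x)" h] h x by simp
      then show ?thesis using left[OF h x] unfolding \<Psi>_def abs_le_iff by argo
    qed
    show "\<bar>\<Psi> (x \<otimes> h) - \<Psi> x - \<phi> h\<bar> \<le> E" if x: "x \<in> carrier G" and h: "h \<in> H" for x h
    proof -
      have "h \<otimes> inv (x \<otimes> h) = inv x" using h x by (simp add: inv_mult_group)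
      then have "\<bar>\<Phi> (inv x) - \<Phi> (inv (x \<otimes> h)) - \<phi> h\<bar> \<le> E" using left[of h "inv (x \<otimes> h)"] h x by simp
      then show ?thesis using right[OF x h] unfolding \<Psi>_def abs_le_iff by argo
    qed
  qed (rule that)
qed

locale group_extension = lc_group Q T + G: top_group G TG
  for Q :: "('b, 'd) monoid_scheme" (structure) and T :: "'b topology"
    and G :: "('a, 'c) monoid_scheme" and TG :: "'a topology" +
  fixes q :: "'a \<Rightarrow> 'b"
  assumes q_hom: "q \<in> hom G Q"
begin

sublocale q: group_hom G Q q
  by unfold_locales (rule q_hom)

definition continuous_section :: "'b set \<Rightarrow> ('b \<Rightarrow> 'a) \<Rightarrow> bool" where
  "continuous_section W \<sigma> \<longleftrightarrow> openin T W \<and> continuous_map (subtopology T W) TG \<sigma> \<and> (\<forall>x\<in>W. q (\<sigma> x) = x)"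

lemma continuous_sectionD:
  assumes "continuous_section W \<sigma>"
  shows "openin T W" "continuous_map (subtopology T W) TG \<sigma>" "x \<in> W \<Longrightarrow> q (\<sigma> x) = x"
  using assms by (auto simp: continuous_section_def)

lemma continuous_section_carrier:
  assumes "continuous_section W \<sigma>" "x \<in> W"
  shows "x \<in> carrier Q" "\<sigma> x \<in> carrier G"
proof -
  show x: "x \<in> carrier Q"
    using assms(2) openin_subset[OF continuous_sectionD(1)[OF assms(1)]] by auto
  then show "\<sigma> x \<in> carrier G"
    using continuous_map_image_subset_topspace[OF continuous_sectionD(2)[OF assms(1)]] assms(2) by auto
qed

lemma continuous_section_translate:
  assumes s: "continuous_section V s" and x0: "x0 \<in> V" and g: "g \<in> carrier G" and a: "q g \<otimes> x0 = a"
  obtains W \<sigma> where "a \<in> W" "continuous_section W \<sigma>"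
proof -
  note V = continuous_section_carrier[OF s]
  define W where "W = {x \<in> topspace T. inv (q g) \<otimes> x \<in> V}"
  have shift: "continuous_map T T (\<lambda>x. inv (q g) \<otimes> x)" using g by (intro continuous_map_left) simp
  then have "continuous_map (subtopology T W) (subtopology T V) (\<lambda>x. inv (q g) \<otimes> x)"
    by (auto simp: continuous_map_in_subtopology W_def intro: continuous_map_from_subtopology)
  from continuous_map_compose[OF this continuous_sectionD(2)[OF s]]
  have "continuous_map (subtopology T W) TG (\<lambda>x. s (inv (q g) \<otimes> x))" by (simp add: o_def)
  then have "continuous_map (subtopology T W) TG (\<lambda>x. g \<otimes>\<^bsub>G\<^esub> s (inv (q g) \<otimes> x))"
    using g by (intro G.continuous_map_group_mult) auto
  moreover have "openin T W"
    unfolding W_def by (rule openin_continuous_map_preimage[OF shift continuous_sectionD(1)[OF s]])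
  moreover have "q (g \<otimes>\<^bsub>G\<^esub> s (inv (q g) \<otimes> x)) = x" if "x \<in> W" for x
    using that g V(2) by (auto simp: W_def continuous_sectionD(3)[OF s])
  ultimately have "continuous_section W (\<lambda>x. g \<otimes>\<^bsub>G\<^esub> s (inv (q g) \<otimes> x))"
    by (simp add: continuous_section_def)
  moreover have "a \<in> W" using a g x0 V(1)[OF x0] by (auto simp: W_def)
  ultimately show ?thesis by (rule that[rotated])
qed

end

subsection \<open>Averaging over local sections\<close>

definition total_weight :: "'j set \<Rightarrow> ('j \<Rightarrow> 'b \<Rightarrow> real) \<Rightarrow> 'b \<Rightarrow> real" where
  "total_weight A \<rho> x = (\<Sum>a\<in>A. \<rho> a x)"

locale section_charts = group_extension Q T G TG q + discrete_subgroup Q T L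
  for Q :: "('b, 'd) monoid_scheme" (structure) and T :: "'b topology"
    and G :: "('a, 'c) monoid_scheme" and TG :: "'a topology" and q :: "'a \<Rightarrow> 'b" and L :: "'b set" +
  fixes A :: "'j set" and W :: "'j \<Rightarrow> 'b set" and \<sigma> :: "'j \<Rightarrow> 'b \<Rightarrow> 'a" and \<rho> :: "'j \<Rightarrow> 'b \<Rightarrow> real"
  assumes finite_A: "finite A"
    and \<sigma>_section: "\<And>a. a \<in> A \<Longrightarrow> continuous_section (W a) (\<sigma> a)"
    and \<rho>_Cc: "\<And>a. a \<in> A \<Longrightarrow> \<rho> a \<in> Cc_on T (W a)"
    and \<rho>_nonneg: "\<And>a x. a \<in> A \<Longrightarrow> x \<in> carrier Q \<Longrightarrow> 0 \<le> \<rho> a x"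
    and \<rho>_normalized: "\<And>x. x \<in> carrier Q \<Longrightarrow> periodize (total_weight A \<rho>) x = 1"
begin

definition chart_mean :: "('a \<Rightarrow> real) \<Rightarrow> 'b \<Rightarrow> real" where
  "chart_mean u x = (\<Sum>a\<in>A. \<rho> a x * u (\<sigma> a x))"

definition orbit_mean :: "('a \<Rightarrow> real) \<Rightarrow> 'b \<Rightarrow> real" where
  "orbit_mean u = periodize (chart_mean u)"

definition chart_support :: "'b set" where
  "chart_support = (SOME K. compactin T K \<and> (\<forall>a\<in>A. \<forall>x\<in>topspace T. x \<notin> K \<longrightarrow> \<rho> a x = 0))"

lemma chart_support:
  shows chart_support_compact: "compactin T chart_support"
    and \<rho>_eq_0_off_chart_support: "\<forall>a\<in>A. \<forall>x\<in>topspace T. x \<notin> chart_support \<longrightarrow> \<rho> a x = 0"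
proof -
  have "\<forall>a\<in>A. \<exists>K. compactin T K \<and> (\<forall>x\<in>topspace T. x \<notin> K \<longrightarrow> \<rho> a x = 0)"
    using \<rho>_Cc unfolding Cc_on_def by blast
  then obtain K where K: "\<forall>a\<in>A. compactin T (K a) \<and> (\<forall>x\<in>topspace T. x \<notin> K a \<longrightarrow> \<rho> a x = 0)"
    by metis
  have "compactin T (\<Union>a\<in>A. K a)" using K finite_A by (intro compactin_Union) auto
  then have "\<exists>K. compactin T K \<and> (\<forall>a\<in>A. \<forall>x\<in>topspace T. x \<notin> K \<longrightarrow> \<rho> a x = 0)"
    using K by (intro exI[of _ "\<Union>a\<in>A. K a"]) auto
  from someI_ex[OF this] show "compactin T chart_support"
    "\<forall>a\<in>A. \<forall>x\<in>topspace T. x \<notin> chart_support \<longrightarrow> \<rho> a x = 0"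
    unfolding chart_support_def by blast+
qed

lemma \<sigma>_of_support:
  assumes "a \<in> A" "x \<in> carrier Q" "\<rho> a x \<noteq> 0"
  shows "\<sigma> a x \<in> carrier G" "q (\<sigma> a x) = x"
proof -
  have "x \<in> W a" using Cc_on_eq_0[OF \<rho>_Cc[OF assms(1)]] assms(2,3) by auto
  then show "\<sigma> a x \<in> carrier G" "q (\<sigma> a x) = x"
    using continuous_section_carrier[OF \<sigma>_section[OF assms(1)]]
      continuous_sectionD(3)[OF \<sigma>_section[OF assms(1)]]
    by auto
qed

lemma chart_mean_abs_le:
  assumes x: "x \<in> carrier Q" and u: "\<And>s. s \<in> carrier G \<Longrightarrow> q s = x \<Longrightarrow> \<bar>u s\<bar> \<le> E"
  shows "\<bar>chart_mean u x\<bar> \<le> E * total_weight A \<rho> x"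
proof -
  have "\<bar>\<rho> a x * u (\<sigma> a x)\<bar> \<le> E * \<rho> a x" if a: "a \<in> A" for a
  proof (cases "\<rho> a x = 0")
    case False
    have "\<rho> a x * \<bar>u (\<sigma> a x)\<bar> \<le> \<rho> a x * E"
      using u[OF \<sigma>_of_support[OF a x False]] \<rho>_nonneg[OF a x] by (rule mult_left_mono)
    then show ?thesis using \<rho>_nonneg[OF a x] by (simp add: abs_mult mult.commute)
  qed simp
  then show ?thesis unfolding chart_mean_def total_weight_def sum_distrib_left
    by (intro order_trans[OF sum_abs] sum_mono)
qed

lemma chart_mean_diff: "chart_mean (\<lambda>s. u s - v s) x = chart_mean u x - chart_mean v x"
  by (simp add: chart_mean_def right_diff_distrib sum_subtractf)

lemma chart_mean_const: "chart_mean (\<lambda>s. c) = (\<lambda>x. total_weight A \<rho> x * c)"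
  by (simp add: chart_mean_def total_weight_def fun_eq_iff sum_distrib_right)

lemma orbit_mean_eq_sum:
  assumes "x \<in> carrier Q"
  shows "orbit_mean u x = (\<Sum>l | l \<in> L \<and> l \<otimes> x \<in> chart_support. chart_mean u (l \<otimes> x))"
  unfolding orbit_mean_def
  using assms \<rho>_eq_0_off_chart_support L_carrier
  by (intro periodize_eq_sum finite_orbit_Int_compact chart_support_compact) (auto simp: chart_mean_def)

lemma orbit_mean_diff:
  "x \<in> carrier Q \<Longrightarrow> orbit_mean (\<lambda>s. u s - v s) x = orbit_mean u x - orbit_mean v x"
  by (simp add: orbit_mean_eq_sum chart_mean_diff sum_subtractf)

lemma sum_total_weight:
  assumes "x \<in> carrier Q"
  shows "(\<Sum>l | l \<in> L \<and> l \<otimes> x \<in> chart_support. total_weight A \<rho> (l \<otimes> x)) = 1"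
  using orbit_mean_eq_sum[OF assms, of "\<lambda>s. 1"] \<rho>_normalized[OF assms]
  by (simp add: orbit_mean_def chart_mean_const)

lemma orbit_mean_const: "x \<in> carrier Q \<Longrightarrow> orbit_mean (\<lambda>s. c) x = c"
  by (simp add: orbit_mean_eq_sum chart_mean_const sum_total_weight flip: sum_distrib_right)

lemma orbit_mean_abs_le:
  assumes x: "x \<in> carrier Q" and u: "\<And>l s. l \<in> L \<Longrightarrow> s \<in> carrier G \<Longrightarrow> q s = l \<otimes> x \<Longrightarrow> \<bar>u s\<bar> \<le> E"
  shows "\<bar>orbit_mean u x\<bar> \<le> E"
proof -
  have "\<bar>orbit_mean u x\<bar> \<le> (\<Sum>l | l \<in> L \<and> l \<otimes> x \<in> chart_support. E * total_weight A \<rho> (l \<otimes> x))"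
    unfolding orbit_mean_eq_sum[OF x] using x u L_carrier
    by (intro order_trans[OF sum_abs] sum_mono chart_mean_abs_le) auto
  also have "\<dots> = E" using sum_total_weight[OF x] by (simp flip: sum_distrib_left)
  finally show ?thesis .
qed

lemma orbit_mean_translate: "l \<in> L \<Longrightarrow> x \<in> carrier Q \<Longrightarrow> orbit_mean u (l \<otimes> x) = orbit_mean u x"
  unfolding orbit_mean_def by (rule periodize_translate)

end

locale quasimorphism_transfer = section_charts Q T G TG q L A W \<sigma> \<rho> + pos_functional T I
  for Q :: "('b, 'd) monoid_scheme" (structure) and T :: "'b topology"
    and G :: "('a, 'c) monoid_scheme" and TG :: "'a topology" and q :: "'a \<Rightarrow> 'b" and L :: "'b set"
    and A :: "'j set" and W :: "'j \<Rightarrow> 'b set" and \<sigma> :: "'j \<Rightarrow> 'b \<Rightarrow> 'a" and \<rho> :: "'j \<Rightarrow> 'b \<Rightarrow> real"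
    and I :: "('b \<Rightarrow> real) \<Rightarrow> real" +
  fixes f :: "'a \<Rightarrow> real" and E :: real
  assumes I_mass: "I (total_weight A \<rho>) = 1"
    and I_left: "left_invariant L I" and I_right: "right_invariant (carrier Q) I"
    and f_defect: "\<And>x y. x \<in> carrier G \<Longrightarrow> y \<in> carrier G \<Longrightarrow> q x \<in> L \<Longrightarrow> q y \<in> L \<Longrightarrow>
      \<bar>f (x \<otimes>\<^bsub>G\<^esub> y) - f x - f y\<bar> \<le> E"
    and f_continuous: "\<And>l. l \<in> L \<Longrightarrow> continuous_map (subtopology TG {g \<in> carrier G. q g = l}) euclideanreal f"
begin

definition spread :: "'a \<Rightarrow> real" where
  "spread g = orbit_mean (\<lambda>s. f (g \<otimes>\<^bsub>G\<^esub> inv\<^bsub>G\<^esub> s)) (q g)"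

definition transfer :: "'a \<Rightarrow> real" where
  "transfer g = I (chart_mean (\<lambda>s. spread (s \<otimes>\<^bsub>G\<^esub> g)))"

lemma spread_mult:
  assumes \<gamma>: "\<gamma> \<in> carrier G" "q \<gamma> \<in> L" and g: "g \<in> carrier G"
  shows "\<bar>spread (\<gamma> \<otimes>\<^bsub>G\<^esub> g) - f \<gamma> - spread g\<bar> \<le> E"
proof -
  let ?u = "\<lambda>s. f (\<gamma> \<otimes>\<^bsub>G\<^esub> g \<otimes>\<^bsub>G\<^esub> inv\<^bsub>G\<^esub> s)" and ?v = "\<lambda>s. f (g \<otimes>\<^bsub>G\<^esub> inv\<^bsub>G\<^esub> s)"
  have qg: "q g \<in> carrier Q" using g by simp
  have "spread (\<gamma> \<otimes>\<^bsub>G\<^esub> g) = orbit_mean ?u (q g)"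
    unfolding spread_def using \<gamma> g by (simp add: orbit_mean_translate)
  then have "spread (\<gamma> \<otimes>\<^bsub>G\<^esub> g) - f \<gamma> - spread g = orbit_mean (\<lambda>s. ?u s - f \<gamma> - ?v s) (q g)"
    by (simp add: orbit_mean_diff[OF qg] orbit_mean_const[OF qg] spread_def)
  moreover have "\<bar>?u s - f \<gamma> - ?v s\<bar> \<le> E" if l: "l \<in> L" and s: "s \<in> carrier G" "q s = l \<otimes> q g" for l s
  proof -
    have "q (g \<otimes>\<^bsub>G\<^esub> inv\<^bsub>G\<^esub> s) = inv l"
      using s g L_carrier[OF l] by (simp add: inv_mult_group)
    then show ?thesis
      using f_defect[OF \<gamma>(1) _ \<gamma>(2), of "g \<otimes>\<^bsub>G\<^esub> inv\<^bsub>G\<^esub> s"] s(1) g \<gamma>(1) l by (simp add: G.m_assoc)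
  qed
  ultimately show ?thesis using orbit_mean_abs_le[OF qg] by simp
qed

lemma spread_insert_conj:
  assumes conj: "\<And>k. k \<in> carrier G \<Longrightarrow> \<bar>f (k \<otimes>\<^bsub>G\<^esub> h \<otimes>\<^bsub>G\<^esub> inv\<^bsub>G\<^esub> k) - f h\<bar> \<le> D'"
    and h: "h \<in> carrier G" "q h = \<one>" and k: "k \<in> carrier G" and g: "g \<in> carrier G"
  shows "\<bar>spread (k \<otimes>\<^bsub>G\<^esub> h \<otimes>\<^bsub>G\<^esub> g) - f h - spread (k \<otimes>\<^bsub>G\<^esub> g)\<bar> \<le> E + D'"
proof -
  let ?\<gamma> = "k \<otimes>\<^bsub>G\<^esub> h \<otimes>\<^bsub>G\<^esub> inv\<^bsub>G\<^esub> k"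
  have "?\<gamma> \<otimes>\<^bsub>G\<^esub> (k \<otimes>\<^bsub>G\<^esub> g) = k \<otimes>\<^bsub>G\<^esub> h \<otimes>\<^bsub>G\<^esub> g" using h k g by (simp add: G.m_assoc)
  then show ?thesis
    using spread_mult[of ?\<gamma> "k \<otimes>\<^bsub>G\<^esub> g"] conj[OF k] h k g by simp
qed

lemma chart_term_Cc:
  assumes a: "a \<in> A" and b: "b \<in> A" and c: "c \<in> L" and g: "g \<in> carrier G"
  shows "(\<lambda>z. \<rho> a z * \<rho> b (c \<otimes> (z \<otimes> q g)) *
    f (\<sigma> a z \<otimes>\<^bsub>G\<^esub> g \<otimes>\<^bsub>G\<^esub> inv\<^bsub>G\<^esub> (\<sigma> b (c \<otimes> (z \<otimes> q g))))) \<in> Cc T"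
proof -
  let ?s = "\<lambda>z. c \<otimes> (z \<otimes> q g)"
  let ?\<eta> = "\<lambda>z. \<sigma> a z \<otimes>\<^bsub>G\<^esub> g \<otimes>\<^bsub>G\<^esub> inv\<^bsub>G\<^esub> (\<sigma> b (?s z))"
  have cQ: "c \<in> carrier Q" and qg: "q g \<in> carrier Q" using L_carrier[OF c] g by auto
  have s: "continuous_map T T ?s" using cQ qg by (intro continuous_map_group_mult) auto
  define U where "U = W a \<inter> {z \<in> topspace T. ?s z \<in> W b}"
  note section_a = continuous_sectionD[OF \<sigma>_section[OF a]] and section_b = continuous_sectionD[OF \<sigma>_section[OF b]]
  have U: "openin T U" unfolding U_def
    by (intro openin_Int section_a(1) openin_continuous_map_preimage[OF s section_b(1)])
  have "(\<lambda>z. \<rho> b (?s z)) \<in> Cc_on T {z \<in> carrier Q. z \<otimes> q g \<in> {z \<in> carrier Q. c \<otimes> z \<in> W b}}"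
    by (rule Cc_on_right[OF Cc_on_left[OF \<rho>_Cc[OF b] cQ] qg])
  from Cc_on_mult_Int[OF Hausdorff \<rho>_Cc[OF a] this]
  have weight: "(\<lambda>z. \<rho> a z * \<rho> b (?s z)) \<in> Cc_on T U"
    using qg by (simp add: U_def Int_def conj_ac cong: conj_cong)
  have "continuous_map (subtopology T U) (subtopology T (W b)) ?s"
    using s by (auto simp: continuous_map_in_subtopology U_def intro: continuous_map_from_subtopology)
  from continuous_map_compose[OF this section_b(2)]
  have "continuous_map (subtopology T U) TG (\<lambda>z. \<sigma> b (?s z))" by (simp add: o_def)
  moreover have "continuous_map (subtopology T U) TG (\<sigma> a)"
    unfolding U_def by (rule continuous_map_from_subtopology_mono[OF section_a(2)]) auto
  ultimately have \<eta>: "continuous_map (subtopology T U) TG ?\<eta>"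
    using g by (intro G.continuous_map_group_mult G.continuous_map_group_inv) auto
  have "?\<eta> z \<in> carrier G \<and> q (?\<eta> z) = inv c" if "z \<in> U" for z
  proof -
    have z: "z \<in> W a" "?s z \<in> W b" using that by (auto simp: U_def)
    note car = continuous_section_carrier[OF \<sigma>_section[OF a] z(1)]
      continuous_section_carrier[OF \<sigma>_section[OF b] z(2)]
    show ?thesis
      using car g cQ qg section_a(3)[OF z(1)] section_b(3)[OF z(2)] by (simp add: inv_mult_group m_assoc)
  qed
  with \<eta> have "continuous_map (subtopology T U) (subtopology TG {g \<in> carrier G. q g = inv c}) ?\<eta>"
    by (auto simp: continuous_map_in_subtopology)
  from continuous_map_compose[OF this f_continuous] c
  have "continuous_map (subtopology T U) euclideanreal (\<lambda>z. f (?\<eta> z))" by (simp add: o_def)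
  from Cc_on_mult_local[OF Hausdorff U weight this] show ?thesis by (rule Cc_on_imp_Cc)
qed

lemma chart_mean_spread_Cc:
  assumes g: "g \<in> carrier G"
  shows "chart_mean (\<lambda>s. spread (s \<otimes>\<^bsub>G\<^esub> g)) \<in> Cc T"
proof -
  define S where "S = {c \<in> L. \<exists>z\<in>(\<lambda>z. z \<otimes> q g) ` chart_support. c \<otimes> z \<in> chart_support}"
  have S: "finite S"
    unfolding S_def using g
    by (intro finite_returns image_compactin[OF _ continuous_map_right] chart_support_compact) simp
  let ?t = "\<lambda>a b c z. \<rho> a z * \<rho> b (c \<otimes> (z \<otimes> q g)) *
    f (\<sigma> a z \<otimes>\<^bsub>G\<^esub> g \<otimes>\<^bsub>G\<^esub> inv\<^bsub>G\<^esub> (\<sigma> b (c \<otimes> (z \<otimes> q g))))"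
  have expand: "(\<Sum>a\<in>A. \<Sum>c\<in>S. \<Sum>b\<in>A. ?t a b c z) = chart_mean (\<lambda>s. spread (s \<otimes>\<^bsub>G\<^esub> g)) z"
    if z: "z \<in> topspace T" for z
    unfolding chart_mean_def
  proof (rule sum.cong[OF refl])
    fix a assume a: "a \<in> A"
    show "(\<Sum>c\<in>S. \<Sum>b\<in>A. ?t a b c z) = \<rho> a z * spread (\<sigma> a z \<otimes>\<^bsub>G\<^esub> g)"
    proof (cases "\<rho> a z = 0")
      case False
      have zQ: "z \<in> carrier Q" "z \<otimes> q g \<in> carrier Q" using z g by auto
      have z_support: "z \<in> chart_support" using \<rho>_eq_0_off_chart_support a z False by blast
      note \<sigma> = \<sigma>_of_support[OF a zQ(1) False]
      have "spread (\<sigma> a z \<otimes>\<^bsub>G\<^esub> g) =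
          (\<Sum>c\<in>S. chart_mean (\<lambda>s. f (\<sigma> a z \<otimes>\<^bsub>G\<^esub> g \<otimes>\<^bsub>G\<^esub> inv\<^bsub>G\<^esub> s)) (c \<otimes> (z \<otimes> q g)))"
        unfolding spread_def orbit_mean_def q.hom_mult[OF \<sigma>(1) g] \<sigma>(2)
        using S z_support \<rho>_eq_0_off_chart_support zQ L_carrier
        by (intro periodize_eq_sum) (auto simp: S_def chart_mean_def)
      then show ?thesis by (simp add: chart_mean_def sum_distrib_left mult.assoc)
    qed simp
  qed
  have "(\<lambda>z. \<Sum>a\<in>A. \<Sum>c\<in>S. \<Sum>b\<in>A. ?t a b c z) \<in> Cc T"
    by (intro Cc_on_sum finite_A S chart_term_Cc g) (auto simp: S_def)
  then show ?thesis by (rule Cc_on_cong[OF _ expand])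
qed

lemma total_weight_Cc: "total_weight A \<rho> \<in> Cc T"
  unfolding total_weight_def[abs_def] by (rule Cc_on_sum[OF finite_A Cc_on_imp_Cc[OF \<rho>_Cc]])

lemma integral_chart_mean_close:
  assumes u: "chart_mean u \<in> Cc T" and v: "chart_mean v \<in> Cc T" and p: "continuous_map T euclideanreal p"
    and close: "\<And>s. s \<in> carrier G \<Longrightarrow> \<bar>u s - p (q s) - v s\<bar> \<le> E'"
  shows "\<bar>I (chart_mean u) - I (\<lambda>x. total_weight A \<rho> x * p x) - I (chart_mean v)\<bar> \<le> E'"
proof -
  let ?w = "total_weight A \<rho>"
  note wp = Cc_on_mult(1)[OF total_weight_Cc p]
  have "\<bar>chart_mean u x - (?w x * p x + chart_mean v x)\<bar> \<le> E' * ?w x" if x: "x \<in> topspace T" for x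
  proof -
    have "\<bar>chart_mean (\<lambda>s. u s - p x - v s) x\<bar> \<le> E' * ?w x"
      using x close by (intro chart_mean_abs_le) auto
    moreover have "chart_mean (\<lambda>s. u s - p x - v s) x = chart_mean u x - (?w x * p x + chart_mean v x)"
      unfolding chart_mean_diff chart_mean_const by simp
    ultimately show ?thesis by simp
  qed
  then have "\<bar>I (chart_mean u) - I (\<lambda>x. ?w x * p x + chart_mean v x)\<bar> \<le> I (\<lambda>x. E' * ?w x)"
    by (intro I_abs_diff_le u Cc_on_add wp v Cc_on_scale total_weight_Cc)
  then show ?thesis
    using I_add[OF wp v] I_scale[OF total_weight_Cc] I_mass by (simp add: algebra_simps)
qed

lemma transfer_insert:
  assumes conj: "\<And>k. k \<in> carrier G \<Longrightarrow> \<bar>f (k \<otimes>\<^bsub>G\<^esub> h \<otimes>\<^bsub>G\<^esub> inv\<^bsub>G\<^esub> k) - f h\<bar> \<le> D'"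
    and h: "h \<in> carrier G" "q h = \<one>" and x: "x \<in> carrier G" and y: "y \<in> carrier G"
  shows "\<bar>transfer (x \<otimes>\<^bsub>G\<^esub> h \<otimes>\<^bsub>G\<^esub> y) - transfer (x \<otimes>\<^bsub>G\<^esub> y) - f h\<bar> \<le> E + D'"
proof -
  have "\<bar>I (chart_mean (\<lambda>s. spread (s \<otimes>\<^bsub>G\<^esub> (x \<otimes>\<^bsub>G\<^esub> h \<otimes>\<^bsub>G\<^esub> y)))) -
      I (\<lambda>z. total_weight A \<rho> z * f h) - I (chart_mean (\<lambda>s. spread (s \<otimes>\<^bsub>G\<^esub> (x \<otimes>\<^bsub>G\<^esub> y))))\<bar> \<le> E + D'"
  proof (rule integral_chart_mean_close)
    show "\<bar>spread (s \<otimes>\<^bsub>G\<^esub> (x \<otimes>\<^bsub>G\<^esub> h \<otimes>\<^bsub>G\<^esub> y)) - f h - spread (s \<otimes>\<^bsub>G\<^esub> (x \<otimes>\<^bsub>G\<^esub> y))\<bar> \<le> E + D'"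
      if "s \<in> carrier G" for s
      using spread_insert_conj[OF conj h, of "s \<otimes>\<^bsub>G\<^esub> x" y] that h x y by (simp add: G.m_assoc)
  qed (use h x y in \<open>auto intro: chart_mean_spread_Cc\<close>)
  then show ?thesis by (simp add: transfer_def I_scale_right[OF total_weight_Cc] I_mass)
qed

lemma transfer_defect:
  assumes x: "x \<in> carrier G" and y: "y \<in> carrier G"
  shows "\<bar>transfer (x \<otimes>\<^bsub>G\<^esub> y) - transfer x - transfer y\<bar> \<le> E"
proof -
  let ?P = "chart_mean (\<lambda>t. spread (t \<otimes>\<^bsub>G\<^esub> y))"
  have P: "?P \<in> Cc T" "(\<lambda>z. ?P (z \<otimes> q x)) \<in> Cc T"
    using chart_mean_spread_Cc[OF y] x by (auto intro: Cc_right)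
  have per: "periodize (\<lambda>z. ?P (z \<otimes> q x)) z = periodize ?P (z \<otimes> q x)" if "z \<in> carrier Q" for z
    unfolding periodize_def using that x L_carrier by (intro sum.cong) (auto simp: m_assoc)
  let ?p = "periodize (\<lambda>z. ?P (z \<otimes> q x))"
  have "\<bar>spread (s \<otimes>\<^bsub>G\<^esub> (x \<otimes>\<^bsub>G\<^esub> y)) - ?p (q s) - spread (s \<otimes>\<^bsub>G\<^esub> x)\<bar> \<le> E"
    if s: "s \<in> carrier G" for s
  proof -
    have sx: "s \<otimes>\<^bsub>G\<^esub> x \<in> carrier G" "q (s \<otimes>\<^bsub>G\<^esub> x) \<in> carrier Q" using s x by auto
    let ?u = "\<lambda>t. spread (s \<otimes>\<^bsub>G\<^esub> (x \<otimes>\<^bsub>G\<^esub> y)) - spread (t \<otimes>\<^bsub>G\<^esub> y) -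
      f (s \<otimes>\<^bsub>G\<^esub> x \<otimes>\<^bsub>G\<^esub> inv\<^bsub>G\<^esub> t)"
    have "?p (q s) = orbit_mean (\<lambda>t. spread (t \<otimes>\<^bsub>G\<^esub> y)) (q (s \<otimes>\<^bsub>G\<^esub> x))"
      using s x per by (simp add: orbit_mean_def)
    then have "spread (s \<otimes>\<^bsub>G\<^esub> (x \<otimes>\<^bsub>G\<^esub> y)) - ?p (q s) - spread (s \<otimes>\<^bsub>G\<^esub> x) =
        orbit_mean ?u (q (s \<otimes>\<^bsub>G\<^esub> x))"
      by (simp only: orbit_mean_diff[OF sx(2)] orbit_mean_const[OF sx(2)] spread_def[of "s \<otimes>\<^bsub>G\<^esub> x"])
    moreover have "\<bar>?u t\<bar> \<le> E"
      if l: "l \<in> L" and t: "t \<in> carrier G" "q t = l \<otimes> q (s \<otimes>\<^bsub>G\<^esub> x)" for l t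
    proof -
      let ?\<gamma> = "s \<otimes>\<^bsub>G\<^esub> x \<otimes>\<^bsub>G\<^esub> inv\<^bsub>G\<^esub> t"
      have "q ?\<gamma> = q (s \<otimes>\<^bsub>G\<^esub> x) \<otimes> inv (q t)" using sx(1) t(1) by (metis q.hom_mult q.hom_inv G.inv_closed)
      then have "q ?\<gamma> = inv l"
        unfolding t(2) using sx(2) L_carrier[OF l] by (simp add: inv_mult_group del: q.hom_mult)
      moreover have "?\<gamma> \<otimes>\<^bsub>G\<^esub> (t \<otimes>\<^bsub>G\<^esub> y) = s \<otimes>\<^bsub>G\<^esub> (x \<otimes>\<^bsub>G\<^esub> y)"
        using s x y t by (simp add: G.m_assoc)
      ultimately show ?thesis using spread_mult[of ?\<gamma> "t \<otimes>\<^bsub>G\<^esub> y"] sx t y l by (simp add: algebra_simps)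
    qed
    ultimately show ?thesis using orbit_mean_abs_le[OF sx(2)] by simp
  qed
  then have "\<bar>transfer (x \<otimes>\<^bsub>G\<^esub> y) - I (\<lambda>z. total_weight A \<rho> z * ?p z) - transfer x\<bar> \<le> E"
    unfolding transfer_def using x y P
    by (intro integral_chart_mean_close chart_mean_spread_Cc periodize_continuous) auto
  moreover have "I (\<lambda>z. total_weight A \<rho> z * ?p z) = I (\<lambda>z. ?P (z \<otimes> q x))"
    by (rule integral_unfold[OF pos_functional_axioms I_left total_weight_Cc _ P(2)]) (simp add: \<rho>_normalized)
  moreover have "I (\<lambda>z. ?P (z \<otimes> q x)) = transfer y"
    unfolding transfer_def using right_invariantD[OF I_right P(1)] x by simp
  ultimately show ?thesis by linarith
qed

end

locale cocompact_extension = group_extension Q T G TG q + cocompact_lattice Q T L K0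
  for Q :: "('b, 'd) monoid_scheme" (structure) and T :: "'b topology"
    and G :: "('a, 'c) monoid_scheme" and TG :: "'a topology" and q :: "'a \<Rightarrow> 'b" and L K0 :: "'b set"
begin

lemma section_charts_exist:
  assumes "\<forall>x\<in>K0. \<exists>W \<sigma>. x \<in> W \<and> continuous_section W \<sigma>"
  obtains A :: "'b set" and W \<sigma> \<rho>
  where "section_charts Q T G TG q L A W \<sigma> \<rho>" "total_weight A \<rho> \<in> Cc_pos T"
proof -
  obtain W \<sigma> where W: "\<And>x. x \<in> K0 \<Longrightarrow> x \<in> W x" "\<And>x. x \<in> K0 \<Longrightarrow> continuous_section (W x) (\<sigma> x)"
    using assms by metis
  then have W_nbhd: "\<forall>x\<in>K0. openin T (W x) \<and> x \<in> W x"
    using continuous_sectionD(1) by blast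
  obtain A v where A: "finite A" "A \<subseteq> K0" and v: "\<And>a. a \<in> A \<Longrightarrow> v a \<in> Cc_on T (W a)"
    "\<And>a y. a \<in> A \<Longrightarrow> 0 \<le> v a y" "\<And>y. y \<in> K0 \<Longrightarrow> (\<Sum>a\<in>A. v a y) = (1::real)"
    using partition_of_unity[OF K0_compact W_nbhd] by metis
  let ?u = "\<lambda>x. \<Sum>a\<in>A. v a x"
  have u: "?u \<in> Cc_nonneg T" "\<forall>x\<in>K0. 0 < ?u x"
    using v A(1) by (auto simp: Cc_nonneg_def sum_nonneg intro: Cc_on_sum Cc_on_imp_Cc)
  define \<rho> where "\<rho> a x = v a x / periodize ?u x" for a x
  have \<rho>_sum: "total_weight A \<rho> = (\<lambda>x. ?u x / periodize ?u x)"
    by (simp add: total_weight_def fun_eq_iff \<rho>_def sum_divide_distrib)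
  have \<rho>_Cc: "\<rho> a \<in> Cc_on T (W a)" if "a \<in> A" for a
    unfolding \<rho>_def[abs_def] using periodize_pos[OF u]
    by (intro Cc_on_divide[OF v(1)[OF that] periodize_continuous[OF Cc_nonnegD(1)[OF u(1)]]]) fastforce
  have "section_charts Q T G TG q L A W \<sigma> \<rho>"
  proof unfold_locales
    show "continuous_section (W a) (\<sigma> a)" if "a \<in> A" for a using W(2) A(2) that by blast
    show "0 \<le> \<rho> a x" if "a \<in> A" "x \<in> carrier Q" for a x
      unfolding \<rho>_def using v(2)[OF that(1)] periodize_pos[OF u that(2)] by simp
    show "periodize (total_weight A \<rho>) x = 1" if "x \<in> carrier Q" for x
      unfolding \<rho>_sum by (rule periodize_normalized[OF u that])
  qed (use A(1) \<rho>_Cc in auto)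
  moreover have "total_weight A \<rho> \<in> Cc_pos T"
    unfolding \<rho>_sum by (rule normalized_Cc_pos[OF u])
  ultimately show ?thesis by (rule that)
qed

lemma continuous_section_of_closed_cover:
  assumes J: "finite J" and D: "\<And>i. i \<in> J \<Longrightarrow> closedin T (D i)" "K0 \<subseteq> (\<Union>i\<in>J. D i)"
    and s: "\<And>i. i \<in> J \<Longrightarrow> continuous_map (subtopology T (D i)) TG (s i)"
      "\<And>i x. i \<in> J \<Longrightarrow> x \<in> D i \<Longrightarrow> q (s i x) = x"
  obtains V \<sigma> x where "continuous_section V \<sigma>" "x \<in> V"
proof -
  obtain i where i: "i \<in> J" "T interior_of D i \<noteq> {}"
    using closed_cover_has_interior[OF J D] by blast
  have sub: "T interior_of D i \<subseteq> D i" by (rule interior_of_subset)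
  have "continuous_section (T interior_of D i) (s i)"
    using s(2)[OF i(1)] sub continuous_map_from_subtopology_mono[OF s(1)[OF i(1)] sub]
    by (auto simp: continuous_section_def)
  then show ?thesis using i(2) that by blast
qed

end

locale split_quasimorphism = group_extension Q T G TG q + discrete_subgroup Q T L
  for Q :: "('b, 'd) monoid_scheme" (structure) and T :: "'b topology"
    and G :: "('a, 'c) monoid_scheme" and TG :: "'a topology" and q :: "'a \<Rightarrow> 'b" and L :: "'b set" +
  fixes s1 :: "'b \<Rightarrow> 'a" and \<phi> :: "'a \<Rightarrow> real" and D D' :: real
  assumes s1_hom: "s1 \<in> hom (Q\<lparr>carrier := L\<rparr>) G"
    and s1_section: "\<And>l. l \<in> L \<Longrightarrow> q (s1 l) = l"
    and \<phi>_continuous: "continuous_map (subtopology TG (kernel G Q q)) euclideanreal \<phi>"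
    and \<phi>_defect: "\<And>x y. x \<in> kernel G Q q \<Longrightarrow> y \<in> kernel G Q q \<Longrightarrow>
      \<bar>\<phi> (x \<otimes>\<^bsub>G\<^esub> y) - \<phi> x - \<phi> y\<bar> \<le> D"
    and \<phi>_conj: "\<And>g x. g \<in> carrier G \<Longrightarrow> x \<in> kernel G Q q \<Longrightarrow>
      \<bar>\<phi> (g \<otimes>\<^bsub>G\<^esub> x \<otimes>\<^bsub>G\<^esub> inv\<^bsub>G\<^esub> g) - \<phi> x\<bar> \<le> D'"
begin

lemma s1_carrier [simp]: "l \<in> L \<Longrightarrow> s1 l \<in> carrier G"
  using s1_hom by (auto simp: hom_def)

lemma s1_mult: "l \<in> L \<Longrightarrow> m \<in> L \<Longrightarrow> s1 (l \<otimes> m) = s1 l \<otimes>\<^bsub>G\<^esub> s1 m"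
  using s1_hom by (auto simp: hom_def)

lemma s1_one: "s1 \<one> = \<one>\<^bsub>G\<^esub>"
  using s1_mult[of \<one> \<one>] by simp

definition lattice_extension :: "'a \<Rightarrow> real" where
  "lattice_extension g = \<phi> (g \<otimes>\<^bsub>G\<^esub> inv\<^bsub>G\<^esub> (s1 (q g)))"

lemma straightened_kernel:
  assumes "g \<in> carrier G" "q g \<in> L"
  shows "g \<otimes>\<^bsub>G\<^esub> inv\<^bsub>G\<^esub> (s1 (q g)) \<in> kernel G Q q"
  using assms by (simp add: kernel_def s1_section)

lemma lattice_extension_kernel: "h \<in> kernel G Q q \<Longrightarrow> lattice_extension h = \<phi> h"
  by (auto simp: lattice_extension_def kernel_def s1_one)

lemma conj_kernel:
  assumes "g \<in> carrier G" "h \<in> kernel G Q q"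
  shows "g \<otimes>\<^bsub>G\<^esub> h \<otimes>\<^bsub>G\<^esub> inv\<^bsub>G\<^esub> g \<in> kernel G Q q"
  using assms by (auto simp: kernel_def)

lemma lattice_extension_defect:
  assumes x: "x \<in> carrier G" "q x \<in> L" and y: "y \<in> carrier G" "q y \<in> L"
  shows "\<bar>lattice_extension (x \<otimes>\<^bsub>G\<^esub> y) - lattice_extension x - lattice_extension y\<bar> \<le> D + D'"
proof -
  let ?g = "s1 (q x)"
  let ?x = "x \<otimes>\<^bsub>G\<^esub> inv\<^bsub>G\<^esub> ?g" and ?y = "y \<otimes>\<^bsub>G\<^esub> inv\<^bsub>G\<^esub> (s1 (q y))"
  have "x \<otimes>\<^bsub>G\<^esub> y \<otimes>\<^bsub>G\<^esub> inv\<^bsub>G\<^esub> (s1 (q (x \<otimes>\<^bsub>G\<^esub> y))) =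
      ?x \<otimes>\<^bsub>G\<^esub> (?g \<otimes>\<^bsub>G\<^esub> ?y \<otimes>\<^bsub>G\<^esub> inv\<^bsub>G\<^esub> ?g)"
    using x y by (simp add: s1_mult G.inv_mult_group G.m_assoc)
  moreover have "?g \<in> carrier G" using x(2) by simp
  moreover note straightened_kernel[OF x] straightened_kernel[OF y]
  ultimately show ?thesis
    using \<phi>_defect[of ?x "?g \<otimes>\<^bsub>G\<^esub> ?y \<otimes>\<^bsub>G\<^esub> inv\<^bsub>G\<^esub> ?g"] \<phi>_conj[of ?g ?y] conj_kernel[of ?g ?y]
    unfolding lattice_extension_def by auto
qed

lemma lattice_extension_continuous:
  assumes l: "l \<in> L"
  shows "continuous_map (subtopology TG {g \<in> carrier G. q g = l}) euclideanreal lattice_extension"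
proof -
  let ?F = "{g \<in> carrier G. q g = l}"
  have "continuous_map (subtopology TG ?F) TG (\<lambda>g. g \<otimes>\<^bsub>G\<^esub> inv\<^bsub>G\<^esub> (s1 l))"
    using l by (intro G.continuous_map_group_mult) auto
  then have "continuous_map (subtopology TG ?F) (subtopology TG (kernel G Q q))
      (\<lambda>g. g \<otimes>\<^bsub>G\<^esub> inv\<^bsub>G\<^esub> (s1 l))"
    using straightened_kernel l by (auto simp: continuous_map_in_subtopology)
  from continuous_map_compose[OF this \<phi>_continuous] show ?thesis
    by (rule continuous_map_eq) (auto simp: lattice_extension_def)
qed

lemma defect_bounds_nonneg: "0 \<le> D" "0 \<le> D'"
proof -
  have "\<one>\<^bsub>G\<^esub> \<in> kernel G Q q" by (simp add: kernel_def)
  then show "0 \<le> D" "0 \<le> D'"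
    using \<phi>_defect[of "\<one>\<^bsub>G\<^esub>" "\<one>\<^bsub>G\<^esub>"] \<phi>_conj[of "\<one>\<^bsub>G\<^esub>" "\<one>\<^bsub>G\<^esub>"] by auto
qed

lemma extension_by_transfer:
  assumes charts: "section_charts Q T G TG q L A W \<sigma> \<rho>"
    and I: "pos_functional T I" "I (total_weight A \<rho>) = 1"
    "left_invariant L I" "right_invariant (carrier Q) I"
  obtains \<psi> where "\<And>h. h \<in> kernel G Q q \<Longrightarrow> \<psi> h = \<phi> h"
    "\<And>x y. x \<in> carrier G \<Longrightarrow> y \<in> carrier G \<Longrightarrow> \<bar>\<psi> (x \<otimes>\<^bsub>G\<^esub> y) - \<psi> x - \<psi> y\<bar> \<le> D + 2 * D'"
proof -
  interpret section_charts Q T G TG q L A W \<sigma> \<rho> by (rule charts)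
  interpret pos_functional T I by (rule I)
  interpret quasimorphism_transfer Q T G TG q L A W \<sigma> \<rho> I lattice_extension "D + D'"
    by unfold_locales (use I(2-) lattice_extension_defect lattice_extension_continuous in auto)
  have conj: "\<bar>lattice_extension (k \<otimes>\<^bsub>G\<^esub> h \<otimes>\<^bsub>G\<^esub> inv\<^bsub>G\<^esub> k) - lattice_extension h\<bar> \<le> D'"
    if "k \<in> carrier G" "h \<in> kernel G Q q" for k h
    using \<phi>_conj[OF that] by (simp add: lattice_extension_kernel conj_kernel that)
  have transfer_kernel: "\<bar>transfer (x \<otimes>\<^bsub>G\<^esub> h \<otimes>\<^bsub>G\<^esub> y) - transfer (x \<otimes>\<^bsub>G\<^esub> y) - \<phi> h\<bar> \<le> D + 2 * D'"
    if h: "h \<in> kernel G Q q" and "x \<in> carrier G" "y \<in> carrier G" for h x y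
    using transfer_insert[OF conj[OF _ h], of x y] that
    by (auto simp: kernel_def lattice_extension_kernel[OF h])
  show ?thesis
  proof (rule G.quasimorphism_extension_from_approximation[of "kernel G Q q" \<phi> "D + 2 * D'" transfer])
    show "subgroup (kernel G Q q) G" by (rule q.subgroup_kernel)
    fix x y assume x: "x \<in> carrier G" and y: "y \<in> carrier G"
    show "\<bar>transfer (x \<otimes>\<^bsub>G\<^esub> y) - transfer x - transfer y\<bar> \<le> D + 2 * D'"
      using transfer_defect[OF x y] defect_bounds_nonneg by simp
  next
    fix h x assume h: "h \<in> kernel G Q q" and x: "x \<in> carrier G"
    have hG: "h \<in> carrier G" using h by (simp add: kernel_def)
    show "\<bar>transfer (h \<otimes>\<^bsub>G\<^esub> x) - transfer x - \<phi> h\<bar> \<le> D + 2 * D'"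
      using transfer_kernel[OF h, of "\<one>\<^bsub>G\<^esub>" x] x hG by simp
    show "\<bar>transfer (x \<otimes>\<^bsub>G\<^esub> h) - transfer x - \<phi> h\<bar> \<le> D + 2 * D'"
      using transfer_kernel[OF h x, of "\<one>\<^bsub>G\<^esub>"] x hG by simp
  next
    show "\<bar>\<phi> (h \<otimes>\<^bsub>G\<^esub> k) - \<phi> h - \<phi> k\<bar> \<le> D + 2 * D'"
      if "h \<in> kernel G Q q" "k \<in> kernel G Q q" for h k
      using \<phi>_defect[OF that] defect_bounds_nonneg by simp
  qed (rule that)
qed

end

lemma quasimorphism_extension_over_cocompact_lattice:
  fixes Q :: "('b, 'd) monoid_scheme" and G :: "('a, 'c) monoid_scheme" and T :: "'b topology"
  assumes "split_quasimorphism Q T G TG q L s1 \<phi> D D'" and "cocompact_lattice Q T L K0"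
    and surj: "q ` carrier G = carrier Q"
    and s: "group_extension.continuous_section T TG q V s" "x0 \<in> V"
  obtains \<psi> where "\<And>h. h \<in> kernel G Q q \<Longrightarrow> \<psi> h = \<phi> h"
    "\<And>x y. x \<in> carrier G \<Longrightarrow> y \<in> carrier G \<Longrightarrow> \<bar>\<psi> (x \<otimes>\<^bsub>G\<^esub> y) - \<psi> x - \<psi> y\<bar> \<le> D + 2 * D'"
proof -
  interpret split_quasimorphism Q T G TG q L s1 \<phi> D D' by fact
  interpret cocompact_lattice Q T L K0 by fact
  interpret cocompact_extension Q T G TG q L K0 ..
  have "\<forall>a\<in>K0. \<exists>W \<sigma>. a \<in> W \<and> continuous_section W \<sigma>"
  proof
    fix a assume "a \<in> K0"
    then have a: "a \<in> carrier Q" by (rule compactin_carrier[OF K0_compact])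
    have x0: "x0 \<in> carrier Q" by (rule continuous_section_carrier[OF s])
    have "a \<otimes>\<^bsub>Q\<^esub> inv\<^bsub>Q\<^esub> x0 \<in> q ` carrier G" unfolding surj using a x0 by simp
    then obtain g where "g \<in> carrier G" "q g \<otimes>\<^bsub>Q\<^esub> x0 = a" using a x0 by (auto simp: m_assoc dest: sym)
    from continuous_section_translate[OF s this] show "\<exists>W \<sigma>. a \<in> W \<and> continuous_section W \<sigma>" by blast
  qed
  then obtain A :: "'b set" and W \<sigma> \<rho>
    where charts: "section_charts Q T G TG q L A W \<sigma> \<rho>" "total_weight A \<rho> \<in> Cc_pos T"
    by (rule section_charts_exist) (rule that)
  obtain I where I: "pos_functional T I" "I (total_weight A \<rho>) = 1"
    "left_invariant (carrier Q) I" "right_invariant (carrier Q) I"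
    by (rule bi_invariant_functional[OF charts(2)]) (rule that)
  show ?thesis
    by (rule extension_by_transfer[OF charts(1) I(1,2) left_invariant_subset[OF I(3) L_subset] I(4)])
      (rule that)
qed

subsection \<open>The extension theorem\<close>

lemma top_groupI: "topological_group G T \<Longrightarrow> top_group G T"
  by (simp add: top_group_def top_group_axioms_def topological_group_def)

lemma lc_groupI:
  "topological_group G T \<Longrightarrow> Hausdorff_space T \<Longrightarrow> locally_compact_space T \<Longrightarrow> lc_group G T"
  by (simp add: lc_group_def lc_space_def top_groupI)

lemma cocompact_lattice_of_fundamental_domain:
  assumes Q: "lc_group Q T" and L: "subgroup L Q" "subtopology T L = discrete_topology L"
    and B: "strict_fundamental_domain Q L B" "compactin T (T closure_of B)"
  shows "cocompact_lattice Q T L (T closure_of B)"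
proof -
  interpret lc_group Q T by (rule Q)
  have sub: "B \<subseteq> T closure_of B"
    using B(1) by (intro closure_of_subset) (simp add: strict_fundamental_domain_def)
  show ?thesis
  proof (intro cocompact_lattice.intro discrete_subgroup.intro discrete_subgroup_axioms.intro
      cocompact_lattice_axioms.intro Q L B(2))
    show "\<exists>l\<in>L. l \<otimes>\<^bsub>Q\<^esub> x \<in> T closure_of B" if "x \<in> carrier Q" for x
    proof -
      have "\<exists>!b. b \<in> B \<and> (\<exists>l\<in>L. b = l \<otimes>\<^bsub>Q\<^esub> x)"
        using B(1) that by (simp add: strict_fundamental_domain_def)
      then show ?thesis using sub by blast
    qed
  qed
qed

lemma le_defect:
  assumes "quasimorphism_on G H \<phi>" "x \<in> H" "y \<in> H"
  shows "\<bar>\<phi> (x \<otimes>\<^bsub>G\<^esub> y) - \<phi> x - \<phi> y\<bar> \<le> defect G H \<phi>"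
proof -
  have "bdd_above ((\<lambda>p. \<bar>\<phi> (fst p \<otimes>\<^bsub>G\<^esub> snd p) - \<phi> (fst p) - \<phi> (snd p)\<bar>) ` (H \<times> H))"
    using assms(1) by (auto simp: quasimorphism_on_def bdd_above_def)
  from cSUP_upper[OF _ this, of "(x, y)"] show ?thesis using assms(2,3) by (simp add: defect_def)
qed

lemma defect_le:
  assumes "H \<noteq> {}" "\<And>x y. x \<in> H \<Longrightarrow> y \<in> H \<Longrightarrow> \<bar>\<phi> (x \<otimes>\<^bsub>G\<^esub> y) - \<phi> x - \<phi> y\<bar> \<le> C"
  shows "defect G H \<phi> \<le> C"
  unfolding defect_def using assms by (intro cSUP_least) auto

lemma le_qi_defect:
  assumes "quasi_invariant G H \<phi>" "g \<in> carrier G" "x \<in> H"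
  shows "\<bar>\<phi> (g \<otimes>\<^bsub>G\<^esub> x \<otimes>\<^bsub>G\<^esub> inv\<^bsub>G\<^esub> g) - \<phi> x\<bar> \<le> qi_defect G H \<phi>"
  unfolding qi_defect_def
  by (rule cInf_greatest) (use assms in \<open>auto simp: quasi_invariant_def\<close>)

lemma qi_defect_nonneg: "quasi_invariant G H \<phi> \<Longrightarrow> 0 \<le> qi_defect G H \<phi>"
  unfolding qi_defect_def by (rule cInf_greatest) (auto simp: quasi_invariant_def)

theorem theorem6p1:
  fixes Ghat :: "'a monoid" and TG :: "'a topology" and H :: "'a set"
    and Q :: "'b monoid" and TQ :: "'b topology" and q :: "'a \<Rightarrow> 'b"
    and L :: "'b set" and s1 :: "'b \<Rightarrow> 'a"
    and B :: "'b set" and p :: nat and Bs :: "nat \<Rightarrow> 'b set" and s2 :: "nat \<Rightarrow> 'b \<Rightarrow> 'a"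
    and \<phi> :: "'a \<Rightarrow> real"
  assumes topG: "topological_group Ghat TG"
    and subH: "subgroup H Ghat"
    and topQ: "topological_group Q TQ"
    and HausQ: "Hausdorff_space TQ"
    and lcQ: "locally_compact_space TQ"
    and q_hom: "q \<in> hom Ghat Q"
    and q_surj: "q ` carrier Ghat = carrier Q"
    and q_ker: "{x \<in> carrier Ghat. q x = \<one>\<^bsub>Q\<^esub>} = H"
    and subL: "subgroup L Q"
    and discL: "subtopology TQ L = discrete_topology L"
    and s1_hom: "s1 \<in> hom (Q\<lparr>carrier := L\<rparr>) Ghat"
    and s1_sec: "\<forall>l\<in>L. q (s1 l) = l"
    and fdB: "strict_fundamental_domain Q L B"
    and relcB: "compactin TQ (TQ closure_of B)"
    and Bs_union: "(\<Union>i\<in>{1..p}. Bs i) = B"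
    and Bs_disj: "\<forall>i\<in>{1..p}. \<forall>j\<in>{1..p}. i \<noteq> j \<longrightarrow> Bs i \<inter> Bs j = {}"
    and Bs_borel: "\<forall>i\<in>{1..p}. Bs i \<in> borel_sets_of TQ"
    and s2_cont: "\<forall>i\<in>{1..p}. continuous_map (subtopology TQ (TQ closure_of Bs i)) TG (s2 i)"
    and s2_sec: "\<forall>i\<in>{1..p}. \<forall>x\<in>TQ closure_of Bs i. q (s2 i x) = x"
    and qm: "quasimorphism_on Ghat H \<phi>"
    and qi: "quasi_invariant Ghat H \<phi>"
    and cont: "continuous_map (subtopology TG H) euclideanreal \<phi>"
  shows "\<exists>\<psi>. quasimorphism_on Ghat (carrier Ghat) \<psi> \<and> (\<forall>x\<in>H. \<psi> x = \<phi> x) \<and>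
           defect Ghat (carrier Ghat) \<psi> \<le> defect Ghat H \<phi> + 3 * qi_defect Ghat H \<phi>"
proof -
  let ?K = "TQ closure_of B"
  have ker: "kernel Ghat Q q = H" using q_ker by (simp add: kernel_def)
  interpret group_extension Q TQ Ghat TG q
    by (intro group_extension.intro group_extension_axioms.intro lc_groupI top_groupI) fact+
  interpret cocompact_lattice Q TQ L ?K
    by (rule cocompact_lattice_of_fundamental_domain[OF lc_group_axioms]) fact+
  interpret cocompact_extension Q TQ Ghat TG q L ?K ..
  have K: "?K = (\<Union>i\<in>{1..p}. TQ closure_of Bs i)"
    unfolding Bs_union[symmetric] by (simp add: closure_of_Union)
  obtain V \<sigma> x where chart: "continuous_section V \<sigma>" "x \<in> V"
    by (rule continuous_section_of_closed_cover[of "{1..p}" "\<lambda>i. TQ closure_of Bs i" s2])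
      (use K s2_cont s2_sec in auto)
  have "split_quasimorphism Q TQ Ghat TG q L s1 \<phi> (defect Ghat H \<phi>) (qi_defect Ghat H \<phi>)"
    by unfold_locales (use s1_hom s1_sec cont le_defect[OF qm] le_qi_defect[OF qi] in \<open>auto simp: ker\<close>)
  then obtain \<psi> where \<psi>: "\<And>h. h \<in> H \<Longrightarrow> \<psi> h = \<phi> h"
    "\<And>x y. x \<in> carrier Ghat \<Longrightarrow> y \<in> carrier Ghat \<Longrightarrow>
      \<bar>\<psi> (x \<otimes>\<^bsub>Ghat\<^esub> y) - \<psi> x - \<psi> y\<bar> \<le> defect Ghat H \<phi> + 2 * qi_defect Ghat H \<phi>"
    by (rule quasimorphism_extension_over_cocompact_lattice[OF _ cocompact_lattice_axioms q_surj chart,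
          unfolded ker]) (rule that)
  have "quasimorphism_on Ghat (carrier Ghat) \<psi>" using \<psi>(2) unfolding quasimorphism_on_def by blast
  moreover have "defect Ghat (carrier Ghat) \<psi> \<le> defect Ghat H \<phi> + 2 * qi_defect Ghat H \<phi>"
    using \<psi>(2) by (intro defect_le) auto
  ultimately show ?thesis using \<psi>(1) qi_defect_nonneg[OF qi] by (intro exI[of _ \<psi>]) auto
qed

end
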